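(* Let $G$ be a finite group, $p$ an odd prime divisor of $|G|$ with $(p-1,|G|)=1$, and $S$ a Sylow $p$-subgroup of $G$. Assume that there is a subgroup $D$ of $S$ with $1<|D|<|S|$ such that every subgroup of $S$ of order $|D|$ is abelian and satisfies the $S$-subnormalizer condition in $G$. Then $G$ is $p$-nilpotent.
   Context: For a finite group $G$ and $S\in\mathrm{Syl}_p(G)$, a subgroup $H\le S$ satisfies the $S$-subnormalizer condition in $G$ if $N_G(K)\le N_G(H)$ for every subgroup $K$ with $H\le K\le S$. *)

theory Defs
  imports "HOL-Algebra.Algebra"
begin

definition sylow_subgroup :: "('a, 'b) monoid_scheme \<Rightarrow> nat \<Rightarrow> 'a set \<Rightarrow> bool" where
  "sylow_subgroup G p S \<longleftrightarrow> subgroup S G \<and> card S = p ^ multiplicity p (order G)"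

text \<open>A subgroup \<open>H \<le> S\<close> satisfies the \<open>S\<close>-subnormalizer condition in \<open>G\<close>. All subgroups are
  regarded as subgroups of \<open>G\<close> contained in \<open>S\<close>, so that both normalizers are taken in \<open>G\<close>.\<close>

definition subnormalizer_condition ::
  "('a, 'b) monoid_scheme \<Rightarrow> 'a set \<Rightarrow> 'a set \<Rightarrow> bool" where
  "subnormalizer_condition G S H \<longleftrightarrow>
     subgroup H G \<and> H \<subseteq> S \<and>
     (\<forall>K. subgroup K G \<and> H \<subseteq> K \<and> K \<subseteq> S \<longrightarrow> normalizer G K \<subseteq> normalizer G H)"

text \<open>A finite group is \<open>p\<close>-nilpotent if it has a normal \<open>p\<close>-complement: a normal subgroup of order
  prime to \<open>p\<close> whose index is a power of \<open>p\<close>.\<close>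

definition p_nilpotent :: "('a, 'b) monoid_scheme \<Rightarrow> nat \<Rightarrow> bool" where
  "p_nilpotent G p \<longleftrightarrow>
     (\<exists>N. N \<lhd> G \<and> coprime (card N) p \<and> (\<exists>n. card (rcosets\<^bsub>G\<^esub> N) = p ^ n))"

end

theory Submission
  imports Defs "HOL-Number_Theory.Residues"
begin

text \<open>Let \<open>d\<close> be the order of \<open>D\<close>. Since \<open>N\<^bsub>G\<^esub>(S)\<close> normalises every subgroup \<open>H \<le> S\<close> of order \<open>d\<close>, a Sylow argument in
  the normaliser of a conjugate of \<open>H\<close> shows that \<open>H\<close> is weakly closed in \<open>S\<close>. By Frobenius' criterion
  (Sylow intersections give control of fusion, then transfer) it suffices that for every \<open>p\<close>-subgroup \<open>Q\<close>
  each element \<open>x\<close> of \<open>N\<^bsub>G\<^esub>(Q)\<close> of prime power order prime to \<open>p\<close> centralises \<open>Q\<close>.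

  If \<open>|Q| > d\<close>, then \<open>x\<close> normalises all subgroups of \<open>Q\<close> of order \<open>d\<close>. As \<open>(p - 1, |G|) = 1\<close>, it acts
  trivially on \<open>L / M\<close> for every \<open>M\<close> of index \<open>p\<close> in a subgroup \<open>L\<close> of order \<open>p d\<close>, hence on \<open>L\<close>; so \<open>x\<close>
  centralises all elements of order \<open>p\<close>, and \<open>p\<close> is odd. If \<open>|Q| < d\<close>, an abelian \<open>H \<ge> Q\<close> of order \<open>d\<close> lies
  in \<open>C\<^bsub>G\<^esub>(Q)\<close>, and weak closure of \<open>H\<close> gives \<open>N\<^bsub>G\<^esub>(Q) \<subseteq> C\<^bsub>G\<^esub>(Q) N\<^bsub>G\<^esub>(H)\<close>.

  The critical case is \<open>|Q| = d\<close> with \<open>Q\<close> not cyclic. Take \<open>L = Q\<langle>t\<rangle>\<close> of order \<open>p d\<close> with \<open>t\<close> in a second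
  maximal subgroup \<open>M\<close> of \<open>L\<close>. As \<open>M\<close> is abelian, \<open>t\<close> acts on \<open>Q\<close> as a transvection with axis \<open>M \<inter> Q\<close>, and
  since \<open>|G|\<close> is odd two such transvections generate a \<open>p\<close>-group modulo \<open>C\<^bsub>G\<^esub>(Q)\<close>. Hence \<open>L\<close> and each of its
  conjugates under \<open>N\<^bsub>G\<^esub>(Q)\<close> lie, up to \<open>C\<^bsub>G\<^esub>(Q)\<close>, in a common Sylow subgroup, and weak closure of \<open>L\<close> reduces
  the claim to the larger group \<open>L\<close>.\<close>

section \<open>Conjugation, normalisers, centralisers and p-subgroups in a finite group\<close>

locale finite_group = group G for G (structure) +
  assumes finite_carrier [simp]: "finite (carrier G)"
begin

definition cj :: "'a \<Rightarrow> 'a \<Rightarrow> 'a" where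
  "cj g x = g \<otimes> x \<otimes> inv g"

text \<open>One inclusion is enough: conjugation is injective, so on a finite set inclusion is
  equality and this is the usual normaliser.\<close>

definition Nor :: "'a set \<Rightarrow> 'a set" where
  "Nor H = {g \<in> carrier G. \<forall>h\<in>H. cj g h \<in> H}"

definition Cen :: "'a set \<Rightarrow> 'a set" where
  "Cen H = {g \<in> carrier G. \<forall>h\<in>H. cj g h = h}"

definition p_subgroup :: "nat \<Rightarrow> 'a set \<Rightarrow> bool" where
  "p_subgroup p H \<longleftrightarrow> subgroup H G \<and> (\<exists>n. card H = p ^ n)"

text \<open>The Sylow subgroups of a subgroup \<open>M\<close> stay subsets of the ambient group, so
  that Sylow arguments inside normalisers and centralisers need no change of group. By Lagrange the
  quotient is the index of \<open>P\<close> in \<open>M\<close>.\<close>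

definition sylow_in :: "nat \<Rightarrow> 'a set \<Rightarrow> 'a set \<Rightarrow> bool" where
  "sylow_in p M P \<longleftrightarrow> p_subgroup p P \<and> P \<subseteq> M \<and> \<not> p dvd card M div card P"

definition p_element :: "nat \<Rightarrow> 'a \<Rightarrow> bool" where
  "p_element q x \<longleftrightarrow> x \<in> carrier G \<and> (\<exists>k. x [^] (q ^ k) = \<one>)"

lemma inv_mult_cancel_left [simp]:
  "x \<in> carrier G \<Longrightarrow> y \<in> carrier G \<Longrightarrow> inv x \<otimes> (x \<otimes> y) = y"
  by (simp add: m_assoc [symmetric])

lemma mult_inv_cancel_left [simp]:
  "x \<in> carrier G \<Longrightarrow> y \<in> carrier G \<Longrightarrow> x \<otimes> (inv x \<otimes> y) = y"
  by (simp add: m_assoc [symmetric])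

lemma cj_closed [simp, intro]:
  "g \<in> carrier G \<Longrightarrow> x \<in> carrier G \<Longrightarrow> cj g x \<in> carrier G"
  by (simp add: cj_def)

lemma cj_mult:
  "g \<in> carrier G \<Longrightarrow> x \<in> carrier G \<Longrightarrow> y \<in> carrier G \<Longrightarrow> cj g (x \<otimes> y) = cj g x \<otimes> cj g y"
  by (simp add: cj_def m_assoc)

lemma cj_cj:
  "g \<in> carrier G \<Longrightarrow> h \<in> carrier G \<Longrightarrow> x \<in> carrier G \<Longrightarrow> cj g (cj h x) = cj (g \<otimes> h) x"
  by (simp add: cj_def m_assoc inv_mult_group)

lemma cj_one_left [simp]: "x \<in> carrier G \<Longrightarrow> cj \<one> x = x"
  by (simp add: cj_def)

lemma cj_one [simp]: "g \<in> carrier G \<Longrightarrow> cj g \<one> = \<one>"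
  by (simp add: cj_def)

lemma cj_inv:
  "g \<in> carrier G \<Longrightarrow> x \<in> carrier G \<Longrightarrow> cj g (inv x) = inv (cj g x)"
  by (simp add: cj_def m_assoc inv_mult_group)

lemma cj_pow:
  "g \<in> carrier G \<Longrightarrow> x \<in> carrier G \<Longrightarrow> cj g (x [^] (n::nat)) = cj g x [^] n"
  by (induction n) (simp_all add: cj_mult)

lemma cj_inv_cancel [simp]:
  "g \<in> carrier G \<Longrightarrow> x \<in> carrier G \<Longrightarrow> cj (inv g) (cj g x) = x"
  "g \<in> carrier G \<Longrightarrow> x \<in> carrier G \<Longrightarrow> cj g (cj (inv g) x) = x"
  by (simp_all add: cj_cj)

lemma cj_inj:
  "g \<in> carrier G \<Longrightarrow> x \<in> carrier G \<Longrightarrow> y \<in> carrier G \<Longrightarrow> cj g x = cj g y \<longleftrightarrow> x = y"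
  using cj_inv_cancel(1) by metis

lemma cj_inj_on: "g \<in> carrier G \<Longrightarrow> H \<subseteq> carrier G \<Longrightarrow> inj_on (cj g) H"
  by (simp add: inj_on_def cj_inj subset_iff)

lemma cj_fixed_iff:
  "g \<in> carrier G \<Longrightarrow> x \<in> carrier G \<Longrightarrow> cj g x = x \<longleftrightarrow> g \<otimes> x = x \<otimes> g"
  unfolding cj_def by (metis inv_solve_right' m_closed)

lemma cj_fixed_pow:
  assumes "g \<in> carrier G" "x \<in> carrier G" "cj g x = x"
  shows "cj (g [^] (n::nat)) x = x"
  using assms by (induction n) (simp_all add: cj_cj [symmetric])

lemma cj_fixed_inv:
  assumes "g \<in> carrier G" "x \<in> carrier G" "cj g x = x"
  shows "cj (inv g) x = x"
  using assms by (metis cj_inv_cancel(1))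

lemma finite_sub [simp]: "H \<subseteq> carrier G \<Longrightarrow> finite H"
  using finite_carrier finite_subset by blast

lemma subgroup_finite: "subgroup H G \<Longrightarrow> finite H"
  by (simp add: subgroup.subset)

lemma subgroup_card_pos: "subgroup H G \<Longrightarrow> 0 < card H"
  by (simp add: subgroup.finite_imp_card_positive)

lemma subgroup_memD: "subgroup H G \<Longrightarrow> x \<in> H \<Longrightarrow> x \<in> carrier G"
  by (rule subgroup.mem_carrier)

lemma subgroup_pow: "subgroup H G \<Longrightarrow> x \<in> H \<Longrightarrow> x [^] (n::nat) \<in> H"
  by (induction n) (auto simp: subgroup.one_closed subgroup.m_closed)

lemma pow_card_eq_one:
  assumes "subgroup H G" "x \<in> H"
  shows "x [^] card H = \<one>"
proof -
  interpret H: group "G\<lparr>carrier := H\<rparr>" using assms by (simp add: subgroup_imp_group)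
  have "x [^]\<^bsub>G\<lparr>carrier := H\<rparr>\<^esub> order (G\<lparr>carrier := H\<rparr>) = \<one>\<^bsub>G\<lparr>carrier := H\<rparr>\<^esub>"
    using assms by (intro H.pow_order_eq_1) auto
  then show ?thesis by (simp add: order_def nat_pow_consistent [symmetric])
qed

lemma pow_eq_one_inv:
  assumes "x \<in> carrier G" obtains n :: nat where "inv x = x [^] n"
proof -
  have "x [^] order G = \<one>" using assms pow_order_eq_1 by blast
  moreover have "order G > 0" by (simp add: order_gt_0_iff_finite)
  ultimately have "x [^] (order G - 1) \<otimes> x = \<one>"
    by (metis Suc_pred' nat_pow_Suc)
  then have "inv x = x [^] (order G - 1)"
    using assms by (metis inv_equality nat_pow_closed)
  then show ?thesis using that by blast
qed

text \<open>In a finite group inverses are powers, so closure under products suffices.\<close>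

lemma subgroupI_finite:
  assumes "H \<subseteq> carrier G" "\<one> \<in> H" "\<And>x y. x \<in> H \<Longrightarrow> y \<in> H \<Longrightarrow> x \<otimes> y \<in> H"
  shows "subgroup H G"
proof (rule subgroupI)
  fix x assume x: "x \<in> H"
  have "x [^] (n::nat) \<in> H" for n by (induction n) (use assms x in auto)
  then show "inv x \<in> H" using assms(1) x pow_eq_one_inv by (metis subsetD)
qed (use assms in auto)

lemma card_subgroup_dvd:
  assumes "subgroup H G" "subgroup K G" "H \<subseteq> K"
  shows "card H dvd card K"
proof -
  interpret K: group "G\<lparr>carrier := K\<rparr>" using assms by (simp add: subgroup_imp_group)
  have "subgroup H (G\<lparr>carrier := K\<rparr>)" using assms by (simp add: subgroup_incl)
  from K.lagrange[OF this] have "card K = card (rcosets\<^bsub>G\<lparr>carrier := K\<rparr>\<^esub> H) * card H"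
    by (simp add: order_def)
  then show ?thesis by (rule dvdI[OF trans[OF _ mult.commute]])
qed

lemma coprime_pow_eq_one:
  assumes "x \<in> carrier G" "x [^] (m::nat) = \<one>" "x [^] (n::nat) = \<one>" "coprime m n"
  shows "x = \<one>"
proof -
  have "ord x dvd m" "ord x dvd n" using assms by (auto simp: pow_eq_id)
  then have "ord x = 1" using assms(4) by (metis coprime_common_divisor_nat)
  then show ?thesis using assms(1) by (metis One_nat_def ord_eq_1)
qed

lemma Nor_subgroup: assumes "H \<subseteq> carrier G" shows "subgroup (Nor H) G"
proof (rule subgroupI_finite)
  show "Nor H \<subseteq> carrier G" by (auto simp: Nor_def)
  show "\<one> \<in> Nor H" using assms by (auto simp: Nor_def subsetD)
  fix x y assume "x \<in> Nor H" "y \<in> Nor H"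
  then show "x \<otimes> y \<in> Nor H" using assms unfolding Nor_def
    by (auto simp: cj_cj[symmetric] subsetD)
qed

lemma Cen_subgroup: assumes "H \<subseteq> carrier G" shows "subgroup (Cen H) G"
proof (rule subgroupI_finite)
  show "Cen H \<subseteq> carrier G" by (auto simp: Cen_def)
  show "\<one> \<in> Cen H" using assms by (auto simp: Cen_def subsetD)
  fix x y assume "x \<in> Cen H" "y \<in> Cen H"
  then show "x \<otimes> y \<in> Cen H" using assms unfolding Cen_def
    by (auto simp: cj_cj[symmetric] subsetD)
qed

lemma Cen_carrier: "g \<in> Cen H \<Longrightarrow> g \<in> carrier G" by (simp add: Cen_def)
lemma Nor_carrier: "g \<in> Nor H \<Longrightarrow> g \<in> carrier G" by (simp add: Nor_def)
lemma Cen_subset_Nor: "Cen H \<subseteq> Nor H" by (auto simp: Cen_def Nor_def)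
lemma Cen_antimono: "H \<subseteq> K \<Longrightarrow> Cen K \<subseteq> Cen H" by (auto simp: Cen_def)

lemma Nor_image:
  assumes "g \<in> Nor H" "H \<subseteq> carrier G" shows "cj g ` H = H"
  using assms by (intro endo_inj_surj) (auto simp: Nor_def intro!: cj_inj_on)

lemma NorI_image: "g \<in> carrier G \<Longrightarrow> cj g ` H \<subseteq> H \<Longrightarrow> g \<in> Nor H"
  by (auto simp: Nor_def)

lemma cj_image_image:
  assumes "g \<in> carrier G" "h \<in> carrier G" "H \<subseteq> carrier G"
  shows "cj g ` cj h ` H = cj (g \<otimes> h) ` H"
  using assms by (auto simp: image_image cj_cj subsetD intro!: image_cong)

lemma cj_image_one [simp]: "H \<subseteq> carrier G \<Longrightarrow> cj \<one> ` H = H"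
  by (auto simp: subsetD image_iff)

lemma card_cj_image: "g \<in> carrier G \<Longrightarrow> H \<subseteq> carrier G \<Longrightarrow> card (cj g ` H) = card H"
  by (simp add: card_image cj_inj_on)

lemma subgroup_cj_image:
  assumes "g \<in> carrier G" "subgroup H G" shows "subgroup (cj g ` H) G"
proof (rule subgroupI_finite)
  show "cj g ` H \<subseteq> carrier G" using assms by (auto simp: subgroup_memD)
  show "\<one> \<in> cj g ` H" using assms subgroup.one_closed by (metis cj_one imageI)
  fix x y assume "x \<in> cj g ` H" "y \<in> cj g ` H"
  then obtain a b where "a \<in> H" "b \<in> H" "x = cj g a" "y = cj g b" by blast
  then show "x \<otimes> y \<in> cj g ` H" using assms
    by (auto simp: cj_mult[symmetric] subgroup_memD subgroup.m_closed)
qed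

lemma subgroup_subset_Nor: "subgroup H G \<Longrightarrow> H \<subseteq> Nor H"
  unfolding Nor_def cj_def by (auto simp: subgroup.m_closed subgroup.m_inv_closed subgroup_memD)

lemma Cen_normal_in_Nor:
  assumes "g \<in> Nor H" "c \<in> Cen H" "H \<subseteq> carrier G"
  shows "cj g c \<in> Cen H"
proof -
  have "cj (cj g c) h = h" if h: "h \<in> H" for h
  proof -
    have g: "inv g \<in> Nor H" by (rule subgroup.m_inv_closed[OF Nor_subgroup]) (use assms in auto)
    have hc: "h \<in> carrier G" "c \<in> carrier G" "g \<in> carrier G" using assms h by (auto simp: Cen_def Nor_def)
    have "cj (cj g c) h = cj g (cj c (cj (inv g) h))" using hc by (simp add: cj_cj) (simp add: cj_def m_assoc)
    also have "cj c (cj (inv g) h) = cj (inv g) h" using assms g h by (auto simp: Cen_def Nor_def)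
    finally show ?thesis using hc by simp
  qed
  then show ?thesis using assms by (auto simp: Cen_def Nor_def)
qed

lemma normalizer_eq_Nor:
  assumes "subgroup H G" shows "normalizer G H = Nor H"
proof -
  have H: "H \<subseteq> carrier G" using assms subgroup.subset by blast
  have "g <# H #> inv g = cj g ` H" for g
    by (auto simp: l_coset_def r_coset_def cj_def)
  then have "normalizer G H = {g \<in> carrier G. cj g ` H = H}"
    using H by (simp add: normalizer_def stabilizer_def)
  also have "\<dots> = Nor H" using Nor_image[OF _ H] NorI_image[of _ H] Nor_carrier[of _ H] by auto
  finally show ?thesis .
qed

lemma p_subgroup_subgroup: "p_subgroup p H \<Longrightarrow> subgroup H G" by (simp add: p_subgroup_def)
lemma p_subgroup_subset: "p_subgroup p H \<Longrightarrow> H \<subseteq> carrier G"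
  by (simp add: p_subgroup_def subgroup.subset)

lemma p_subgroup_mono:
  assumes "p_subgroup p H" "subgroup K G" "K \<subseteq> H" "Factorial_Ring.prime p"
  shows "p_subgroup p K"
proof -
  have "card K dvd card H" using assms card_subgroup_dvd p_subgroup_def by blast
  then show ?thesis using assms by (metis divides_primepow_nat p_subgroup_def)
qed

lemma p_subgroup_cj:
  "g \<in> carrier G \<Longrightarrow> p_subgroup p H \<Longrightarrow> p_subgroup p (cj g ` H)"
  by (auto simp: p_subgroup_def subgroup_cj_image card_cj_image subgroup.subset)

lemma p_subgroup_element: "p_subgroup p H \<Longrightarrow> x \<in> H \<Longrightarrow> p_element p x"
  unfolding p_subgroup_def p_element_def by (metis pow_card_eq_one subgroup_memD)

section \<open>Orbits of \<open>p\<close>-groups and Sylow subgroups\<close>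

text \<open>The moved points form a union of orbits; by the orbit-stabiliser theorem each has
  p-power size, and none of them is a single point.\<close>

lemma p_group_moved_points:
  assumes K: "p_subgroup p K" and p: "Factorial_Ring.prime p" and fin: "finite Y"
    and closed: "\<And>k x. k \<in> K \<Longrightarrow> x \<in> Y \<Longrightarrow> \<phi> k x \<in> Y"
    and one: "\<And>x. x \<in> Y \<Longrightarrow> \<phi> \<one> x = x"
    and mult: "\<And>k l x. k \<in> K \<Longrightarrow> l \<in> K \<Longrightarrow> x \<in> Y \<Longrightarrow> \<phi> (k \<otimes> l) x = \<phi> k (\<phi> l x)"
  shows "p dvd card {x \<in> Y. \<exists>k\<in>K. \<phi> k x \<noteq> x}"
proof -
  have sK: "subgroup K G" using K by (rule p_subgroup_subgroup)
  let ?K = "G\<lparr>carrier := K\<rparr>"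
  \<comment> \<open>\<open>Bij Y\<close> contains only functions that are \<open>undefined\<close>
    outside \<open>Y\<close>; restriction brings the given maps into this form.\<close>
  define \<psi> where "\<psi> k = restrict (\<phi> k) Y" for k
  interpret K: group ?K using sK by (rule subgroup_imp_group)
  have inv: "\<phi> (inv k) (\<phi> k x) = x" "\<phi> k (\<phi> (inv k) x) = x" if "k \<in> K" "x \<in> Y" for k x
    using that sK one mult[of "inv k" k x] mult[of k "inv k" x]
    by (auto simp: subgroup_memD subgroup.m_inv_closed)
  have bij: "\<psi> k \<in> Bij Y" if "k \<in> K" for k
    unfolding Bij_def \<psi>_def using that inv closed sK
    by (auto intro!: bij_betwI[where g = "\<phi> (inv k)"] simp: subgroup.m_inv_closed)
  have "group_hom ?K (BijGroup Y) \<psi>"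
  proof (intro group_hom.intro group_hom_axioms.intro)
    show "group ?K" by (rule K.group_axioms)
    show "group (BijGroup Y)" by (rule group_BijGroup)
    show "\<psi> \<in> hom ?K (BijGroup Y)"
    proof (rule homI)
      fix k l assume "k \<in> carrier ?K" "l \<in> carrier ?K"
      then show "\<psi> (k \<otimes>\<^bsub>?K\<^esub> l) = \<psi> k \<otimes>\<^bsub>BijGroup Y\<^esub> \<psi> l"
        using bij mult closed by (auto simp: BijGroup_def compose_def \<psi>_def fun_eq_iff)
    qed (use bij in \<open>auto simp: BijGroup_def\<close>)
  qed
  then interpret A: group_action ?K Y \<psi> by (simp add: group_action_def)
  let ?M = "{x \<in> Y. \<exists>k\<in>K. \<phi> k x \<noteq> x}"
  have orb: "orbit ?K \<psi> x = (\<lambda>k. \<phi> k x) ` K" if "x \<in> Y" for x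
    using that by (auto simp: orbit_def \<psi>_def)
  have orbM: "orbit ?K \<psi> x \<subseteq> ?M" if x: "x \<in> ?M" for x
  proof
    fix y assume "y \<in> orbit ?K \<psi> x"
    then obtain l where l: "l \<in> K" "y = \<phi> l x" using orb x by auto
    have yX: "y \<in> Y" using l x closed by auto
    have "\<exists>k\<in>K. \<phi> k y \<noteq> y"
    proof (rule ccontr)
      assume "\<not> ?thesis"
      then have fx: "\<phi> k y = y" if "k \<in> K" for k using that by blast
      have "x = y" using fx[of "inv l"] inv(1)[of l x] l x sK by (auto simp: subgroup.m_inv_closed)
      then show False using fx x by auto
    qed
    then show "y \<in> ?M" using yX by simp
  qed
  have dvd: "p dvd card (orbit ?K \<psi> x)" if x: "x \<in> ?M" for x
  proof -
    have "card (orbit ?K \<psi> x) * card (stabilizer ?K \<psi> x) = order ?K"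
      using A.orbit_stabilizer_theorem x by blast
    then have "card K = card (orbit ?K \<psi> x) * card (stabilizer ?K \<psi> x)" by (simp add: order_def)
    then have "card (orbit ?K \<psi> x) dvd card K" by (rule dvdI)
    then obtain i where i: "card (orbit ?K \<psi> x) = p ^ i"
      using K p by (metis divides_primepow_nat p_subgroup_def)
    have "i \<noteq> 0"
    proof
      assume "i = 0"
      then obtain y where y: "orbit ?K \<psi> x = {y}" using i card_1_singletonE by (metis power_0)
      have "\<phi> k x = y" if "k \<in> K" for k using orb[of x] x y that by auto
      moreover have "\<one> \<in> K" using sK by (rule subgroup.one_closed)
      ultimately show False using x one by auto
    qed
    then show ?thesis using i by simp
  qed
  have "?M = \<Union>(orbit ?K \<psi> ` ?M)"
    using orbM A.orbit_refl by blast
  moreover have "p dvd card (\<Union>(orbit ?K \<psi> ` ?M))"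
  proof (rule dvd_partition)
    show "finite (\<Union> (orbit ?K \<psi> ` ?M))" using fin orbM by (metis (no_types, lifting) UN_least finite_subset mem_Collect_eq subsetI)
    show "\<forall>c\<in>orbit ?K \<psi> ` ?M. p dvd card c" using dvd by blast
    show "\<forall>c1\<in>orbit ?K \<psi> ` ?M. \<forall>c2\<in>orbit ?K \<psi> ` ?M. c1 \<noteq> c2 \<longrightarrow> c1 \<inter> c2 = {}"
    proof (intro ballI impI)
      fix c1 c2 assume "c1 \<in> orbit ?K \<psi> ` ?M" "c2 \<in> orbit ?K \<psi> ` ?M" "c1 \<noteq> c2"
      then have "c1 \<in> orbits ?K Y \<psi>" "c2 \<in> orbits ?K Y \<psi>" by (auto simp: orbits_def)
      then show "c1 \<inter> c2 = {}" using A.disjoint_union \<open>c1 \<noteq> c2\<close> by blast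
    qed
  qed
  ultimately show ?thesis by simp
qed

lemma p_group_fixed_points:
  assumes "p_subgroup p K" "Factorial_Ring.prime p" "finite Y"
    and "\<And>k x. k \<in> K \<Longrightarrow> x \<in> Y \<Longrightarrow> \<phi> k x \<in> Y"
    and "\<And>x. x \<in> Y \<Longrightarrow> \<phi> \<one> x = x"
    and "\<And>k l x. k \<in> K \<Longrightarrow> l \<in> K \<Longrightarrow> x \<in> Y \<Longrightarrow> \<phi> (k \<otimes> l) x = \<phi> k (\<phi> l x)"
  shows "p dvd card Y \<longleftrightarrow> p dvd card {x \<in> Y. \<forall>k\<in>K. \<phi> k x = x}"
proof -
  let ?F = "{x \<in> Y. \<forall>k\<in>K. \<phi> k x = x}" and ?M = "{x \<in> Y. \<exists>k\<in>K. \<phi> k x \<noteq> x}"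
  have "p dvd card ?M" by (rule p_group_moved_points) (use assms in auto)
  moreover have "card Y = card ?M + card ?F"
    using assms(3) by (subst card_Un_disjoint[symmetric]) (auto intro: arg_cong[where f = card])
  ultimately show ?thesis by (simp add: dvd_add_right_iff)
qed

lemma card_rcosets_in:
  assumes "subgroup P G" "subgroup M G" "P \<subseteq> M"
  shows "card ((\<lambda>g. P #> g) ` M) * card P = card M"
proof -
  interpret M: group "G\<lparr>carrier := M\<rparr>" using assms by (simp add: subgroup_imp_group)
  have "subgroup P (G\<lparr>carrier := M\<rparr>)" using assms by (simp add: subgroup_incl)
  from M.lagrange[OF this]
  have "card (rcosets\<^bsub>G\<lparr>carrier := M\<rparr>\<^esub> P) * card P = card M" by (simp add: order_def)
  moreover have "rcosets\<^bsub>G\<lparr>carrier := M\<rparr>\<^esub> P = (\<lambda>g. P #> g) ` M"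
    by (auto simp: RCOSETS_def)
  ultimately show ?thesis by simp
qed

lemma rcos_eq_iff:
  assumes "subgroup P G" "x \<in> carrier G" "y \<in> carrier G"
  shows "P #> x = P #> y \<longleftrightarrow> x \<otimes> inv y \<in> P"
  using assms
  by (metis repr_independence rcos_self subgroup.rcos_module group_axioms)

text \<open>\<open>K\<close> acts on the cosets of \<open>P\<close> in \<open>M\<close>. Their
  number is prime to \<open>p\<close>, so some coset \<open>P #> g\<close> is fixed, and then
  conjugation by \<open>g\<close> maps \<open>K\<close> into \<open>P\<close>.\<close>

lemma sylow_contains:
  assumes p: "Factorial_Ring.prime p" and M: "subgroup M G" and P: "sylow_in p M P"
    and K: "p_subgroup p K" "K \<subseteq> M"
  obtains g where "g \<in> M" "K \<subseteq> cj g ` P"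
proof -
  have sP: "subgroup P G" "P \<subseteq> M" and ndvd: "\<not> p dvd card M div card P"
    using P by (auto simp: sylow_in_def p_subgroup_def)
  \<comment> \<open>The inverse turns right multiplication of right cosets into a left
    action.\<close>
  let ?Y = "(\<lambda>g. P #> g) ` M" and ?\<phi> = "\<lambda>k Y. Y #> inv k"
  have Mc: "g \<in> M \<Longrightarrow> g \<in> carrier G" for g using M by (rule subgroup_memD)
  have Kc: "k \<in> K \<Longrightarrow> k \<in> carrier G" for k using K Mc by blast
  have P_sub: "P \<subseteq> carrier G" using sP by (simp add: subgroup.subset)
  have act: "?\<phi> k (P #> g) = P #> (g \<otimes> inv k)" if "k \<in> K" "g \<in> M" for k g
    using that Mc Kc P_sub by (simp add: coset_mult_assoc)
  have "p dvd card ?Y \<longleftrightarrow> p dvd card {Y \<in> ?Y. \<forall>k\<in>K. ?\<phi> k Y = Y}"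
  proof (rule p_group_fixed_points[OF K(1) p])
    show "finite ?Y" using M by (simp add: subgroup_finite)
    show "?\<phi> k Y \<in> ?Y" if "k \<in> K" "Y \<in> ?Y" for k Y
    proof -
      from that(2) obtain g where g: "g \<in> M" "Y = P #> g" by auto
      have "g \<otimes> inv k \<in> M" using g that K M by (meson subgroup.m_closed subgroup.m_inv_closed subsetD)
      then show ?thesis using act g that by auto
    qed
    show "?\<phi> \<one> Y = Y" if "Y \<in> ?Y" for Y
      using that Mc P_sub by (auto simp: r_coset_subset_G)
    show "?\<phi> (k \<otimes> l) Y = ?\<phi> k (?\<phi> l Y)" if "k \<in> K" "l \<in> K" "Y \<in> ?Y" for k l Y
      using that Mc Kc P_sub
      by (auto simp: coset_mult_assoc inv_mult_group r_coset_subset_G m_assoc)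
  qed
  moreover have "\<not> p dvd card ?Y"
    using card_rcosets_in[OF sP(1) M sP(2)] ndvd subgroup_card_pos[OF sP(1)]
    by (metis nonzero_mult_div_cancel_right not_gr_zero)
  ultimately have "{Y \<in> ?Y. \<forall>k\<in>K. ?\<phi> k Y = Y} \<noteq> {}" by (metis card.empty dvd_0_right)
  then obtain g where g: "g \<in> M" "\<And>k. k \<in> K \<Longrightarrow> ?\<phi> k (P #> g) = P #> g" by auto
  have gc: "g \<in> carrier G" using g Mc by blast
  have "k \<in> cj (inv g) ` P" if k: "k \<in> K" for k
  proof -
    have kc: "k \<in> carrier G" using k Kc by blast
    have "P #> (g \<otimes> inv k) = P #> g" using act g k by simp
    then have "g \<otimes> inv k \<otimes> inv g \<in> P" using rcos_eq_iff[OF sP(1)] gc kc by simp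
    then have "inv (cj g k) \<in> P" using gc kc by (simp add: cj_def inv_mult_group m_assoc)
    then have "cj g k \<in> P" using sP(1) gc kc by (metis cj_closed inv_inv subgroup.m_inv_closed)
    then show ?thesis using gc kc by (metis cj_inv_cancel(1) imageI)
  qed
  then show ?thesis using that[of "inv g"] g M by (meson subgroup.m_inv_closed subsetI)
qed

lemma sylow_in_card:
  assumes "Factorial_Ring.prime p" "subgroup M G" "sylow_in p M P"
  shows "card P = p ^ multiplicity p (card M)"
proof -
  obtain n where n: "card P = p ^ n" and P: "subgroup P G" "P \<subseteq> M" "\<not> p dvd card M div card P"
    using assms by (auto simp: sylow_in_def p_subgroup_def)
  have "card P dvd card M" using P assms card_subgroup_dvd by blast
  then have M: "card M = p ^ n * (card M div card P)" using n by simp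
  have "multiplicity p (card M) = n"
  proof (rule multiplicity_eqI)
    show "p ^ n dvd card M" using M by (rule dvdI)
    have "p ^ n \<noteq> 0" using n subgroup_card_pos[OF P(1)] by simp
    then have "p ^ Suc n dvd p ^ n * (card M div card P) \<longleftrightarrow> p dvd card M div card P"
      unfolding power_Suc2 by (rule dvd_times_left_cancel_iff)
    then show "\<not> p ^ Suc n dvd card M" using P(3) by (subst M) blast
  qed
  then show ?thesis using n by simp
qed

lemma sylow_inI:
  assumes "Factorial_Ring.prime p" "subgroup M G" "subgroup P G" "P \<subseteq> M"
    "card P = p ^ multiplicity p (card M)"
  shows "sylow_in p M P"
proof -
  have "card M \<noteq> 0" using assms subgroup_card_pos by fastforce
  then have "\<not> p dvd card M div card P" using assms
    by (metis multiplicity_decompose not_prime_unit)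
  then show ?thesis using assms by (auto simp: sylow_in_def p_subgroup_def)
qed

lemma sylow_exists:
  assumes p: "Factorial_Ring.prime p" and M: "subgroup M G"
  obtains P where "sylow_in p M P"
proof -
  let ?M = "G\<lparr>carrier := M\<rparr>"
  have "order ?M = p ^ multiplicity p (card M) * (card M div p ^ multiplicity p (card M))"
    by (simp add: order_def multiplicity_dvd)
  moreover have "finite (carrier ?M)" using subgroup_finite[OF M] by simp
  ultimately obtain P where P: "subgroup P ?M" "card P = p ^ multiplicity p (card M)"
    using sylow_thm[OF p subgroup_imp_group[OF M]] by blast
  moreover have "subgroup P G" "P \<subseteq> M"
    using incl_subgroup[OF M P(1)] subgroup.subset[OF P(1)] by auto
  ultimately show ?thesis using that sylow_inI[OF p M] by blast
qed

lemma sylow_in_cj: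
  assumes "subgroup M G" "sylow_in p M P" "g \<in> M"
  shows "sylow_in p M (cj g ` P)"
proof -
  have P: "P \<subseteq> carrier G" "P \<subseteq> M" using assms p_subgroup_subset by (auto simp: sylow_in_def)
  have "g \<in> carrier G" using assms by (simp add: subgroup_memD)
  moreover have "cj g ` P \<subseteq> M" using assms P subgroup_subset_Nor[of M] by (auto simp: Nor_def)
  ultimately show ?thesis using assms P by (auto simp: sylow_in_def p_subgroup_cj card_cj_image)
qed

lemma sylow_above:
  assumes p: "Factorial_Ring.prime p" and M: "subgroup M G" and K: "p_subgroup p K" "K \<subseteq> M"
  obtains P where "sylow_in p M P" "K \<subseteq> P"
  using assms by (metis sylow_contains sylow_exists sylow_in_cj)

lemma sylow_conj:
  assumes p: "Factorial_Ring.prime p" and M: "subgroup M G"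
    and P: "sylow_in p M P" and Q: "sylow_in p M Q"
  obtains g where "g \<in> M" "Q = cj g ` P"
proof -
  have "p_subgroup p Q" "Q \<subseteq> M" using Q by (auto simp: sylow_in_def)
  then obtain g where g: "g \<in> M" "Q \<subseteq> cj g ` P" using sylow_contains[OF p M P] by blast
  have P': "sylow_in p M (cj g ` P)" using g M P sylow_in_cj by blast
  then have "card (cj g ` P) = card Q" using sylow_in_card[OF p M] Q by metis
  moreover have "finite (cj g ` P)" using P' by (auto simp: sylow_in_def dest: p_subgroup_subset)
  ultimately have "Q = cj g ` P" using g by (metis card_subset_eq)
  then show ?thesis using that g by blast
qed

lemma sylow_in_mono:
  assumes "sylow_in p M P" "subgroup M G" "subgroup K G" "P \<subseteq> K" "K \<subseteq> M"
  shows "sylow_in p K P"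
proof -
  have P: "subgroup P G" "\<not> p dvd card M div card P" using assms by (auto simp: sylow_in_def p_subgroup_def)
  have "card P dvd card K" "card K dvd card M" using assms P card_subgroup_dvd by auto
  then have "card K div card P dvd card M div card P" using subgroup_card_pos[OF P(1)]
    by (auto elim!: dvdE)
  then show ?thesis using assms P by (auto simp: sylow_in_def)
qed

text \<open>\<open>K\<close> permutes the cosets of \<open>U\<close> in \<open>T\<close> by
  conjugation. Their number is divisible by \<open>p\<close> and the coset \<open>U\<close> is
  fixed, so a further coset is fixed as well.\<close>

lemma p_group_fixed_coset:
  assumes p: "Factorial_Ring.prime p" and K: "p_subgroup p K" "K \<subseteq> Nor U" "K \<subseteq> Nor T"
    and U: "subgroup U G" and T: "subgroup T G" and UT: "U \<subseteq> T" and dvd: "p dvd card T div card U"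
  obtains z where "z \<in> T - U" "\<And>k. k \<in> K \<Longrightarrow> cj k z \<otimes> inv z \<in> U"
proof -
  let ?Y = "(\<lambda>g. U #> g) ` T" and ?\<phi> = "\<lambda>k Y. cj k ` Y"
  let ?F = "{Y \<in> ?Y. \<forall>k\<in>K. ?\<phi> k Y = Y}"
  have Kc: "k \<in> K \<Longrightarrow> k \<in> carrier G" for k using K p_subgroup_subset by blast
  have Tc: "g \<in> T \<Longrightarrow> g \<in> carrier G" for g using T by (rule subgroup_memD)
  have Uc: "g \<in> U \<Longrightarrow> g \<in> carrier G" for g using U by (rule subgroup_memD)
  have act: "?\<phi> k (U #> g) = U #> cj k g" if "k \<in> K" "g \<in> T" for k g
  proof -
    have "cj k ` U = U" using Nor_image K that U by (meson subgroup.subset subsetD)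
    moreover have "?\<phi> k (U #> g) = (cj k ` U) #> cj k g"
      unfolding r_coset_def using that Kc Tc Uc by (auto simp: cj_mult[symmetric])
    ultimately show ?thesis by simp
  qed
  have "p dvd card ?Y \<longleftrightarrow> p dvd card ?F"
  proof (rule p_group_fixed_points[OF K(1) p])
    show "finite ?Y" using T by (simp add: subgroup_finite)
    show "?\<phi> k Y \<in> ?Y" if "k \<in> K" "Y \<in> ?Y" for k Y
      using that act K by (auto simp: Nor_def)
    have sub: "Y \<subseteq> carrier G" if "Y \<in> ?Y" for Y
      using that U Tc by (auto dest: subgroup.elemrcos_carrier[OF _ group_axioms])
    show "?\<phi> \<one> Y = Y" if "Y \<in> ?Y" for Y using sub[OF that] by simp
    show "?\<phi> (k \<otimes> l) Y = ?\<phi> k (?\<phi> l Y)" if "k \<in> K" "l \<in> K" "Y \<in> ?Y" for k l Y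
      using sub that Kc by (simp add: cj_image_image)
  qed
  moreover have "p dvd card ?Y"
    using card_rcosets_in[OF U T UT] dvd subgroup_card_pos[OF U]
    by (metis nonzero_mult_div_cancel_right not_gr_zero)
  ultimately have dF: "p dvd card ?F" by blast
  have finF: "finite ?F" using T by (simp add: subgroup_finite)
  have UF: "U \<in> ?F"
  proof -
    have "U = U #> \<one>" using U by (simp add: subgroup.subset)
    moreover have "\<one> \<in> T" using T by (rule subgroup.one_closed)
    ultimately have "U \<in> ?Y" by (rule image_eqI)
    moreover have "cj k ` U = U" if "k \<in> K" for k using Nor_image K that U by (meson subgroup.subset subsetD)
    ultimately show ?thesis by blast
  qed
  have "?F \<noteq> {U}" using dF p by (metis is_singletonI is_singleton_altdef not_prime_unit nat_dvd_1_iff_1 prime_nat_iff)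
  then obtain Y where "Y \<in> ?F" "Y \<noteq> U" using UF by blast
  then obtain z where z: "z \<in> T" "U #> z \<noteq> U" "\<And>k. k \<in> K \<Longrightarrow> ?\<phi> k (U #> z) = U #> z" by auto
  have "z \<notin> U" using z U coset_join2 Uc by blast
  moreover have "cj k z \<otimes> inv z \<in> U" if "k \<in> K" for k
    using z act[of k z] that rcos_eq_iff[OF U, of "cj k z" z] Tc Kc by simp
  ultimately show ?thesis using that z by blast
qed

section \<open>Extension of a subgroup by one normalising element\<close>

text \<open>Bezout writes \<open>z\<close> as a product of a power of \<open>z [^] m\<close> and a
  power of the inverse of \<open>z [^] n\<close>.\<close>

lemma pow_mem_coprime:
  assumes U: "subgroup U G" and z: "z \<in> carrier G" "z [^] (m::nat) \<in> U" "z [^] (n::nat) \<in> U"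
    and "coprime m n"
  shows "z \<in> U"
proof (cases "m = 0")
  case True
  then have "n = 1" using assms by simp
  then show ?thesis using z by simp
next
  case False
  then obtain x y where xy: "m * x = n * y + 1" using bezout_nat[of m n] assms(5) by auto
  have "z [^] (m * x) \<in> U" "z [^] (n * y) \<in> U"
    using subgroup_pow[OF U z(2), of x] subgroup_pow[OF U z(3), of y] z by (simp_all add: nat_pow_pow)
  moreover have "z [^] (m * x) = z [^] (n * y) \<otimes> z" using xy by simp
  ultimately have "inv (z [^] (n * y)) \<otimes> (z [^] (n * y) \<otimes> z) \<in> U"
    using U by (metis subgroup.m_closed subgroup.m_inv_closed)
  then show ?thesis using z by simp
qed

lemma Nor_pow: "z \<in> Nor U \<Longrightarrow> U \<subseteq> carrier G \<Longrightarrow> z [^] (n::nat) \<in> Nor U"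
  using Nor_subgroup subgroup_pow by blast

lemma cyclic_extension_subgroup:
  assumes U: "subgroup U G" and z: "z \<in> Nor U"
  shows "subgroup {u \<otimes> z [^] (i::nat) |u i. u \<in> U} G" (is "subgroup ?V G")
proof (rule subgroupI_finite)
  have Uc: "U \<subseteq> carrier G" using U by (simp add: subgroup.subset)
  have zc: "z \<in> carrier G" using z by (rule Nor_carrier)
  show "?V \<subseteq> carrier G" using zc Uc by auto
  have "\<one> = \<one> \<otimes> z [^] (0::nat)" by simp
  then show "\<one> \<in> ?V" using U subgroup.one_closed by blast
  fix x y assume "x \<in> ?V" "y \<in> ?V"
  then obtain u v :: 'a and i j :: nat where uv: "u \<in> U" "v \<in> U" "x = u \<otimes> z [^] i" "y = v \<otimes> z [^] j" by blast
  have "x \<otimes> y = (u \<otimes> cj (z [^] i) v) \<otimes> z [^] (i + j)"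
    using uv zc Uc by (simp add: cj_def m_assoc subsetD nat_pow_mult[symmetric])
  moreover have "u \<otimes> cj (z [^] i) v \<in> U"
    using uv Nor_pow[OF z Uc] U by (auto simp: Nor_def subgroup.m_closed)
  ultimately show "x \<otimes> y \<in> ?V" by blast
qed

definition index_p :: "nat \<Rightarrow> 'a set \<Rightarrow> 'a set \<Rightarrow> bool" where
  "index_p p L M \<longleftrightarrow> subgroup L G \<and> subgroup M G \<and> M \<subseteq> L \<and> card L = p * card M"

text \<open>The cosets of the powers of \<open>z\<close> with exponent below \<open>p\<close>
  exhaust the extension. Two equal ones would put a power of \<open>z\<close> with exponent strictly
  between 0 and \<open>p\<close> into \<open>U\<close>; with \<open>z [^] p\<close> in
  \<open>U\<close> this forces \<open>z\<close> into \<open>U\<close>.\<close>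

lemma cyclic_extension_index:
  assumes p: "Factorial_Ring.prime p" and U: "subgroup U G" and z: "z \<in> Nor U" "z \<notin> U" "z [^] p \<in> U"
  shows "index_p p {u \<otimes> z [^] (i::nat) |u i. u \<in> U} U" (is "index_p p ?V U")
proof -
  have Uc: "U \<subseteq> carrier G" using U by (simp add: subgroup.subset)
  have zc: "z \<in> carrier G" using z by (auto dest: Nor_carrier)
  have p0: "p > 0" using p by (simp add: prime_gt_0_nat)
  have V: "subgroup ?V G" using cyclic_extension_subgroup[OF U z(1)] .
  have UV: "U \<subseteq> ?V" using Uc by (force intro: exI[of _ "0::nat"])
  have "(\<lambda>g. U #> g) ` ?V = (\<lambda>i. U #> z [^] i) ` {..<p}"
  proof (intro equalityI subsetI)
    fix Y assume "Y \<in> (\<lambda>g. U #> g) ` ?V"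
    then obtain u and i :: nat where u: "u \<in> U" "Y = U #> (u \<otimes> z [^] i)" by blast
    have "(z [^] p) [^] (i div p) \<in> U" using subgroup_pow U z by blast
    then have "u \<otimes> (z [^] p) [^] (i div p) \<in> U" using u U by (simp add: subgroup.m_closed)
    moreover have "z [^] i = (z [^] p) [^] (i div p) \<otimes> z [^] (i mod p)"
      using zc by (simp add: nat_pow_pow nat_pow_mult)
    then have "u \<otimes> z [^] i \<otimes> inv (z [^] (i mod p)) = u \<otimes> (z [^] p) [^] (i div p)"
      using zc Uc u by (simp add: m_assoc subsetD)
    ultimately have "Y = U #> z [^] (i mod p)"
      using u rcos_eq_iff[OF U] zc Uc by (simp add: subsetD)
    then show "Y \<in> (\<lambda>i. U #> z [^] i) ` {..<p}" using p0 by auto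
  next
    fix Y assume "Y \<in> (\<lambda>i. U #> z [^] i) ` {..<p}"
    then obtain i :: nat where "Y = U #> z [^] i" by auto
    moreover have "z [^] i = \<one> \<otimes> z [^] i" using zc by simp
    then have "z [^] i \<in> ?V" using U subgroup.one_closed by blast
    ultimately show "Y \<in> (\<lambda>g. U #> g) ` ?V" by blast
  qed
  moreover have "inj_on (\<lambda>i. U #> z [^] i) {..<p}"
  proof (rule linorder_inj_onI)
    fix i j assume ij: "i < j" "i \<in> {..<p}" "j \<in> {..<p}"
    show "U #> z [^] i \<noteq> U #> z [^] j"
    proof
      assume "U #> z [^] i = U #> z [^] j"
      then have "z [^] j \<otimes> inv (z [^] i) \<in> U" using rcos_eq_iff[OF U, of "z [^] j" "z [^] i"] zc by simp
      moreover have "z [^] j = z [^] (j - i) \<otimes> z [^] i" using ij zc by (simp add: nat_pow_mult)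
      ultimately have "z [^] (j - i) \<in> U" using zc by (simp add: m_assoc)
      moreover have "coprime (j - i) p"
        using ij p by (metis coprime_commute diff_is_0_eq lessThan_iff less_imp_diff_less
          nat_dvd_not_less not_gr_zero not_le prime_imp_coprime)
      ultimately show False using pow_mem_coprime[OF U zc _ z(3)] z by blast
    qed
  qed auto
  ultimately have "card ((\<lambda>g. U #> g) ` ?V) = p" by (simp add: card_image)
  then show ?thesis using card_rcosets_in[OF U V UV] U V UV by (auto simp: index_p_def)
qed

text \<open>A second fixed coset gives an element of \<open>T\<close> outside \<open>U\<close> whose
  commutators with \<open>K\<close> lie in \<open>U\<close>. Passing to its last p-power outside
  \<open>U\<close> keeps this property and puts the p-th power into \<open>U\<close>.\<close>

lemma central_step:
  assumes p: "Factorial_Ring.prime p" and K: "p_subgroup p K" "K \<subseteq> Nor U" "K \<subseteq> Nor T"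
    and U: "subgroup U G" "U \<subseteq> K" and T: "p_subgroup p T" and UT: "U \<subset> T"
  obtains z where "z \<in> T - U" "z [^] p \<in> U" "z \<in> Nor U" "\<And>k. k \<in> K \<Longrightarrow> cj k z \<otimes> inv z \<in> U"
proof -
  have Tc: "T \<subseteq> carrier G" using T by (rule p_subgroup_subset)
  have Uc: "U \<subseteq> carrier G" using U by (simp add: subgroup.subset)
  have Kc: "K \<subseteq> carrier G" using K by (simp add: p_subgroup_subset)
  obtain a where a: "card T = p ^ a" using T by (auto simp: p_subgroup_def)
  have sT: "subgroup T G" using T by (rule p_subgroup_subgroup)
  have "card U < card T" using UT Tc by (simp add: psubset_card_mono)
  moreover have dv: "card U dvd card T" using card_subgroup_dvd U sT UT by blast
  then obtain b where b: "card U = p ^ b" using a p by (metis divides_primepow_nat)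
  ultimately have "b < a" using a p by (metis power_less_imp_less_exp prime_gt_1_nat)
  then have "card T div card U = p ^ (a - b)" using a b p
    by (metis power_diff less_imp_le_nat not_prime_0)
  then have "p dvd card T div card U" using \<open>b < a\<close> by simp
  then obtain z where z: "z \<in> T - U" "\<And>k. k \<in> K \<Longrightarrow> cj k z \<otimes> inv z \<in> U"
    using p_group_fixed_coset[OF p K U(1) sT] UT by blast
  have zc: "z \<in> carrier G" using z Tc by blast
  \<comment> \<open>As \<open>U\<close> lies in \<open>K\<close>, the commutators of
    \<open>z\<close> with \<open>U\<close> lie in \<open>U\<close>, which means that
    \<open>z\<close> normalises \<open>U\<close>.\<close>
  have zN: "z \<in> Nor U"
  proof -
    have "cj z u \<in> U" if u: "u \<in> U" for u
    proof -
      have uc: "u \<in> carrier G" using u Uc by blast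
      have "cj (inv u) z \<otimes> inv z \<in> U" using z u U by (meson subgroup.m_inv_closed subsetD)
      then have "u \<otimes> (cj (inv u) z \<otimes> inv z) \<in> U" using u U by (simp add: subgroup.m_closed)
      then show ?thesis using uc zc by (simp add: cj_def m_assoc)
    qed
    then show ?thesis using zc by (simp add: Nor_def)
  qed
  \<comment> \<open>The commutator with the next power of \<open>z\<close> is the previous one times
    a conjugate, by a power of \<open>z\<close>, of the commutator with \<open>z\<close>.\<close>
  have pw: "cj k (z [^] i) \<otimes> inv (z [^] i) \<in> U" if k: "k \<in> K" for k and i :: nat
  proof (induction i)
    case 0
    then show ?case using k Kc U by (auto simp: subgroup.one_closed)
  next
    case (Suc i)
    have kc: "k \<in> carrier G" using k Kc by blast
    let ?w = "cj k z \<otimes> inv z"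
    have wc: "?w \<in> carrier G" using kc zc by simp
    have "cj k (z [^] Suc i) \<otimes> inv (z [^] Suc i) = (cj k (z [^] i) \<otimes> inv (z [^] i)) \<otimes> cj (z [^] i) ?w"
      using kc zc by (simp add: cj_mult inv_mult_group m_assoc) (simp add: cj_def m_assoc)
    moreover have "cj (z [^] i) ?w \<in> U" using z k Nor_pow[OF zN Uc] by (auto simp: Nor_def)
    ultimately show ?case using Suc U by (simp add: subgroup.m_closed)
  qed
  have "z [^] (p ^ a) = \<one>" using pow_card_eq_one[OF sT] z a by auto
  then have ex: "z [^] (p ^ a) \<in> U" using U by (simp add: subgroup.one_closed)
  define n where "n = (LEAST n. z [^] (p ^ n) \<in> U)"
  have n: "z [^] (p ^ n) \<in> U" unfolding n_def using ex by (rule LeastI)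
  have "n \<noteq> 0" using n z zc by (cases n) auto
  then obtain m where m: "n = Suc m" using not0_implies_Suc by blast
  let ?z = "z [^] (p ^ m)"
  have "?z \<notin> U" using not_less_Least[of m] m unfolding n_def by (metis lessI)
  moreover have "?z \<in> T" using z subgroup_pow[OF sT] by blast
  moreover have "?z [^] p \<in> U" using n m zc by (simp add: nat_pow_pow mult.commute)
  moreover have "?z \<in> Nor U" using Nor_pow[OF zN Uc] .
  ultimately show ?thesis using that[of ?z] pw by blast
qed

section \<open>Subgroups of index \<open>p\<close> in a \<open>p\<close>-group\<close>

text \<open>Normalisers grow in p-groups: \<open>central_step\<close> with \<open>U\<close> itself
  as the acting group yields \<open>z\<close> in \<open>S\<close> outside \<open>U\<close> that
  normalises \<open>U\<close>, and the extension of \<open>U\<close> by \<open>z\<close> is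
  \<open>V\<close>.\<close>

lemma p_group_extend:
  assumes p: "Factorial_Ring.prime p" and S: "p_subgroup p S" and U: "subgroup U G" "U \<subset> S"
  obtains V where "index_p p V U" "V \<subseteq> S" "V \<subseteq> Nor U"
proof -
  have sS: "subgroup S G" using S by (rule p_subgroup_subgroup)
  have "p_subgroup p U" using p_subgroup_mono[OF S U(1) _ p] U(2) by blast
  moreover have "U \<subseteq> Nor S" using subgroup_subset_Nor[OF sS] U by blast
  ultimately obtain z where z: "z \<in> S - U" "z [^] p \<in> U" "z \<in> Nor U"
    by (rule central_step[OF p _ subgroup_subset_Nor[OF U(1)] _ U(1) subset_refl S U(2)])
  let ?V = "{u \<otimes> z [^] (i::nat) |u i. u \<in> U}"
  have "index_p p ?V U" using cyclic_extension_index[OF p U(1)] z by blast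
  moreover have "?V \<subseteq> S" using z U sS by (auto simp: subgroup.m_closed subgroup_pow)
  moreover have "?V \<subseteq> Nor U"
    using subgroup_subset_Nor[OF U(1)] Nor_pow[OF z(3)] Nor_subgroup[of U] U(1)
    by (auto intro!: subgroup.m_closed[of "Nor U"] simp: subgroup.subset)
  ultimately show ?thesis using that by blast
qed

text \<open>Extensions of index \<open>p\<close> are repeated from \<open>U\<close> upwards; the
  orders run through consecutive powers of \<open>p\<close>, so none is skipped.\<close>

lemma p_group_intermediate:
  assumes p: "Factorial_Ring.prime p" and S: "p_subgroup p S" and U: "subgroup U G" "U \<subseteq> S"
    and m: "card U \<le> p ^ m" "p ^ m \<le> card S"
  obtains H where "subgroup H G" "U \<subseteq> H" "H \<subseteq> S" "card H = p ^ m"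
proof -
  have p1: "1 < p" using p by (rule prime_gt_1_nat)
  have "\<exists>H. subgroup H G \<and> U \<subseteq> H \<and> H \<subseteq> S \<and> card H = p ^ m"
    using U m
  proof (induction "p ^ m - card U" arbitrary: U rule: less_induct)
    case less
    show ?case
    proof (cases "card U = p ^ m")
      case True
      then show ?thesis using less by blast
    next
      case False
      then have lt: "card U < p ^ m" using less by simp
      then have "U \<subset> S" using less by auto
      then obtain V where V: "index_p p V U" "V \<subseteq> S" by (rule p_group_extend[OF p S less.prems(1)])
      have "p_subgroup p U" by (rule p_subgroup_mono[OF S less.prems(1,2) p])
      then obtain a where a: "card U = p ^ a" by (auto simp: p_subgroup_def)
      then have "a < m" using lt p1 by simp
      then have "p ^ Suc a \<le> p ^ m" using p1 by (intro power_increasing) auto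
      then have Vm: "card V \<le> p ^ m" using V a by (simp add: index_p_def)
      moreover have "card U < card V" using V a p1 by (simp add: index_p_def)
      ultimately have "p ^ m - card V < p ^ m - card U" using lt by simp
      then obtain H where "subgroup H G" "V \<subseteq> H" "H \<subseteq> S" "card H = p ^ m"
        using less(1)[of V] V Vm less.prems by (auto simp: index_p_def)
      then show ?thesis using V by (intro exI[of _ H]) (auto simp: index_p_def)
    qed
  qed
  then show ?thesis using that by blast
qed

lemma p_group_maximal:
  assumes p: "Factorial_Ring.prime p" and L: "p_subgroup p L" and U: "subgroup U G" "U \<subset> L"
  obtains M where "index_p p L M" "U \<subseteq> M"
proof -
  have p1: "1 < p" using p by (rule prime_gt_1_nat)
  have sL: "subgroup L G" using L by (rule p_subgroup_subgroup)
  obtain n where n: "card L = p ^ n" using L by (auto simp: p_subgroup_def)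
  have "p_subgroup p U" using p_subgroup_mono[OF L U(1) _ p] U(2) by blast
  then obtain a where a: "card U = p ^ a" by (auto simp: p_subgroup_def)
  have "card U < card L" using U subgroup_finite[OF sL] psubset_card_mono by blast
  then have "a < n" using n a p1 by simp
  then obtain m where m: "n = Suc m" using not0_implies_Suc by fastforce
  then have "card U \<le> p ^ m" using \<open>a < n\<close> a p1 by simp
  moreover have "p ^ m \<le> card L" using n m p1 by simp
  ultimately obtain M where "subgroup M G" "U \<subseteq> M" "M \<subseteq> L" "card M = p ^ m"
    using p_group_intermediate[OF p L U(1)] U by blast
  then show ?thesis using that[of M] n m sL by (simp add: index_p_def)
qed

lemma index_p_psubset:
  assumes "Factorial_Ring.prime p" "index_p p L M" shows "M \<subset> L"
  using assms subgroup_card_pos[of M] prime_gt_1_nat[of p] by (auto simp: index_p_def)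

text \<open>The overgroup of \<open>M\<close> in \<open>L\<close> given by
  \<open>p_group_extend\<close> normalises \<open>M\<close> and already has the order of
  \<open>L\<close>.\<close>

lemma index_p_normal:
  assumes p: "Factorial_Ring.prime p" and L: "p_subgroup p L" and M: "index_p p L M"
  shows "L \<subseteq> Nor M"
proof -
  have sM: "subgroup M G" using M by (simp add: index_p_def)
  obtain V where V: "index_p p V M" "V \<subseteq> L" "V \<subseteq> Nor M"
    by (rule p_group_extend[OF p L sM index_p_psubset[OF p M]])
  then have "card V = card L" using M by (simp add: index_p_def)
  then have "V = L" using V p_subgroup_subset[OF L] finite_sub card_subset_eq by blast
  then show ?thesis using V by blast
qed

lemma index_p_pow_mem:
  assumes p: "Factorial_Ring.prime p" and L: "p_subgroup p L" and M: "index_p p L M" and a: "a \<in> L"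
  shows "a [^] p \<in> M"
proof -
  have sM: "subgroup M G" and sL: "subgroup L G" using M by (auto simp: index_p_def)
  let ?L = "G\<lparr>carrier := L\<rparr>"
  interpret L: group ?L using sL by (rule subgroup_imp_group)
  have sub: "subgroup M ?L" using subgroup_incl[OF sM sL] M by (simp add: index_p_def)
  have "cj x h \<in> M" if "x \<in> L" "h \<in> M" for x h
    using index_p_normal[OF p L M] that by (auto simp: Nor_def)
  then have nM: "M \<lhd> ?L"
    using sub sL by (auto simp: L.normal_inv_iff cj_def)
  interpret Q: group "?L Mod M" using normal.factorgroup_is_group[OF nM] .
  have "order (?L Mod M) = p"
    using L.lagrange[OF sub] M subgroup_card_pos[OF sM] by (simp add: FactGroup_def order_def index_p_def)
  moreover have "M #> a \<in> carrier (?L Mod M)" using a by (auto simp: FactGroup_def RCOSETS_def)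
  ultimately have "(M #> a) [^]\<^bsub>?L Mod M\<^esub> p = M" using Q.pow_order_eq_1 by fastforce
  moreover have "(M #> a) [^]\<^bsub>?L Mod M\<^esub> p = M #> (a [^] p)"
    using normal.FactGroup_pow[OF nM, of a p] a by (simp add: nat_pow_consistent[symmetric])
  ultimately have "M #> (a [^] p) = M" by simp
  then show ?thesis using coset_join1 sM a sL subgroup_memD by blast
qed

lemma index_p_generate:
  assumes p: "Factorial_Ring.prime p" and L: "p_subgroup p L" and M: "index_p p L M"
    and z: "z \<in> L - M" and a: "a \<in> L"
  obtains u and i :: nat where "u \<in> M" "a = u \<otimes> z [^] i"
proof -
  have sM: "subgroup M G" and sL: "subgroup L G" "M \<subseteq> L" using M by (auto simp: index_p_def)
  have zN: "z \<in> Nor M" using index_p_normal[OF p L M] z by blast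
  let ?V = "{u \<otimes> z [^] (i::nat) |u i. u \<in> M}"
  have V: "index_p p ?V M"
    using cyclic_extension_index[OF p sM zN] z index_p_pow_mem[OF p L M] by blast
  have "?V \<subseteq> L" using z sL by (auto simp: subgroup.m_closed subgroup_pow)
  moreover have "card ?V = card L" using V M by (simp add: index_p_def)
  ultimately have "?V = L" using subgroup_finite[OF sL(1)] card_subset_eq by blast
  then show ?thesis using a that by blast
qed

section \<open>Coprime action\<close>

text \<open>Iteration shows that the i-th power of \<open>x\<close> sends \<open>a\<close> to
  \<open>a\<close> times the i-th power of \<open>y\<close>. For \<open>i = n\<close> this gives
  \<open>y [^] n = \<one>\<close>, and the exponents are coprime.\<close>

lemma coprime_fixed:
  assumes "x \<in> carrier G" "x [^] (n::nat) = \<one>" "a \<in> carrier G" "y \<in> carrier G"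
    and a: "cj x a = a \<otimes> y" and y: "cj x y = y" and m: "y [^] (m::nat) = \<one>" and "coprime n m"
  shows "y = \<one>"
proof -
  have "cj (x [^] i) a = a \<otimes> y [^] i" for i :: nat
  proof (induction i)
    case (Suc i)
    have "cj (x [^] Suc i) a = cj (x [^] i) a \<otimes> cj (x [^] i) y"
      using assms by (simp add: cj_cj[symmetric] cj_mult)
    also have "cj (x [^] i) y = y" using assms cj_fixed_pow by blast
    finally show ?case using Suc assms by (simp add: m_assoc)
  qed (use assms in simp)
  from this[of n] have "a \<otimes> y [^] n = a" using assms by simp
  then have "y [^] n = \<one>" using assms by (metis l_cancel_one nat_pow_closed)
  then show ?thesis using coprime_pow_eq_one assms by blast
qed

text \<open>Lifts trivial action: a q-element that centralises the p-group \<open>Y\<close> and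
  fixes the coset of \<open>a\<close> modulo \<open>Y\<close> fixes \<open>a\<close>.\<close>

lemma coprime_fixed_p:
  assumes pq: "Factorial_Ring.prime p" "Factorial_Ring.prime q" "p \<noteq> q" and x: "p_element q x"
    and Y: "p_subgroup p Y" "x \<in> Cen Y" and a: "a \<in> carrier G" "inv a \<otimes> cj x a \<in> Y"
  shows "cj x a = a"
proof -
  let ?y = "inv a \<otimes> cj x a"
  obtain k where k: "x \<in> carrier G" "x [^] (q ^ k) = \<one>" using x by (auto simp: p_element_def)
  obtain m where m: "?y [^] (p ^ m) = \<one>"
    using p_subgroup_element[OF Y(1) a(2)] by (auto simp: p_element_def)
  have yc: "?y \<in> carrier G" using k a by simp
  have "coprime (q ^ k) (p ^ m)" using pq by (simp add: primes_coprime)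
  then have "?y = \<one>"
    using k a m Y yc by (intro coprime_fixed[of x "q ^ k" a ?y "p ^ m"]) (auto simp: Cen_def)
  then show ?thesis using a k by (metis cj_closed inv_mult_cancel_left inv_closed inv_inv m_closed r_inv r_one mult_inv_cancel_left)
qed

text \<open>\<open>e\<close> is a commutator of \<open>a\<close> and \<open>b\<close> that commutes
  with both. The exponent \<open>n * (n - 1) div 2\<close> counts how often a \<open>b\<close>
  passes an \<open>a\<close> when the product is sorted.\<close>

lemma class2_pow:
  assumes c: "a \<in> carrier G" "b \<in> carrier G" "e \<in> carrier G"
    and e: "b \<otimes> a = a \<otimes> b \<otimes> e" "e \<otimes> a = a \<otimes> e" "e \<otimes> b = b \<otimes> e"
  shows "b [^] (n::nat) \<otimes> a = a \<otimes> b [^] n \<otimes> e [^] n"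
    and "(a \<otimes> b) [^] n = a [^] n \<otimes> b [^] n \<otimes> e [^] (n * (n - 1) div 2)"
proof -
  have eb: "e [^] i \<otimes> b [^] j = b [^] j \<otimes> e [^] i" for i j :: nat
    using c e by (metis group_commutes_pow nat_pow_closed)
  have eb1: "e [^] i \<otimes> b = b \<otimes> e [^] i" for i :: nat
    using eb[of i 1] c by simp
  have ea: "e [^] i \<otimes> a = a \<otimes> e [^] i" for i :: nat
    using c e by (metis group_commutes_pow)
  show 1: "b [^] n \<otimes> a = a \<otimes> b [^] n \<otimes> e [^] n" for n :: nat
  proof (induction n)
    case (Suc n)
    have "b [^] Suc n \<otimes> a = b [^] n \<otimes> (b \<otimes> a)" using c by (simp add: m_assoc)
    also have "\<dots> = (b [^] n \<otimes> a) \<otimes> (b \<otimes> e)" using c e by (simp add: m_assoc)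
    also have "\<dots> = a \<otimes> b [^] n \<otimes> (e [^] n \<otimes> b [^] (1::nat)) \<otimes> e" using c Suc by (simp add: m_assoc)
    also have "\<dots> = a \<otimes> b [^] Suc n \<otimes> e [^] Suc n" using c unfolding eb by (simp add: m_assoc)
    finally show ?case .
  qed (use c in simp)
  show "(a \<otimes> b) [^] n = a [^] n \<otimes> b [^] n \<otimes> e [^] (n * (n - 1) div 2)"
  proof (induction n)
    case (Suc n)
    let ?k = "n * (n - 1) div 2"
    have k: "Suc n * (Suc n - 1) div 2 = n + ?k"
      by (cases n) (auto simp: algebra_simps)
    have "(a \<otimes> b) [^] Suc n = a [^] n \<otimes> b [^] n \<otimes> (e [^] ?k \<otimes> a) \<otimes> b" using Suc c by (simp add: m_assoc)
    also have "\<dots> = a [^] n \<otimes> (b [^] n \<otimes> a) \<otimes> (e [^] ?k \<otimes> b)" unfolding ea using c by (simp add: m_assoc)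
    also have "\<dots> = a [^] n \<otimes> a \<otimes> b [^] n \<otimes> (e [^] n \<otimes> b) \<otimes> e [^] ?k"
      unfolding eb1[of ?k] 1 using c by (simp add: m_assoc)
    also have "\<dots> = a [^] Suc n \<otimes> b [^] Suc n \<otimes> e [^] (n + ?k)"
      unfolding eb1 using c by (simp add: m_assoc nat_pow_mult[symmetric])
    finally show ?case unfolding k .
  qed (use c in simp)
qed

text \<open>A maximal K-invariant proper subgroup \<open>U\<close> of \<open>T\<close> works: the
  extension of \<open>U\<close> by the element from \<open>central_step\<close> is again
  K-invariant, so it is \<open>T\<close>. With \<open>K = T\<close> this gives an index
  \<open>p\<close> subgroup containing all commutators; with \<open>K\<close> a Sylow subgroup it
  prepares the transfer.\<close>

lemma invariant_maximal:
  assumes p: "Factorial_Ring.prime p" and K: "p_subgroup p K" "K \<subseteq> Nor T"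
    and T: "subgroup T G" "T \<subseteq> K" "T \<noteq> {\<one>}"
  obtains U where "index_p p T U" "K \<subseteq> Nor U" "\<And>k t. k \<in> K \<Longrightarrow> t \<in> T \<Longrightarrow> cj k t \<otimes> inv t \<in> U"
proof -
  have Tc: "T \<subseteq> carrier G" using T by (simp add: subgroup.subset)
  have Kc: "K \<subseteq> carrier G" using K by (simp add: p_subgroup_subset)
  have finT: "finite T" using Tc by simp
  define \<U> where "\<U> = {U. subgroup U G \<and> U \<subset> T \<and> K \<subseteq> Nor U}"
  have "{\<one>} \<in> \<U>"
    using T Kc triv_subgroup subgroup.one_closed[OF T(1)] by (auto simp: \<U>_def Nor_def)
  moreover have "finite \<U>" using finT by (rule rev_finite_subset[OF finite_Pow_iff[THEN iffD2]]) (auto simp: \<U>_def)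
  ultimately obtain U where U: "U \<in> \<U>" and max: "\<And>V. V \<in> \<U> \<Longrightarrow> U \<subseteq> V \<Longrightarrow> U = V"
    using finite_has_maximal[of \<U>] by blast
  have sU: "subgroup U G" "U \<subset> T" "K \<subseteq> Nor U" using U by (auto simp: \<U>_def)
  have Uc: "U \<subseteq> carrier G" using sU Tc by blast
  have pT: "p_subgroup p T" using p_subgroup_mono[OF K(1) T(1,2) p] .
  obtain z where z: "z \<in> T - U" "z [^] p \<in> U" "z \<in> Nor U" "\<And>k. k \<in> K \<Longrightarrow> cj k z \<otimes> inv z \<in> U"
    using central_step[OF p K(1) sU(3) K(2) sU(1) _ pT sU(2)] sU T by blast
  have zc: "z \<in> carrier G" using z Tc by blast
  let ?V = "{u \<otimes> z [^] (i::nat) |u i. u \<in> U}"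
  have iV: "index_p p ?V U" using cyclic_extension_index[OF p sU(1) z(3) _ z(2)] z by blast
  then have sV: "subgroup ?V G" and UV: "U \<subseteq> ?V" by (auto simp: index_p_def)
  have VT: "?V \<subseteq> T" using z sU T by (auto simp: subgroup.m_closed subgroup_pow subsetD)
  have zV: "z \<in> ?V"
  proof -
    have "z = \<one> \<otimes> z [^] (1::nat)" using zc by simp
    then show ?thesis using subgroup.one_closed[OF sU(1)] by blast
  qed
  have "?V = T"
  proof (rule ccontr)
    assume "?V \<noteq> T"
    have "cj k v \<in> ?V" if k: "k \<in> K" and v: "v \<in> ?V" for k v
    proof -
      obtain u and i :: nat where u: "u \<in> U" "v = u \<otimes> z [^] i" using v by blast
      have kc: "k \<in> carrier G" using k Kc by blast
      have "(cj k z \<otimes> inv z) \<otimes> z \<in> ?V"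
        by (intro subgroup.m_closed[OF sV] zV subsetD[OF UV] z(4)[OF k])
      then have "cj k z \<in> ?V" using kc zc by (simp add: m_assoc)
      then have "cj k z [^] i \<in> ?V" using subgroup_pow[OF sV] by blast
      moreover have "cj k u \<in> ?V" using u k sU(3) UV by (auto simp: Nor_def)
      moreover have "cj k v = cj k u \<otimes> cj k z [^] i" using u kc zc Uc by (simp add: cj_mult cj_pow subsetD)
      ultimately show ?thesis using subgroup.m_closed[OF sV] by simp
    qed
    then have "?V \<in> \<U>" using sV VT \<open>?V \<noteq> T\<close> Kc by (auto simp: \<U>_def Nor_def)
    then show False using max[OF _ UV] z zV by blast
  qed
  \<comment> \<open>\<open>T\<close> consists of products of elements of \<open>U\<close> with
    powers of \<open>z\<close>. Commutators of \<open>k\<close> with both factors lie in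
    \<open>U\<close>, and the product rule \<open>mult\<close> combines them.\<close>
  moreover have "cj k t \<otimes> inv t \<in> U" if k: "k \<in> K" and t: "t \<in> T" for k t
  proof -
    have kc: "k \<in> carrier G" using k Kc by blast
    have mult: "cj k (a \<otimes> b) \<otimes> inv (a \<otimes> b) \<in> U"
      if "cj k a \<otimes> inv a \<in> U" "cj k b \<otimes> inv b \<in> U" "a \<in> T" "b \<in> T" for a b
    proof -
      have ab: "a \<in> carrier G" "b \<in> carrier G" using that Tc by auto
      have "cj k (a \<otimes> b) \<otimes> inv (a \<otimes> b) = (cj k a \<otimes> inv a) \<otimes> cj a (cj k b \<otimes> inv b)"
        using kc ab by (simp add: cj_mult inv_mult_group m_assoc) (simp add: cj_def m_assoc)
      moreover have "cj a (cj k b \<otimes> inv b) \<in> U" using that sU(3) T(2) by (auto simp: Nor_def subset_iff)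
      ultimately show ?thesis using that subgroup.m_closed[OF sU(1)] by simp
    qed
    have u: "cj k u \<otimes> inv u \<in> U" if "u \<in> U" for u
      using that sU k by (auto simp: Nor_def intro!: subgroup.m_closed[OF sU(1)] subgroup.m_inv_closed[OF sU(1)])
    have "cj k (z [^] i) \<otimes> inv (z [^] i) \<in> U" for i :: nat
    proof (induction i)
      case 0
      then show ?case using kc subgroup.one_closed[OF sU(1)] by simp
    next
      case (Suc i)
      have "z [^] i \<in> T" using z subgroup_pow[OF T(1)] by blast
      then show ?case using mult[of "z [^] i" z] Suc z k by simp
    qed
    moreover obtain v and i :: nat where "v \<in> U" "t = v \<otimes> z [^] i" using t \<open>?V = T\<close> by blast
    moreover have "z [^] i \<in> T" for i :: nat using z subgroup_pow[OF T(1)] by blast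
    ultimately show ?thesis using mult[of v "z [^] i"] u sU(2) by blast
  qed
  ultimately show ?thesis using that[of U] iV sU(3) by simp
qed

lemma Nor_mem: "g \<in> Nor H \<Longrightarrow> h \<in> H \<Longrightarrow> cj g h \<in> H" by (simp add: Nor_def)
lemma Cen_fixed: "g \<in> Cen H \<Longrightarrow> h \<in> H \<Longrightarrow> cj g h = h" by (simp add: Cen_def)

text \<open>In a minimal counterexample \<open>x\<close> centralises every proper \<open>x\<close>-invariant subgroup. The subgroup \<open>W\<close>
  below contains all commutators and is \<open>x\<close>-invariant by construction, so it can stand in for the
  commutator subgroup; either its centraliser \<open>C\<close> is proper, or \<open>Q\<close> has class at most two.\<close>

lemma central_if_fixes_order_p:
  assumes pq: "Factorial_Ring.prime p" "Factorial_Ring.prime q" "p \<noteq> q" and odd: "odd p"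
    and x: "p_element q x"
    and Q: "p_subgroup p Q" "x \<in> Nor Q" and fix_p: "\<And>a. a \<in> Q \<Longrightarrow> a [^] p = \<one> \<Longrightarrow> cj x a = a"
  shows "x \<in> Cen Q"
  using Q fix_p
proof (induction "card Q" arbitrary: Q rule: less_induct)
  case less
  note Q = less.prems(1,2) and fix_p = less.prems(3)
  have sQ: "subgroup Q G" and Qc: "Q \<subseteq> carrier G"
    using Q by (auto simp: p_subgroup_subgroup p_subgroup_subset)
  have finQ: "finite Q" using Qc by simp
  obtain k where xc: "x \<in> carrier G" and k: "x [^] (q ^ k) = \<one>" using x by (auto simp: p_element_def)
  have IH: "x \<in> Cen W" if "subgroup W G" "W \<subset> Q" "x \<in> Nor W" for W
  proof (rule less(1)[OF psubset_card_mono[OF finQ that(2)] _ that(3)])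
    show "p_subgroup p W" by (rule p_subgroup_mono[OF Q(1) that(1) psubset_imp_subset[OF that(2)] pq(1)])
  qed (use that fix_p in blast)
  show ?case
  proof (cases "Q = {\<one>}")
    case True
    then show ?thesis using xc by (simp add: Cen_def)
  next
    case False
    obtain U where U: "index_p p Q U" and comm: "\<And>a b. a \<in> Q \<Longrightarrow> b \<in> Q \<Longrightarrow> cj a b \<otimes> inv b \<in> U"
      by (rule invariant_maximal[OF pq(1) Q(1) subgroup_subset_Nor[OF sQ] sQ subset_refl False]) (rule that)
    have sU: "subgroup U G" "U \<subset> Q" using U index_p_psubset[OF pq(1)] by (auto simp: index_p_def)
    have xQ: "cj (x [^] i) a \<in> Q" if "a \<in> Q" for a and i :: nat
      using Nor_pow[OF Q(2) Qc] that Nor_mem by blast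
    define W where "W = {w \<in> Q. \<forall>i::nat. cj (x [^] i) w \<in> U}"
    have WU: "W \<subseteq> U"
    proof
      fix w assume "w \<in> W"
      then have "\<forall>i::nat. cj (x [^] i) w \<in> U" "w \<in> carrier G" using Qc by (auto simp: W_def)
      then have "cj (x [^] (0::nat)) w \<in> U" "w \<in> carrier G" by blast+
      then show "w \<in> U" by simp
    qed
    have sW: "subgroup W G"
    proof (rule subgroupI_finite)
      show "W \<subseteq> carrier G" using Qc by (auto simp: W_def)
      show "\<one> \<in> W" using xc sQ sU by (simp add: W_def subgroup.one_closed)
      fix a b assume "a \<in> W" "b \<in> W"
      then show "a \<otimes> b \<in> W" using xc sQ sU Qc
        by (auto simp: W_def cj_mult subsetD subgroup.m_closed)
    qed
    have xW: "x \<in> Nor W"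
    proof -
      have "cj x w \<in> W" if w: "w \<in> W" for w
      proof -
        have "cj (x [^] i) (cj x w) \<in> U" for i :: nat
        proof -
          have "cj (x [^] Suc i) w \<in> U" using w unfolding W_def by blast
          then show ?thesis using xc w Qc by (auto simp: cj_cj W_def)
        qed
        then show ?thesis using w xQ[of w 1] xc by (simp add: W_def)
      qed
      then show ?thesis using xc by (simp add: Nor_def)
    qed
    have xcenW: "x \<in> Cen W" using IH[OF sW _ xW] WU sU by blast
    have commW: "cj a b \<otimes> inv b \<in> W" if ab: "a \<in> Q" "b \<in> Q" for a b
    proof -
      have c: "a \<in> carrier G" "b \<in> carrier G" using ab Qc by auto
      have "cj (x [^] i) (cj a b \<otimes> inv b) \<in> U" for i :: nat
      proof -
        have "cj (x [^] i) (cj a b \<otimes> inv b) = cj (cj (x [^] i) a) (cj (x [^] i) b) \<otimes> inv (cj (x [^] i) b)"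
          using c xc by (simp add: cj_mult cj_inv) (simp add: cj_def m_assoc inv_mult_group)
        then show ?thesis using comm xQ ab by simp
      qed
      moreover have "cj a b \<otimes> inv b \<in> Q" using comm ab sU by blast
      ultimately show ?thesis by (simp add: W_def)
    qed
    define C where "C = {c \<in> Q. \<forall>a\<in>Q. \<forall>b\<in>Q. cj c (cj a b \<otimes> inv b) = cj a b \<otimes> inv b}"
    have Wc: "w \<in> W \<Longrightarrow> w \<in> carrier G" for w using sW subgroup_memD by blast
    have sC: "subgroup C G"
    proof (rule subgroupI_finite)
      show "C \<subseteq> carrier G" using Qc by (auto simp: C_def)
      show "\<one> \<in> C" using sQ commW Wc by (simp add: C_def subgroup.one_closed)
      fix c d assume cd: "c \<in> C" "d \<in> C"
      have "cj (c \<otimes> d) w = w" if "cj c w = w" "cj d w = w" "w \<in> W" for w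
        using that cd Wc Qc by (auto simp: C_def cj_cj[symmetric] subsetD)
      then show "c \<otimes> d \<in> C" using cd commW sQ by (auto simp: C_def subgroup.m_closed)
    qed
    have xw: "cj x w = w" "cj (inv x) w = w" if "w \<in> W" for w
      using that Cen_fixed[OF xcenW] cj_fixed_inv xc Wc by auto
    have cjx: "cj (cj x c) w = cj x (cj c w)" if "c \<in> Q" "w \<in> W" for c w
    proof -
      have "cj (cj x c) w = cj x (cj c (cj (inv x) w))"
        using that xc Wc Qc by (auto simp: cj_cj subsetD) (simp add: cj_def m_assoc subsetD)
      then show ?thesis using xw that by simp
    qed
    have xC: "x \<in> Nor C"
    proof -
      have "cj x c \<in> C" if c: "c \<in> C" for c
        using c xQ[of c 1] xc cjx commW xw by (auto simp: C_def)
      then show ?thesis using xc by (simp add: Nor_def)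
    qed
    \<comment> \<open>\<open>x\<close> fixes every commutator and also its conjugate by
      \<open>a\<close>, since both lie in \<open>W\<close>. Hence \<open>a\<close> and its conjugate
      by \<open>x\<close> act alike on commutators; this takes the place of the three subgroups
      lemma.\<close>
    have axC: "inv a \<otimes> cj x a \<in> C" if a: "a \<in> Q" for a
    proof -
      have ac: "a \<in> carrier G" using a Qc by blast
      have "cj (inv a \<otimes> cj x a) (cj s t \<otimes> inv t) = cj s t \<otimes> inv t" if st: "s \<in> Q" "t \<in> Q" for s t
      proof -
        let ?w = "cj s t \<otimes> inv t"
        have sc: "s \<in> carrier G" "t \<in> carrier G" using st Qc by auto
        have "cj a ?w = cj (cj a s) (cj a t) \<otimes> inv (cj a t)"
          using ac sc by (simp add: cj_mult cj_inv) (simp add: cj_def m_assoc inv_mult_group)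
        moreover have "cj a s \<in> Q" "cj a t \<in> Q" using a st subgroup_subset_Nor[OF sQ] Nor_mem by blast+
        ultimately have "cj a ?w \<in> W" using commW by simp
        then have "cj (cj x a) ?w = cj a ?w" using cjx[OF a commW[OF st]] xw by simp
        then show ?thesis using ac sc xc by (simp add: cj_cj[symmetric])
      qed
      moreover have "inv a \<otimes> cj x a \<in> Q" using a xQ[of a 1] xc sQ by (simp add: subgroup.m_closed subgroup.m_inv_closed)
      ultimately show ?thesis by (simp add: C_def)
    qed
    show ?thesis
    proof (cases "C = Q")
      case False
      then have CQ: "C \<subset> Q" by (auto simp: C_def)
      then have "p_subgroup p C" using p_subgroup_mono[OF Q(1) sC _ pq(1)] by blast
      then have "cj x a = a" if "a \<in> Q" for a
        using coprime_fixed_p[OF pq x _ IH[OF sC CQ xC] _ axC[OF that]] that Qc by blast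
      then show ?thesis using xc by (simp add: Cen_def)
    next
      case True
      \<comment> \<open>All commutators are now central in \<open>Q\<close>. If \<open>x\<close>
        fixes \<open>a [^] p\<close>, the power formula shows that the p-th power of
        \<open>inv a \<otimes> cj x a\<close> is trivial. So \<open>x\<close> fixes this element by
        hypothesis, and \<open>coprime_fixed\<close> makes it trivial.\<close>
      have step: "cj x a = a" if a: "a \<in> Q" and ap: "cj x (a [^] p) = a [^] p" for a
      proof -
        let ?b = "cj x a" and ?a = "inv a"
        let ?e = "cj (inv (cj x a)) a \<otimes> inv a"
        have ac: "a \<in> carrier G" "?b \<in> carrier G" "?a \<in> carrier G" using a Qc xc by auto
        have bQ: "?b \<in> Q" "inv ?b \<in> Q" "?a \<in> Q" using xQ[OF a, of 1] xc sQ a by (auto simp: subgroup.m_inv_closed)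
        have eW: "?e \<in> W" using commW[OF bQ(2) a] .
        have ec: "?e \<in> carrier G" using Wc[OF eW] .
        have ecom: "?e \<otimes> c = c \<otimes> ?e" if "c \<in> Q" for c
        proof -
          have "c \<in> C" using that True by simp
          then have "cj c ?e = ?e" using bQ a by (simp add: C_def)
          then show ?thesis using that Qc ec cj_fixed_iff by (metis subsetD)
        qed
        have rel: "?b \<otimes> ?a = ?a \<otimes> ?b \<otimes> ?e"
          using ac ecom[OF bQ(3)] by (simp add: cj_def[of "inv _"] m_assoc)
        note cl = class2_pow[OF ac(3,2) ec rel ecom[OF bQ(3)] ecom[OF bQ(1)]]
        have bp: "?b [^] p = a [^] p" using ap ac xc by (simp add: cj_pow)
        have "?b [^] p \<otimes> ?a = ?a \<otimes> ?b [^] p" unfolding bp using ac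
          by (metis group_commutes_pow l_inv r_inv)
        then have "?a \<otimes> ?b [^] p \<otimes> ?e [^] p = ?a \<otimes> ?b [^] p" using cl(1)[of p] by simp
        then have ep: "?e [^] p = \<one>"
          using l_cancel_one[of "?a \<otimes> ?b [^] p" "?e [^] p"] m_closed[OF ac(3) nat_pow_closed[OF ac(2)]]
            nat_pow_closed[OF ec] by blast
        \<comment> \<open>Here \<open>p\<close> odd is used: the correction term of the class two power formula vanishes.\<close>
        have "p * (p - 1) div 2 = p * ((p - 1) div 2)" using odd by (auto elim!: oddE)
        then have "?e [^] (p * (p - 1) div 2) = (?e [^] p) [^] ((p - 1) div 2)"
          using ec nat_pow_pow by simp
        then have "(?a \<otimes> ?b) [^] p = ?a [^] p \<otimes> a [^] p" using cl(2)[of p] ep bp ac by simp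
        then have yp: "(?a \<otimes> ?b) [^] p = \<one>" using ac by (simp add: nat_pow_inv)
        have "?a \<otimes> ?b \<in> Q" using bQ sQ by (simp add: subgroup.m_closed)
        then have fy: "cj x (?a \<otimes> ?b) = ?a \<otimes> ?b" using fix_p yp by blast
        have cop: "coprime (q ^ k) p" using pq by (simp add: primes_coprime)
        have "?a \<otimes> ?b = \<one>"
          by (rule coprime_fixed[OF xc k ac(1) m_closed[OF ac(3,2)] mult_inv_cancel_left[OF ac(1,2), symmetric] fy yp cop])
        moreover have "a \<otimes> (?a \<otimes> ?b) = ?b" using mult_inv_cancel_left[OF ac(1,2)] .
        ultimately show ?thesis using ac(1) by simp
      qed
      \<comment> \<open>Induction on the exponent of the order: \<open>a [^] p\<close> has a smaller
        one, so \<open>x\<close> fixes it.\<close>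
      have "cj x a = a" if "a \<in> Q" "a [^] (p ^ n) = \<one>" for a n
        using that
      proof (induction n arbitrary: a)
        case 0
        then show ?case using xc Qc by auto
      next
        case (Suc n)
        have "a \<in> carrier G" using Suc Qc by blast
        then have "(a [^] p) [^] (p ^ n) = \<one>" using Suc by (simp add: nat_pow_pow)
        then have "cj x (a [^] p) = a [^] p" using Suc subgroup_pow[OF sQ] by blast
        then show ?case using step Suc by blast
      qed
      then have "cj x a = a" if "a \<in> Q" for a
        using p_subgroup_element[OF Q(1) that] that by (auto simp: p_element_def)
      then show ?thesis using xc by (simp add: Cen_def)
    qed
  qed
qed

section \<open>Action on factors of order p\<close>

lemma generate_p_element:
  assumes q: "Factorial_Ring.prime q" and x: "p_element q x"
  shows "p_subgroup q (generate G {x})"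
proof -
  obtain k where k: "x \<in> carrier G" "x [^] (q ^ k) = \<one>" using x by (auto simp: p_element_def)
  then have "ord x dvd q ^ k" by (simp add: pow_eq_id)
  then obtain i where "ord x = q ^ i" using q by (metis divides_primepow_nat)
  moreover have "card (generate G {x}) = ord x" using k generate_pow_card by simp
  moreover have "subgroup (generate G {x}) G" using k generate_is_subgroup by simp
  ultimately show ?thesis by (auto simp: p_subgroup_def)
qed

text \<open>Fermat's theorem makes the exponent \<open>p - 1\<close> kill \<open>k\<close> as well,
  and Bezout combines the two coprime exponents. It is applied to an automorphism of a group of
  order \<open>p\<close>, which raises each element to the power \<open>k\<close>.\<close>

lemma cong_one_if_coprime_exponent:
  fixes k :: nat
  assumes p: "Factorial_Ring.prime p" and k: "[k ^ n = 1] (mod p)" and cop: "coprime (p - 1) n" and n: "0 < n"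
  shows "[k = 1] (mod p)"
proof -
  have "coprime k p"
  proof -
    have "\<not> p dvd k"
    proof
      assume "p dvd k"
      then have "p dvd k ^ n" using n by (simp add: dvd_power_iff_le dvd_trans[OF _ dvd_power])
      then have "p dvd 1" using k by (metis cong_dvd_iff)
      then show False using p by (simp add: prime_nat_iff)
    qed
    then show ?thesis using p prime_imp_coprime coprime_commute by metis
  qed
  then have f: "[k ^ (p - 1) = 1] (mod p)" using p fermat_theorem
    by (metis coprime_absorb_left coprime_commute not_prime_unit)
  have p1: "p - 1 \<noteq> 0" using p prime_gt_1_nat[of p] by simp
  obtain a b where ab: "(p - 1) * a = n * b + 1" using bezout_nat[OF p1, of n] cop by auto
  have "[k ^ ((p - 1) * a) = 1] (mod p)" using cong_pow[OF f, of a] by (simp add: power_mult)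
  moreover have "[k ^ (n * b) * k = 1 * k] (mod p)" using cong_pow[OF k, of b] by (intro cong_mult) (auto simp: power_mult)
  moreover have "k ^ ((p - 1) * a) = k ^ (n * b) * k" unfolding ab by simp
  ultimately show ?thesis by (metis cong_sym cong_trans mult_1)
qed

text \<open>Otherwise the fixed points of \<open>x\<close> in \<open>L\<close> lie in a subgroup
  \<open>M\<close> of index \<open>p\<close>. The action on \<open>L / M\<close> is a power map
  whose exponent must be 1 modulo \<open>p\<close>, so \<open>x\<close> preserves a coset of
  \<open>M\<close> other than \<open>M\<close>. Its size is prime to \<open>q\<close>, so it
  contains a fixed point, which lies outside \<open>M\<close>.\<close>

lemma fixes_if_fixes_maximal:
  assumes pq: "Factorial_Ring.prime p" "Factorial_Ring.prime q" "p \<noteq> q" and x: "p_element q x"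
    and cop: "coprime (p - 1) (order G)"
    and L: "p_subgroup p L" "x \<in> Nor L" and max: "\<And>M. index_p p L M \<Longrightarrow> x \<in> Nor M"
  shows "x \<in> Cen L"
proof (rule ccontr)
  assume neg: "x \<notin> Cen L"
  have xc: "x \<in> carrier G" using x by (auto simp: p_element_def)
  have sL: "subgroup L G" and Lc: "L \<subseteq> carrier G" using L p_subgroup_subgroup p_subgroup_subset by auto
  define F where "F = {a \<in> L. cj x a = a}"
  have sF: "subgroup F G"
  proof (rule subgroupI_finite)
    show "F \<subseteq> carrier G" using Lc by (auto simp: F_def)
    show "\<one> \<in> F" using sL xc by (simp add: F_def subgroup.one_closed)
    fix a b assume "a \<in> F" "b \<in> F"
    then show "a \<otimes> b \<in> F" using Lc xc sL by (auto simp: F_def cj_mult subsetD subgroup.m_closed)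
  qed
  have "F \<subset> L" using neg xc by (auto simp: F_def Cen_def)
  then obtain M where M: "index_p p L M" "F \<subseteq> M" by (rule p_group_maximal[OF pq(1) L(1) sF])
  have sM: "subgroup M G" "M \<subset> L" using M index_p_psubset[OF pq(1)] by (auto simp: index_p_def)
  have Mc: "m \<in> M \<Longrightarrow> m \<in> carrier G" for m using sM subgroup_memD by blast
  have xM: "x \<in> Nor M" using max M by blast
  obtain z where z: "z \<in> L - M" using sM by blast
  have zc: "z \<in> carrier G" using z Lc by blast
  have zN: "z [^] (i::nat) \<in> Nor M" for i
    using Nor_pow[of z M i] index_p_normal[OF pq(1) L(1) M(1)] z sM by (auto simp: subgroup.subset)
  obtain u and k :: nat where u: "u \<in> M" "cj x z = u \<otimes> z [^] k"
    using index_p_generate[OF pq(1) L(1) M(1) z, of "cj x z"] Nor_mem[OF L(2)] z by blast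
  have pw: "\<exists>v\<in>M. (u \<otimes> z [^] k) [^] m = v \<otimes> z [^] (k * m)" for m :: nat
  proof (induction m)
    case 0
    then show ?case using subgroup.one_closed[OF sM(1)] by (intro bexI[of _ \<one>]) auto
  next
    case (Suc m)
    then obtain v where v: "v \<in> M" "(u \<otimes> z [^] k) [^] m = v \<otimes> z [^] (k * m)" by blast
    have "(u \<otimes> z [^] k) [^] Suc m = (v \<otimes> cj (z [^] (k * m)) u) \<otimes> (z [^] (k * m) \<otimes> z [^] k)"
      using v u zc Mc by (simp add: cj_def m_assoc)
    also have "z [^] (k * m) \<otimes> z [^] k = z [^] (k * Suc m)" using zc by (simp add: nat_pow_mult add.commute)
    finally show ?case using v u zN Nor_mem subgroup.m_closed[OF sM(1)] by blast
  qed
  \<comment> \<open>If \<open>x\<close> acts modulo \<open>M\<close> as the power \<open>k\<close>,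
    its i-th power acts as the power \<open>k ^ i\<close>.\<close>
  have it: "\<exists>v\<in>M. cj (x [^] i) z = v \<otimes> z [^] (k ^ i)" for i :: nat
  proof (induction i)
    case 0
    then show ?case using zc subgroup.one_closed[OF sM(1)] by (intro bexI[of _ \<one>]) auto
  next
    case (Suc i)
    then obtain v where v: "v \<in> M" "cj (x [^] i) z = v \<otimes> z [^] (k ^ i)" by blast
    obtain w where w: "w \<in> M" "(u \<otimes> z [^] k) [^] (k ^ i) = w \<otimes> z [^] (k * k ^ i)" using pw by blast
    have "cj (x [^] Suc i) z = cj x (cj (x [^] i) z)"
      unfolding nat_pow_Suc2[OF xc] using xc zc by (simp add: cj_cj)
    also have "\<dots> = cj x v \<otimes> (w \<otimes> z [^] (k * k ^ i))"
      unfolding v(2) w(2)[symmetric] u(2)[symmetric] using v xc zc Mc by (simp add: cj_mult cj_pow)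
    also have "\<dots> = (cj x v \<otimes> w) \<otimes> z [^] (k ^ Suc i)" using v w xc zc Mc by (simp add: m_assoc)
    finally show ?case using v w Nor_mem[OF xM] subgroup.m_closed[OF sM(1)] by blast
  qed
  have n: "0 < order G" by (simp add: order_gt_0_iff_finite)
  \<comment> \<open>The order of \<open>G\<close> is an exponent of \<open>x\<close>, so
    \<open>z\<close> and its power \<open>k ^ order G\<close> agree modulo \<open>M\<close>; this
    leads to \<open>k ^ order G\<close> being 1 modulo \<open>p\<close>.\<close>
  have "x [^] order G = \<one>" using xc pow_order_eq_1 by blast
  then obtain v where v: "v \<in> M" "z = v \<otimes> z [^] (k ^ order G)" using it[of "order G"] zc by auto
  have "k \<noteq> 0"
  proof
    assume "k = 0"
    then have "z = v" using v n Mc by (simp add: zero_power)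
    then show False using v z by blast
  qed
  have pM: "p dvd j" if "z [^] (j::nat) \<in> M" for j
  proof (rule ccontr)
    assume "\<not> p dvd j"
    then have "coprime j p" using pq prime_imp_coprime coprime_commute by metis
    then show False using pow_mem_coprime[OF sM(1) zc that] index_p_pow_mem[OF pq(1) L(1) M(1)] z by blast
  qed
  have kn: "k ^ order G = (k ^ order G - 1) + 1" using \<open>k \<noteq> 0\<close> by simp
  have "z = v \<otimes> z [^] (k ^ order G - 1) \<otimes> z"
    using v zc Mc by (subst (asm) kn) (simp add: m_assoc)
  then have vz: "v \<otimes> z [^] (k ^ order G - 1) = \<one>"
    using r_cancel_one'[OF zc m_closed[OF Mc[OF v(1)] nat_pow_closed[OF zc]]] by blast
  have "inv v \<otimes> (v \<otimes> z [^] (k ^ order G - 1)) = z [^] (k ^ order G - 1)"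
    using inv_mult_cancel_left[OF Mc[OF v(1)] nat_pow_closed[OF zc]] .
  then have "z [^] (k ^ order G - 1) = inv v" unfolding vz using Mc[OF v(1)] by simp
  then have "z [^] (k ^ order G - 1) \<in> M" using subgroup.m_inv_closed[OF sM(1) v(1)] by simp
  then have "p dvd k ^ order G - 1" by (rule pM)
  then have "[k ^ order G = 1] (mod p)" using \<open>k \<noteq> 0\<close> by (subst cong_altdef_nat) auto
  then have "[k = 1] (mod p)" using cong_one_if_coprime_exponent[OF pq(1) _ cop n] by blast
  then have "p dvd k - 1" using \<open>k \<noteq> 0\<close> by (subst (asm) cong_altdef_nat) auto
  then obtain j where j: "k = p * j + 1" using \<open>k \<noteq> 0\<close> by (metis Suc_eq_plus1 Suc_pred' dvdE neq0_conv)
  let ?w = "u \<otimes> (z [^] p) [^] j"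
  have w: "?w \<in> M" using u subgroup.m_closed[OF sM(1)] subgroup_pow[OF sM(1)]
      index_p_pow_mem[OF pq(1) L(1) M(1)] z by blast
  have cw: "cj x z = ?w \<otimes> z" using u j zc Mc by (simp add: nat_pow_pow m_assoc)
  let ?Y = "M #> z"
  have Yc: "a \<in> ?Y \<Longrightarrow> a \<in> carrier G" for a using zc Mc by (auto simp: r_coset_def)
  have xY: "cj x a \<in> ?Y" if "a \<in> ?Y" for a
  proof -
    from that obtain m where m: "m \<in> M" "a = m \<otimes> z" by (auto simp: r_coset_def)
    then have "cj x a = (cj x m \<otimes> ?w) \<otimes> z" using cw xc zc Mc w by (simp add: cj_mult m_assoc)
    moreover have "cj x m \<otimes> ?w \<in> M" using m w Nor_mem[OF xM] subgroup.m_closed[OF sM(1)] by blast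
    ultimately show ?thesis by (auto simp: r_coset_def)
  qed
  have xY': "cj (x [^] i) a \<in> ?Y" if "a \<in> ?Y" for a and i :: nat
    using that by (induction i arbitrary: a) (auto simp: cj_cj[symmetric] xc xY Yc)
  have gen: "y \<in> generate G {x} \<Longrightarrow> \<exists>i::nat. y = x [^] i" for y
    using generate_pow_on_finite_carrier[OF finite_carrier xc] by auto
  have "q dvd card ?Y \<longleftrightarrow> q dvd card {a \<in> ?Y. \<forall>y\<in>generate G {x}. cj y a = a}"
  proof (rule p_group_fixed_points[OF generate_p_element[OF pq(2) x] pq(2)])
    show "finite ?Y" using Yc by (intro finite_sub) blast
    show "cj y a \<in> ?Y" if "y \<in> generate G {x}" "a \<in> ?Y" for y a using gen[OF that(1)] that xY' by blast
    show "cj \<one> a = a" if "a \<in> ?Y" for a using Yc[OF that] by simp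
    show "cj (y \<otimes> y') a = cj y (cj y' a)" if "y \<in> generate G {x}" "y' \<in> generate G {x}" "a \<in> ?Y" for y y' a
      using gen[OF that(1)] gen[OF that(2)] xc Yc[OF that(3)] by (auto simp: cj_cj)
  qed
  moreover have "\<not> q dvd card ?Y"
  proof -
    have "card ?Y = card M"
      using card_cosets_equal[of ?Y M] zc sM(1) by (metis bij_betw_same_card rcosetsI subgroup.subset)
    moreover obtain i where "card M = p ^ i" using p_subgroup_mono[OF L(1) sM(1) _ pq(1)] sM by (auto simp: p_subgroup_def)
    ultimately show ?thesis using pq by (metis prime_dvd_power primes_dvd_imp_eq)
  qed
  ultimately have "{a \<in> ?Y. \<forall>y\<in>generate G {x}. cj y a = a} \<noteq> {}" by (metis card.empty dvd_0_right)
  then obtain a where a: "a \<in> ?Y" "cj x a = a" using generate.incl[of x "{x}"] by blast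
  then obtain m where m: "m \<in> M" "a = m \<otimes> z" by (auto simp: r_coset_def)
  have "a \<in> F" using a m z sM by (auto simp: F_def intro: subgroup.m_closed[OF sL])
  then have "inv m \<otimes> a \<in> M" using M m subgroup.m_closed[OF sM(1)] subgroup.m_inv_closed[OF sM(1)] by blast
  then show False using m zc Mc z by simp
qed

section \<open>Weak closure and local control\<close>

text \<open>For a p-subgroup \<open>Q\<close> this is the local condition of Frobenius' criterion,
  that the normaliser modulo the centraliser is a p-group, tested on elements of prime power
  order.\<close>

definition p'_central :: "nat \<Rightarrow> 'a set \<Rightarrow> bool" where
  "p'_central p Q \<longleftrightarrow>
     (\<forall>q x. Factorial_Ring.prime q \<longrightarrow> q \<noteq> p \<longrightarrow> p_element q x \<longrightarrow> x \<in> Nor Q \<longrightarrow> x \<in> Cen Q)"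

definition weakly_closed :: "'a set \<Rightarrow> 'a set \<Rightarrow> bool" where
  "weakly_closed S L \<longleftrightarrow> subgroup L G \<and> L \<subseteq> S \<and> (\<forall>g\<in>carrier G. cj g ` L \<subseteq> S \<longrightarrow> cj g ` L = L)"

lemma p'_centralD:
  "p'_central p Q \<Longrightarrow> Factorial_Ring.prime q \<Longrightarrow> q \<noteq> p \<Longrightarrow> p_element q x \<Longrightarrow> x \<in> Nor Q \<Longrightarrow> x \<in> Cen Q"
  by (simp add: p'_central_def)

lemma p_element_cj:
  assumes "p_element q x" "g \<in> carrier G" shows "p_element q (cj g x)"
proof -
  obtain k where "x \<in> carrier G" "x [^] (q ^ k) = \<one>" using assms by (auto simp: p_element_def)
  then have "cj g x [^] (q ^ k) = \<one>" using assms cj_pow[of g x "q ^ k"] by simp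
  then show ?thesis using assms \<open>x \<in> carrier G\<close> by (auto simp: p_element_def)
qed

lemma p'_central_cj:
  assumes Q: "p'_central p Q" "Q \<subseteq> carrier G" and g: "g \<in> carrier G"
  shows "p'_central p (cj g ` Q)"
  unfolding p'_central_def
proof (intro allI impI)
  fix q x assume q: "Factorial_Ring.prime q" "q \<noteq> p" and x: "p_element q x" "x \<in> Nor (cj g ` Q)"
  have xc: "x \<in> carrier G" using x by (simp add: p_element_def)
  have conj: "cj (cj (inv g) x) a = cj (inv g) (cj x (cj g a))" if "a \<in> carrier G" for a
    using that xc g by (simp add: cj_def m_assoc inv_mult_group)
  have "cj (inv g) x \<in> Nor Q"
  proof -
    have "cj (cj (inv g) x) a \<in> Q" if a: "a \<in> Q" for a
    proof -
      obtain b where "b \<in> Q" "cj x (cj g a) = cj g b" using Nor_mem[OF x(2), of "cj g a"] a by auto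
      then show ?thesis using conj a Q g by (auto simp: subsetD)
    qed
    then show ?thesis using xc g by (simp add: Nor_def)
  qed
  then have cen: "cj (inv g) x \<in> Cen Q" using p'_centralD[OF Q(1) q] p_element_cj[OF x(1)] g by simp
  have "cj x (cj g a) = cj g a" if a: "a \<in> Q" for a
  proof -
    have "cj (inv g) (cj x (cj g a)) = a" using conj Cen_fixed[OF cen a] a Q by (metis subsetD)
    then have "cj g (cj (inv g) (cj x (cj g a))) = cj g a" by simp
    then show ?thesis using a Q g xc by (simp add: subsetD)
  qed
  then show "x \<in> Cen (cj g ` Q)" using xc by (simp add: Cen_def)
qed

text \<open>A q-element \<open>x\<close> normalising \<open>Q\<close> is changed by a factor
  \<open>c\<close> centralising \<open>Q\<close> into an element \<open>y\<close> that normalises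
  \<open>L\<close> and acts on \<open>Q\<close> as \<open>x\<close> does. A power of
  \<open>y\<close> with exponent prime to \<open>q\<close> is a q-element, so it centralises
  \<open>L\<close>; the same power of \<open>x\<close> then centralises \<open>Q\<close>, and hence
  \<open>x\<close> does.\<close>

lemma p'_central_transfer:
  assumes Q: "Q \<subseteq> L" "L \<subseteq> carrier G" and L: "p'_central p L"
    and ex: "\<And>g. g \<in> Nor Q \<Longrightarrow> \<exists>c\<in>Cen Q. cj (c \<otimes> g) ` L = L"
  shows "p'_central p Q"
  unfolding p'_central_def
proof (intro allI impI)
  fix q x assume q: "Factorial_Ring.prime q" "q \<noteq> p" and x: "p_element q x" "x \<in> Nor Q"
  have Qc: "Q \<subseteq> carrier G" using Q by blast
  obtain k where xc: "x \<in> carrier G" and k: "x [^] (q ^ k) = \<one>" using x by (auto simp: p_element_def)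
  obtain c where c: "c \<in> Cen Q" "cj (c \<otimes> x) ` L = L" using ex x by blast
  let ?y = "c \<otimes> x"
  have cc: "c \<in> carrier G" using c by (simp add: Cen_def)
  have yc: "?y \<in> carrier G" using cc xc by simp
  have yN: "?y \<in> Nor L" using c(2) yc by (auto simp: Nor_def)
  \<comment> \<open>\<open>m\<close> is the largest divisor of the group order prime to
    \<open>q\<close>, so raising to the power \<open>m\<close> produces q-elements.\<close>
  obtain m where m: "order G = q ^ multiplicity q (order G) * m" "\<not> q dvd m"
    by (rule multiplicity_decompose'[of "order G" q])
       (use q in \<open>auto simp: order_gt_0_iff_finite prime_nat_iff\<close>)
  have "?y [^] order G = \<one>" using yc pow_order_eq_1 by blast
  then have "(?y [^] m) [^] (q ^ multiplicity q (order G)) = \<one>"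
    using yc m(1) by (simp add: nat_pow_pow mult.commute)
  then have "p_element q (?y [^] m)" using yc unfolding p_element_def by blast
  then have yL: "?y [^] m \<in> Cen L" using p'_centralD[OF L q] Nor_pow[OF yN Q(2)] by blast
  have same: "cj (?y [^] i) a = cj (x [^] i) a \<and> cj (x [^] i) a \<in> Q" if a: "a \<in> Q" for a and i :: nat
  proof (induction i)
    case (Suc i)
    let ?b = "cj (x [^] i) a"
    have b: "?b \<in> Q" "?b \<in> carrier G" using Suc Qc by auto
    have xb: "cj x ?b \<in> Q" using b Nor_mem[OF x(2)] by blast
    have ac: "a \<in> carrier G" using a Qc by blast
    have "cj (?y [^] Suc i) a = cj ?y (cj (?y [^] i) a)"
      unfolding nat_pow_Suc2[OF yc] using yc ac by (simp add: cj_cj)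
    also have "\<dots> = cj c (cj x ?b)" using Suc b cc xc by (simp add: cj_cj)
    also have "\<dots> = cj x ?b" using Cen_fixed[OF c(1) xb] .
    also have "\<dots> = cj (x [^] Suc i) a"
      unfolding nat_pow_Suc2[OF xc] using xc ac by (simp add: cj_cj)
    finally show ?case using xb xc ac unfolding nat_pow_Suc2[OF xc] by (simp add: cj_cj)
  qed (use a Qc in auto)
  have "x [^] m \<in> Cen Q"
  proof -
    have "cj (x [^] m) a = a" if a: "a \<in> Q" for a
      using same[OF a, of m] Cen_fixed[OF yL, of a] a Q by auto
    then show ?thesis using xc by (simp add: Cen_def)
  qed
  moreover have "x [^] (q ^ k) \<in> Cen Q" unfolding k using subgroup.one_closed[OF Cen_subgroup[OF Qc]] .
  moreover have "coprime m (q ^ k)"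
    using m(2) q by (metis coprime_commute coprime_power_right_iff prime_imp_coprime)
  ultimately show "x \<in> Cen Q" using pow_mem_coprime[OF Cen_subgroup[OF Qc] xc] by blast
qed

text \<open>The product of \<open>C\<close> and \<open>T\<close> is a subgroup containing a Sylow
  subgroup of \<open>K\<close> for every prime: \<open>T\<close> for \<open>p\<close>, and one
  inside \<open>C\<close> for any other prime. Hence its order is divisible by that of
  \<open>K\<close>.\<close>

lemma p'_elements_cover:
  assumes p: "Factorial_Ring.prime p" and K: "subgroup K G" and C: "subgroup C G" "C \<subseteq> K" "K \<subseteq> Nor C"
    and el: "\<And>q x. Factorial_Ring.prime q \<Longrightarrow> q \<noteq> p \<Longrightarrow> p_element q x \<Longrightarrow> x \<in> K \<Longrightarrow> x \<in> C"
    and T: "sylow_in p K T" and k: "k \<in> K"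
  obtains c t where "c \<in> C" "t \<in> T" "k = c \<otimes> t"
proof -
  have sT: "subgroup T G" "T \<subseteq> K" using T by (auto simp: sylow_in_def p_subgroup_def)
  have Kc: "K \<subseteq> carrier G" using K by (simp add: subgroup.subset)
  let ?V = "{c \<otimes> t |c t. c \<in> C \<and> t \<in> T}"
  have VK: "?V \<subseteq> K" using C sT K by (auto simp: subset_iff subgroup.m_closed)
  have sV: "subgroup ?V G"
  proof (rule subgroupI_finite)
    show "?V \<subseteq> carrier G" using VK Kc by blast
    have "\<one> = \<one> \<otimes> \<one>" by simp
    then show "\<one> \<in> ?V" using C sT subgroup.one_closed by blast
    fix v w assume "v \<in> ?V" "w \<in> ?V"
    then obtain a b s t where st: "a \<in> C" "b \<in> C" "s \<in> T" "t \<in> T" "v = a \<otimes> s" "w = b \<otimes> t" by blast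
    have c: "a \<in> carrier G" "b \<in> carrier G" "s \<in> carrier G" "t \<in> carrier G" using st C sT Kc by blast+
    have "v \<otimes> w = (a \<otimes> cj s b) \<otimes> (s \<otimes> t)" using st c by (simp add: cj_def m_assoc)
    moreover have "cj s b \<in> C" using st sT C Nor_mem by blast
    ultimately show "v \<otimes> w \<in> ?V" using st subgroup.m_closed[OF C(1)] subgroup.m_closed[OF sT(1)] by blast
  qed
  have CV: "C \<subseteq> ?V"
  proof
    fix c assume c: "c \<in> C"
    then have "c = c \<otimes> \<one>" using C Kc by (auto simp: subsetD)
    then show "c \<in> ?V" using c subgroup.one_closed[OF sT(1)] by blast
  qed
  have TV: "T \<subseteq> ?V"
  proof
    fix c assume c: "c \<in> T"
    then have "c = \<one> \<otimes> c" using sT Kc by (auto simp: subsetD)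
    then show "c \<in> ?V" using c subgroup.one_closed[OF C(1)] by blast
  qed
  have V0: "card ?V \<noteq> 0" using subgroup_card_pos[OF sV] by simp
  have "card K dvd card ?V"
  proof (rule multiplicity_le_imp_dvd)
    show "card K \<noteq> 0" using subgroup_card_pos[OF K] by simp
    fix q :: nat assume q: "Factorial_Ring.prime q"
    obtain Tq where Tq: "sylow_in q K Tq" by (rule sylow_exists[OF q K])
    have "\<exists>W. subgroup W G \<and> W \<subseteq> ?V \<and> card W = q ^ multiplicity q (card K)"
    proof (cases "q = p")
      case True
      then show ?thesis using sT TV sylow_in_card[OF p K T] by blast
    next
      case False
      have s: "p_subgroup q Tq" "Tq \<subseteq> K" using Tq by (auto simp: sylow_in_def)
      then have "Tq \<subseteq> C" using el[OF q False] p_subgroup_element by blast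
      then show ?thesis using s CV sylow_in_card[OF q K Tq] p_subgroup_subgroup by blast
    qed
    then obtain W where W: "subgroup W G" "W \<subseteq> ?V" "card W = q ^ multiplicity q (card K)" by blast
    have "q ^ multiplicity q (card K) dvd card ?V" using card_subgroup_dvd[OF W(1) sV W(2)] unfolding W(3) .
    then show "multiplicity q (card K) \<le> multiplicity q (card ?V)"
      using V0 q by (intro multiplicity_geI) (auto simp: prime_nat_iff simp del: mem_Collect_eq)
  qed
  then have "card K \<le> card ?V" using V0 by (simp add: dvd_imp_le)
  then have "?V = K" by (rule card_seteq[OF subgroup_finite[OF K] VK])
  then show ?thesis using k that by blast
qed

text \<open>Conjugation by the inverse of \<open>k\<close> moves \<open>L\<close> and its conjugate
  into \<open>S\<close>, where weak closure makes both equal to \<open>L\<close>.\<close>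

lemma weakly_closed_common_sylow:
  assumes wc: "weakly_closed S L" and S: "S \<subseteq> carrier G" and h: "h \<in> carrier G" and k: "k \<in> carrier G"
    and sub: "L \<subseteq> cj k ` S" "cj h ` L \<subseteq> cj k ` S"
  shows "cj h ` L = L"
proof -
  have Lc: "L \<subseteq> carrier G" using wc by (simp add: weakly_closed_def subgroup.subset)
  have bk: "cj (inv k) ` cj k ` S = S"
    using k S by (simp add: cj_image_image)
  have 1: "cj (inv k) ` L = L"
    using image_mono[OF sub(1), of "cj (inv k)"] wc k unfolding bk by (simp add: weakly_closed_def)
  have "cj (inv k \<otimes> h) ` L \<subseteq> S"
    using image_mono[OF sub(2), of "cj (inv k)"] k h Lc unfolding bk by (simp add: cj_image_image)
  then have "cj (inv k \<otimes> h) ` L = L" using wc k h by (simp add: weakly_closed_def)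
  then have "cj (inv k) ` cj h ` L = cj (inv k) ` L" using 1 k h Lc by (simp add: cj_image_image)
  then have "cj k ` cj (inv k) ` cj h ` L = cj k ` cj (inv k) ` L" by simp
  then show ?thesis using k h Lc by (simp add: cj_image_image m_assoc[symmetric])
qed

text \<open>If \<open>H\<close> is the only subgroup of index \<open>p\<close>, an element
  \<open>a\<close> of \<open>L\<close> outside \<open>H\<close> lies in no such subgroup, so it
  generates \<open>L\<close>, and \<open>H\<close> is generated by \<open>a [^] p\<close>.\<close>

lemma other_maximal_or_cyclic:
  assumes p: "Factorial_Ring.prime p" and L: "p_subgroup p L" and H: "index_p p L H"
  shows "(\<exists>M. index_p p L M \<and> M \<noteq> H) \<or> (\<exists>b\<in>carrier G. H = {b [^] (i::nat) |i. True})"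
proof (rule disjCI)
  assume "\<not> (\<exists>b\<in>carrier G. H = {b [^] (i::nat) |i. True})"
  show "\<exists>M. index_p p L M \<and> M \<noteq> H"
  proof (rule ccontr)
    assume "\<nexists>M. index_p p L M \<and> M \<noteq> H"
    then have uniq: "M = H" if "index_p p L M" for M using that by blast
    have sL: "subgroup L G" and sH: "subgroup H G" "H \<subset> L"
      using H index_p_psubset[OF p H] by (auto simp: index_p_def)
    obtain a where a: "a \<in> L" "a \<notin> H" using sH by blast
    have ac: "a \<in> carrier G" using a sL subgroup_memD by blast
    have sgen: "subgroup (generate G {a}) G" "generate G {a} \<subseteq> L"
      using ac a sL generate_subgroup_incl[of "{a}" L] by (simp_all add: generate_is_subgroup)
    have "generate G {a} = L"
    proof (rule ccontr)
      assume "generate G {a} \<noteq> L"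
      then obtain M where "index_p p L M" "generate G {a} \<subseteq> M" using p_group_maximal[OF p L sgen(1)] sgen(2) by blast
      then show False using uniq a generate.incl[of a "{a}" G] by auto
    qed
    then have La: "L = {a [^] (i::nat) |i. True}"
      using generate_pow_on_finite_carrier[OF finite_carrier ac] by auto
    have apH: "a [^] p \<in> H" using index_p_pow_mem[OF p L H a(1)] .
    have "H = {(a [^] p) [^] (i::nat) |i. True}"
    proof (intro equalityI subsetI)
      fix h assume h: "h \<in> H"
      then obtain i :: nat where i: "h = a [^] i" using La sH by blast
      have "p dvd i"
      proof (rule ccontr)
        assume "\<not> p dvd i"
        then have "coprime i p" using p prime_imp_coprime coprime_commute by metis
        then show False using pow_mem_coprime[OF sH(1) ac _ apH] h i a by blast
      qed
      then obtain j where "i = p * j" by (rule dvdE)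
      then have "h = (a [^] p) [^] j" using i ac by (simp add: nat_pow_pow)
      then show "h \<in> {(a [^] p) [^] (i::nat) |i. True}" by blast
    next
      fix h assume "h \<in> {(a [^] p) [^] (i::nat) |i. True}"
      then show "h \<in> H" using subgroup_pow[OF sH(1) apH] by blast
    qed
    then show False using ac \<open>\<not> (\<exists>b\<in>carrier G. H = {b [^] (i::nat) |i. True})\<close> by blast
  qed
qed

text \<open>A subgroup of index \<open>p\<close> in a cyclic p-group consists of p-th powers, so
  every element normalising \<open>H\<close> normalises it, and
  \<open>fixes_if_fixes_maximal\<close> applies.\<close>

lemma p'_central_cyclic:
  assumes p: "Factorial_Ring.prime p" and cop: "coprime (p - 1) (order G)"
    and b: "b \<in> carrier G" and H: "p_subgroup p H" "H = {b [^] (i::nat) |i. True}"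
  shows "p'_central p H"
  unfolding p'_central_def
proof (intro allI impI)
  fix q x assume q: "Factorial_Ring.prime q" "q \<noteq> p" and x: "p_element q x" "x \<in> Nor H"
  have xc: "x \<in> carrier G" using x by (simp add: p_element_def)
  have bH: "b \<in> H"
  proof -
    have "b [^] (1::nat) \<in> H" unfolding H(2) by blast
    then show ?thesis using b by simp
  qed
  have Hc: "H \<subseteq> carrier G" using H p_subgroup_subset by blast
  have bc: "b \<in> carrier G" using bH Hc by blast
  show "x \<in> Cen H"
  proof (rule fixes_if_fixes_maximal[OF p q(1) _ x(1) cop H(1) x(2)])
    show "p \<noteq> q" using q by simp
    fix M assume M: "index_p p H M"
    have sM: "subgroup M G" "M \<subset> H" using M index_p_psubset[OF p] by (auto simp: index_p_def)
    have bM: "b \<notin> M" using sM subgroup_pow[OF sM(1)] H(2) by blast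
    have "cj x h \<in> M" if h: "h \<in> M" for h
    proof -
      obtain i :: nat where i: "h = b [^] i" using h sM H(2) by blast
      have "p dvd i"
      proof (rule ccontr)
        assume "\<not> p dvd i"
        then have "coprime i p" using p prime_imp_coprime coprime_commute by metis
        then show False
          using pow_mem_coprime[OF sM(1) bc _ index_p_pow_mem[OF p H(1) M bH]] h i bM by blast
      qed
      then obtain j where j: "i = j * p" by (metis dvdE mult.commute)
      have "cj x h = (cj x b [^] j) [^] p" unfolding i j using xc bc by (simp add: cj_pow nat_pow_pow)
      moreover have "cj x b [^] j \<in> H"
        using Nor_mem[OF x(2) bH] subgroup_pow[OF p_subgroup_subgroup[OF H(1)]] by blast
      ultimately show ?thesis using index_p_pow_mem[OF p H(1) M] by simp
    qed
    then show "x \<in> Nor M" using xc by (simp add: Nor_def)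
  qed
qed

text \<open>\<open>L\<close> is generated by \<open>M1\<close> and any element of \<open>M2\<close>
  outside \<open>M1\<close>.\<close>

lemma two_maximal_Nor:
  assumes p: "Factorial_Ring.prime p" and L: "p_subgroup p L"
    and M: "index_p p L M1" "index_p p L M2" "M1 \<noteq> M2" and x: "x \<in> Nor M1" "x \<in> Nor M2"
  shows "x \<in> Nor L"
proof -
  have sL: "subgroup L G" "M1 \<subseteq> L" "M2 \<subseteq> L" and s: "subgroup M1 G" "subgroup M2 G" using M by (auto simp: index_p_def)
  have "p * card M1 = p * card M2" using M by (simp add: index_p_def)
  then have "card M1 = card M2" using p by (simp add: prime_nat_iff)
  then have "\<not> M2 \<subseteq> M1" using M(3) subgroup_finite[OF s(1)] card_subset_eq by metis
  then obtain z where z: "z \<in> M2" "z \<notin> M1" by blast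
  have xc: "x \<in> carrier G" using x Nor_carrier by blast
  have "cj x a \<in> L" if a: "a \<in> L" for a
  proof -
    obtain u and i :: nat where u: "u \<in> M1" "a = u \<otimes> z [^] i"
      using index_p_generate[OF p L M(1) _ a, of z] z sL by blast
    have "cj x a = cj x u \<otimes> cj x z [^] i"
      using u z xc s subgroup_memD by (simp add: cj_mult cj_pow)
    moreover have "cj x u \<in> L" "cj x z \<in> L" using u z x Nor_mem sL by blast+
    ultimately show ?thesis using subgroup_pow[OF sL(1)] subgroup.m_closed[OF sL(1)] by simp
  qed
  then show ?thesis using xc by (simp add: Nor_def)
qed

section \<open>Transvections in groups of odd order\<close>

text \<open>For a transvection \<open>t\<close> with axis containing \<open>r\<close> this shows
  that all commutators are powers of the single commutator with \<open>y\<close>.\<close>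

lemma commutator_pow:
  assumes c: "t \<in> carrier G" "r \<in> carrier G" "y \<in> carrier G" and r: "cj t r = r"
    and y: "y \<otimes> (inv y \<otimes> cj t y) = (inv y \<otimes> cj t y) \<otimes> y"
  shows "inv (r \<otimes> y [^] (i::nat)) \<otimes> cj t (r \<otimes> y [^] i) = (inv y \<otimes> cj t y) [^] i"
proof -
  let ?c = "inv y \<otimes> cj t y"
  have "cj t (r \<otimes> y [^] i) = r \<otimes> (y \<otimes> ?c) [^] i" using c r by (simp add: cj_mult cj_pow)
  also have "(y \<otimes> ?c) [^] i = y [^] i \<otimes> ?c [^] i" using c y by (intro pow_mult_distrib) auto
  finally show ?thesis using c by (simp add: m_assoc inv_mult_group)
qed

text \<open>If the transvections \<open>t\<close> and \<open>u\<close> with axes \<open>R1\<close> and \<open>R2\<close> both acted non-trivially on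
  \<open>Q / (R1 \<inter> R2)\<close>, then, as in \<open>SL(2, p)\<close>, some \<open>g = t u\<^sup>j t\<close> would act there as an element of
  order 4: its square inverts \<open>c\<close>. This is impossible in a group of odd order.\<close>

lemma transvections_odd_order:
  assumes odd: "odd (order G)" and Q: "subgroup Q G" and comm: "\<And>a b. a \<in> Q \<Longrightarrow> b \<in> Q \<Longrightarrow> a \<otimes> b = b \<otimes> a"
    and t: "t \<in> Nor Q" and u: "u \<in> Nor Q"
    and R: "subgroup R1 G" "R1 \<subseteq> Q" "subgroup R2 G" "R2 \<subseteq> Q"
    and gen1: "\<And>z a. z \<in> Q - R1 \<Longrightarrow> a \<in> Q \<Longrightarrow> \<exists>r\<in>R1. \<exists>i::nat. a = r \<otimes> z [^] i"
    and gen2: "\<And>z a. z \<in> Q - R2 \<Longrightarrow> a \<in> Q \<Longrightarrow> \<exists>r\<in>R2. \<exists>i::nat. a = r \<otimes> z [^] i"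
    and t1: "t \<in> Cen R1" "\<And>a. a \<in> Q \<Longrightarrow> inv a \<otimes> cj t a \<in> R1"
    and u2: "u \<in> Cen R2" "\<And>a. a \<in> Q \<Longrightarrow> inv a \<otimes> cj u a \<in> R2"
  shows "(\<forall>a\<in>Q. inv a \<otimes> cj t a \<in> R2) \<or> (\<forall>a\<in>Q. inv a \<otimes> cj u a \<in> R1)"
proof (rule ccontr)
  assume "\<not> ?thesis"
  then obtain a1 a2 where a1: "a1 \<in> Q" "inv a1 \<otimes> cj t a1 \<notin> R2" and a2: "a2 \<in> Q" "inv a2 \<otimes> cj u a2 \<notin> R1" by blast
  have Qc: "a \<in> Q \<Longrightarrow> a \<in> carrier G" for a using Q subgroup_memD by blast
  have tc: "t \<in> carrier G" and uc: "u \<in> carrier G" using t u Nor_carrier by auto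
  have m: "a \<otimes> b \<in> Q" if "a \<in> Q" "b \<in> Q" for a b using that Q by (simp add: subgroup.m_closed)
  have i: "inv a \<in> Q" if "a \<in> Q" for a using that Q by (simp add: subgroup.m_inv_closed)
  have lcomm: "a \<otimes> (b \<otimes> c) = b \<otimes> (a \<otimes> c)" if "a \<in> Q" "b \<in> Q" "c \<in> Q" for a b c
    using that comm[OF that(1,2)] Qc by (simp add: m_assoc[symmetric])
  \<comment> \<open>The commutator of \<open>u\<close> with \<open>a2\<close> serves as
    \<open>y\<close>.\<close>
  obtain y where y: "y \<in> R2" "y \<notin> R1" using u2(2)[OF a2(1)] a2 by blast
  define c where "c = inv y \<otimes> cj t y"
  have yQ: "y \<in> Q" using y R by blast
  have cR1: "c \<in> R1" unfolding c_def using t1(2)[OF yQ] .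
  have cQ: "c \<in> Q" using cR1 R by blast
  \<comment> \<open>Otherwise every commutator of \<open>t\<close> with \<open>Q\<close>, being a
    power of \<open>c\<close>, would lie in \<open>R2\<close>, against the choice of
    \<open>a1\<close>. The argument for \<open>w\<close> below is symmetric.\<close>
  have cR2: "c \<notin> R2"
  proof
    assume "c \<in> R2"
    obtain r and j :: nat where r: "r \<in> R1" "a1 = r \<otimes> y [^] j" using gen1[of y a1] yQ y a1 by blast
    have "inv a1 \<otimes> cj t a1 = c [^] j" unfolding r(2) c_def
      by (rule commutator_pow) (use r R Qc tc yQ comm[OF yQ cQ] Cen_fixed[OF t1(1)] in \<open>auto simp: c_def\<close>)
    then show False using a1 subgroup_pow[OF R(3) \<open>c \<in> R2\<close>] by simp
  qed
  define w where "w = inv c \<otimes> cj u c"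
  have wR2: "w \<in> R2" unfolding w_def using u2(2)[OF cQ] .
  have wQ: "w \<in> Q" using wR2 R by blast
  have wR1: "w \<notin> R1"
  proof
    assume "w \<in> R1"
    obtain r and j :: nat where r: "r \<in> R2" "a2 = r \<otimes> c [^] j" using gen2[of c a2] cQ cR2 a2 by blast
    have "inv a2 \<otimes> cj u a2 = w [^] j" unfolding r(2) w_def
      by (rule commutator_pow) (use r R Qc uc cQ comm[OF cQ wQ] Cen_fixed[OF u2(1)] in \<open>auto simp: w_def\<close>)
    then show False using a2 subgroup_pow[OF R(1) \<open>w \<in> R1\<close>] by simp
  qed
  \<comment> \<open>The exponent \<open>j\<close> makes \<open>w [^] j\<close> equal to the inverse
    of \<open>y\<close> up to the factor \<open>b\<close> in both axes. Modulo \<open>b\<close>, the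
    element \<open>g\<close> below then sends \<open>c\<close> to the inverse of \<open>y\<close>,
    and \<open>y\<close> to \<open>c\<close>.\<close>
  obtain r and j :: nat where r: "r \<in> R1" "inv y = r \<otimes> w [^] j" using gen1[of w "inv y"] wQ wR1 i[OF yQ] by blast
  define b where "b = w [^] j \<otimes> y"
  have wjQ: "w [^] j \<in> Q" using subgroup_pow[OF Q wQ] .
  have bQ: "b \<in> Q" unfolding b_def using m wjQ yQ .
  have rQ: "r \<in> Q" using r R by blast
  have "b = inv r"
  proof -
    have "r \<otimes> b = inv y \<otimes> y" unfolding b_def using r(2) rQ wjQ yQ Qc by (simp add: m_assoc)
    then have "r \<otimes> b = \<one>" using yQ Qc by simp
    then have "inv r \<otimes> (r \<otimes> b) = inv r" using rQ Qc by simp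
    then show ?thesis using rQ bQ Qc by simp
  qed
  then have bR1: "b \<in> R1" using r subgroup.m_inv_closed[OF R(1)] by simp
  have bR2: "b \<in> R2" unfolding b_def using subgroup_pow[OF R(3) wR2] y subgroup.m_closed[OF R(3)] by simp
  have wj: "w [^] j = b \<otimes> inv y" unfolding b_def using wjQ yQ Qc by (simp add: m_assoc)
  define v where "v = u [^] j"
  have vc: "v \<in> carrier G" unfolding v_def using uc by simp
  have vR2: "cj v a = a" if "a \<in> R2" for a
    unfolding v_def using cj_fixed_pow[OF uc _ Cen_fixed[OF u2(1) that]] that R Qc by blast
  have tR1: "cj t a = a" if "a \<in> R1" for a using Cen_fixed[OF t1(1) that] .
  have ty: "cj t y = y \<otimes> c" unfolding c_def using yQ Qc tc by simp
  have uc': "cj (u [^] k) c = c \<otimes> w [^] k" for k :: nat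
  proof (induction k)
    case 0
    then show ?case using cQ Qc by simp
  next
    case (Suc k)
    have "cj (u [^] Suc k) c = cj (u [^] k) (c \<otimes> w)"
      using uc cQ Qc by (simp add: cj_cj[symmetric] w_def)
    also have "\<dots> = cj (u [^] k) c \<otimes> w"
      using uc cQ wQ Qc cj_fixed_pow[OF uc _ Cen_fixed[OF u2(1) wR2]] by (simp add: cj_mult)
    finally show ?case using Suc cQ wQ Qc by (simp add: m_assoc)
  qed
  have vcc: "cj v c = c \<otimes> (b \<otimes> inv y)" unfolding v_def uc' wj ..
  have iyQ: "inv y \<in> Q" and icQ: "inv c \<in> Q" using i yQ cQ by auto
  define g where "g = t \<otimes> (v \<otimes> t)"
  have gc: "g \<in> carrier G" unfolding g_def using tc vc by simp
  have g: "cj g a = cj t (cj v (cj t a))" if "a \<in> carrier G" for a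
    unfolding g_def using that tc vc by (simp add: cj_cj m_assoc)
  have gb: "cj g b = b" using g bQ Qc tR1 vR2 bR1 bR2 by simp
  have "cj g c = cj t (c \<otimes> (b \<otimes> inv y))" using g cQ Qc tR1[OF cR1] vcc by simp
  also have "\<dots> = c \<otimes> (b \<otimes> inv (y \<otimes> c))" using tc cQ bQ yQ Qc tR1[OF cR1] tR1[OF bR1] ty by (simp add: cj_mult cj_inv)
  also have "inv (y \<otimes> c) = inv c \<otimes> inv y" using yQ cQ Qc by (simp add: inv_mult_group)
  also have "c \<otimes> (b \<otimes> (inv c \<otimes> inv y)) = b \<otimes> inv y"
    using lcomm[OF bQ icQ iyQ] cQ bQ iyQ Qc by simp
  finally have gcc: "cj g c = b \<otimes> inv y" .
  have "cj g y = cj t (y \<otimes> (c \<otimes> (b \<otimes> inv y)))" using g yQ cQ Qc ty vR2[OF y(1)] vc vcc by (simp add: cj_mult)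
  also have "y \<otimes> (c \<otimes> (b \<otimes> inv y)) = c \<otimes> b"
    using lcomm[OF yQ cQ m[OF bQ iyQ]] lcomm[OF yQ bQ iyQ] yQ cQ bQ Qc by simp
  also have "cj t (c \<otimes> b) = c \<otimes> b" using tc cQ bQ Qc tR1[OF cR1] tR1[OF bR1] by (simp add: cj_mult)
  finally have gy: "cj g y = c \<otimes> b" .
  have "cj g (cj g c) = b \<otimes> inv (c \<otimes> b)" using gcc gy gb gc bQ yQ Qc by (simp add: cj_mult cj_inv)
  also have "inv (c \<otimes> b) = inv c \<otimes> inv b" using cQ bQ Qc comm[OF cQ bQ] by (simp add: inv_mult_group)
  also have "b \<otimes> (inv c \<otimes> inv b) = inv c" using lcomm[OF bQ icQ i[OF bQ]] bQ cQ Qc by simp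
  finally have "cj (g \<otimes> g) c = inv c" using gc cQ Qc by (simp add: cj_cj)
  then have "cj ((g \<otimes> g) [^] n) c = (if even n then c else inv c)" for n :: nat
    using gc cQ Qc by (induction n) (auto simp: cj_cj[symmetric] cj_inv)
  \<comment> \<open>The exponent is odd, which selects \<open>inv c\<close>, while this power of
    \<open>g \<otimes> g\<close> is the identity.\<close>
  from this[of "order G"] have "c = inv c"
    using odd gc cQ Qc pow_order_eq_1[of "g \<otimes> g"] by simp
  then have "c \<otimes> c = \<one>" using cQ Qc r_inv by metis
  then have "c [^] (2::nat) = \<one>" using cQ Qc by (simp add: numeral_2_eq_2)
  moreover have "c [^] order G = \<one>" using cQ Qc pow_order_eq_1 by blast
  moreover have "coprime 2 (order G)" using odd by simp
  ultimately have "c = \<one>" using coprime_pow_eq_one cQ Qc by blast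
  then show False using cR2 subgroup.one_closed[OF R(3)] by simp
qed

section \<open>Stabilisers of subgroup chains\<close>

text \<open>The elements of the normaliser of \<open>Q\<close> acting trivially on each factor of
  the chain from \<open>Q\<close> through \<open>R\<close> and \<open>B\<close> to the trivial
  group.\<close>

definition chain_stabilizer :: "'a set \<Rightarrow> 'a set \<Rightarrow> 'a set \<Rightarrow> 'a set" where
  "chain_stabilizer Q R B = {e \<in> Nor Q. (\<forall>a\<in>Q. inv a \<otimes> cj e a \<in> R) \<and> (\<forall>a\<in>R. inv a \<otimes> cj e a \<in> B) \<and> (\<forall>a\<in>B. cj e a = a)}"

lemma chain_stabilizer:
  assumes s: "subgroup Q G" "subgroup R G" "subgroup B G" "B \<subseteq> R" "R \<subseteq> Q"
  shows "subgroup (chain_stabilizer Q R B) G"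
proof (rule subgroupI_finite)
  let ?E = "chain_stabilizer Q R B"
  have c: "a \<in> Q \<Longrightarrow> a \<in> carrier G" for a using s subgroup_memD by blast
  show "?E \<subseteq> carrier G" using Nor_carrier by (auto simp: chain_stabilizer_def)
  show "\<one> \<in> ?E" using s c subgroup.one_closed subgroup.one_closed[OF Nor_subgroup[of Q]]
    by (auto simp: chain_stabilizer_def subset_iff)
  fix x y assume xy: "x \<in> ?E" "y \<in> ?E"
  then have N: "x \<in> Nor Q" "y \<in> Nor Q" by (auto simp: chain_stabilizer_def)
  then have xyc: "x \<in> carrier G" "y \<in> carrier G" using Nor_carrier by auto
  have split: "inv a \<otimes> cj (x \<otimes> y) a = (inv a \<otimes> cj y a) \<otimes> (inv (cj y a) \<otimes> cj x (cj y a))" if "a \<in> carrier G" for a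
    using that xyc by (simp add: cj_cj m_assoc)
  have yR: "cj y a \<in> R" if "a \<in> R" for a
  proof -
    have "a \<otimes> (inv a \<otimes> cj y a) \<in> R" using xy that s(4) subgroup.m_closed[OF s(2)] by (auto simp: chain_stabilizer_def)
    then show ?thesis using that s c xyc by (auto simp: subset_iff)
  qed
  have "x \<otimes> y \<in> Nor Q" using N Nor_subgroup[of Q] c by (auto intro: subgroup.m_closed)
  moreover have "inv a \<otimes> cj (x \<otimes> y) a \<in> R" if "a \<in> Q" for a
    using split c[OF that] xy that Nor_mem[OF N(2) that] subgroup.m_closed[OF s(2)] by (simp add: chain_stabilizer_def)
  moreover have "inv a \<otimes> cj (x \<otimes> y) a \<in> B" if "a \<in> R" for a
    using split c[of a] s that xy yR[OF that] subgroup.m_closed[OF s(3)] by (auto simp: chain_stabilizer_def)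
  moreover have "cj (x \<otimes> y) a = a" if "a \<in> B" for a
    using that s c[of a] xy xyc by (auto simp: chain_stabilizer_def cj_cj[symmetric])
  ultimately show "x \<otimes> y \<in> ?E" by (simp add: chain_stabilizer_def)
qed

text \<open>Coprime action climbs the chain: \<open>x\<close> centralises \<open>B\<close>, hence
  \<open>R\<close>, hence \<open>Q\<close>, by \<open>coprime_fixed_p\<close> at each step.\<close>

lemma chain_stabilizer_central:
  assumes pq: "Factorial_Ring.prime p" "Factorial_Ring.prime q" "q \<noteq> p"
    and Q: "p_subgroup p Q" and s: "subgroup R G" "subgroup B G" "B \<subseteq> R" "R \<subseteq> Q"
    and x: "p_element q x" "x \<in> chain_stabilizer Q R B"
  shows "x \<in> Cen Q"
proof -
  have c: "a \<in> Q \<Longrightarrow> a \<in> carrier G" for a using Q p_subgroup_subset by blast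
  have xc: "x \<in> carrier G" using x by (simp add: p_element_def)
  have pR: "p_subgroup p R" and pB: "p_subgroup p B" using p_subgroup_mono[OF Q _ _ pq(1)] s by auto
  have "x \<in> Cen B" using x xc by (auto simp: chain_stabilizer_def Cen_def)
  then have "x \<in> Cen R"
    using coprime_fixed_p[OF pq(1,2) pq(3)[symmetric] x(1) pB] x xc s c by (auto simp: chain_stabilizer_def Cen_def)
  then show ?thesis
    using coprime_fixed_p[OF pq(1,2) pq(3)[symmetric] x(1) pR] x xc s c by (auto simp: chain_stabilizer_def Cen_def)
qed

lemma Cen_subset_chain_stabilizer:
  assumes s: "subgroup Q G" "subgroup R G" "subgroup B G" "B \<subseteq> R" "R \<subseteq> Q"
  shows "Cen Q \<subseteq> chain_stabilizer Q R B"
proof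
  fix x assume x: "x \<in> Cen Q"
  have "inv a \<otimes> cj x a = \<one>" if "a \<in> Q" for a
    using Cen_fixed[OF x that] that subgroup_memD[OF s(1)] by simp
  moreover have "x \<in> Nor Q" using x Cen_subset_Nor by blast
  ultimately show "x \<in> chain_stabilizer Q R B"
    using s x by (auto simp: chain_stabilizer_def subgroup.one_closed Cen_fixed subset_iff)
qed

end

section \<open>Local analysis when the subgroups of one order are abelian and weakly closed\<close>

locale weakly_closed_abelian = finite_group G for G (structure) +
  fixes p m :: nat and S :: "'a set"
  assumes prime: "Factorial_Ring.prime p" and odd: "odd p" and coprime_order: "coprime (p - 1) (order G)"
    and S: "sylow_in p (carrier G) S" and m: "0 < m" "p ^ m < card S"
    and closed: "\<And>H. subgroup H G \<Longrightarrow> H \<subseteq> S \<Longrightarrow> card H = p ^ m \<Longrightarrow> weakly_closed S H"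
    and abelian: "\<And>H a b. subgroup H G \<Longrightarrow> H \<subseteq> S \<Longrightarrow> card H = p ^ m \<Longrightarrow> a \<in> H \<Longrightarrow> b \<in> H \<Longrightarrow> a \<otimes> b = b \<otimes> a"
begin

lemma p_subgroup_S: "p_subgroup p S" using S by (simp add: sylow_in_def)
lemma S_carrier: "S \<subseteq> carrier G" using p_subgroup_S p_subgroup_subset by blast

lemma odd_order: "odd (order G)"
proof
  assume "even (order G)"
  moreover have "even (p - 1)" using odd by (auto elim!: oddE)
  ultimately show False using coprime_order by (metis coprime_common_divisor odd_one)
qed

lemma Nor_order_d:
  assumes Q: "Q \<subseteq> S" "x \<in> Nor Q" and H: "subgroup H G" "H \<subseteq> Q" "card H = p ^ m"
  shows "x \<in> Nor H"
proof -
  have "cj x ` H \<subseteq> Q" using Q H Nor_mem by blast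
  then have "cj x ` H \<subseteq> S" "x \<in> carrier G" using Q Nor_carrier by auto
  moreover have "weakly_closed S H" using closed H Q by blast
  ultimately have "cj x ` H = H" by (simp add: weakly_closed_def)
  then show ?thesis using NorI_image \<open>x \<in> carrier G\<close> by blast
qed

text \<open>An element conjugating \<open>L\<close> into \<open>S\<close> conjugates
  \<open>M1\<close> and \<open>M2\<close> into \<open>S\<close>. Both have order
  \<open>p ^ m\<close>, so weak closure makes the element normalise them, and therefore
  \<open>L\<close>.\<close>

lemma noncyclic_weakly_closed:
  assumes L: "L \<subseteq> S" "index_p p L M1" "index_p p L M2" "M1 \<noteq> M2" "card M1 = p ^ m"
  shows "weakly_closed S L"
proof -
  have sL: "subgroup L G" and s: "subgroup M1 G" "subgroup M2 G" "M1 \<subseteq> L" "M2 \<subseteq> L" using L by (auto simp: index_p_def)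
  have pL: "p_subgroup p L" by (rule p_subgroup_mono[OF p_subgroup_S sL L(1) prime])
  have "p * card M1 = p * card M2" using L by (simp add: index_p_def)
  then have c2: "card M2 = p ^ m" using prime L(5) by (simp add: prime_nat_iff)
  have w: "weakly_closed S M1" "weakly_closed S M2" using closed s L c2 by auto
  have "cj g ` L = L" if g: "g \<in> carrier G" "cj g ` L \<subseteq> S" for g
  proof -
    have "cj g ` M1 \<subseteq> S" "cj g ` M2 \<subseteq> S" using g s by blast+
    then have "cj g ` M1 = M1" "cj g ` M2 = M2" using w g(1) unfolding weakly_closed_def by blast+
    then have "g \<in> Nor M1" "g \<in> Nor M2" using NorI_image g by auto
    then have "g \<in> Nor L" using two_maximal_Nor[OF prime pL L(2,3,4)] by blast
    then show ?thesis using Nor_image sL by (simp add: subgroup.subset)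
  qed
  then show ?thesis using sL L by (simp add: weakly_closed_def)
qed

text \<open>All subgroups of \<open>Q\<close> of order \<open>p ^ m\<close> are normalised by
  \<open>x\<close>. Each such \<open>H\<close> sits in some \<open>L\<close> of order
  \<open>p ^ (m + 1)\<close> inside \<open>Q\<close>: a second maximal subgroup of \<open>L\<close>
  makes \<open>x\<close> centralise \<open>L\<close>, and otherwise \<open>H\<close> is cyclic.
  These \<open>H\<close> cover the elements of order \<open>p\<close>, which suffices for odd
  \<open>p\<close>.\<close>

lemma p'_central_large:
  assumes Q: "subgroup Q G" "Q \<subseteq> S" "p ^ m < card Q"
  shows "p'_central p Q"
  unfolding p'_central_def
proof (intro allI impI)
  fix q x assume q: "Factorial_Ring.prime q" "q \<noteq> p" and x: "p_element q x" "x \<in> Nor Q"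
  have pQ: "p_subgroup p Q" by (rule p_subgroup_mono[OF p_subgroup_S Q(1,2) prime])
  have Qc: "Q \<subseteq> carrier G" using pQ p_subgroup_subset by blast
  have cen: "x \<in> Cen H" if H: "subgroup H G" "H \<subseteq> Q" "card H = p ^ m" for H
  proof -
    have xH: "x \<in> Nor H" by (rule Nor_order_d[OF Q(2) x(2) H])
    have pH: "p_subgroup p H" by (rule p_subgroup_mono[OF pQ H(1,2) prime])
    have "H \<subset> Q" using H Q(3) by auto
    then obtain L where L: "index_p p L H" "L \<subseteq> Q" by (rule p_group_extend[OF prime pQ H(1)])
    then have sL: "subgroup L G" "H \<subseteq> L" by (auto simp: index_p_def)
    have pL: "p_subgroup p L" by (rule p_subgroup_mono[OF pQ sL(1) L(2) prime])
    have max: "x \<in> Nor M" if "index_p p L M" for M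
    proof (rule Nor_order_d[OF Q(2) x(2)])
      show "subgroup M G" "M \<subseteq> Q" using that L by (auto simp: index_p_def)
      have "p * card M = p * card H" using that L by (simp add: index_p_def)
      then show "card M = p ^ m" using prime H by (simp add: prime_nat_iff)
    qed
    from other_maximal_or_cyclic[OF prime pL L(1)] show ?thesis
    proof (elim disjE exE conjE bexE)
      fix M assume M: "index_p p L M" "M \<noteq> H"
      have "x \<in> Nor L" by (rule two_maximal_Nor[OF prime pL M(1) L(1) M(2) max[OF M(1)] xH])
      then have "x \<in> Cen L"
        using fixes_if_fixes_maximal[OF prime q(1) q(2)[symmetric] x(1) coprime_order pL] max by blast
      then show ?thesis using Cen_antimono[OF sL(2)] by blast
    next
      fix b assume "b \<in> carrier G" "H = {b [^] (i::nat) |i. True}"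
      then have "p'_central p H" using p'_central_cyclic[OF prime coprime_order _ pH] by blast
      then show ?thesis using p'_centralD q x(1) xH by blast
    qed
  qed
  show "x \<in> Cen Q"
  proof (rule central_if_fixes_order_p[OF prime q(1) q(2)[symmetric] odd x(1) pQ x(2)])
    fix a assume a: "a \<in> Q" "a [^] p = \<one>"
    have ac: "a \<in> carrier G" using a Qc by blast
    have "subgroup (generate G {a}) G" using ac by (simp add: generate_is_subgroup)
    moreover have "generate G {a} \<subseteq> Q" using generate_subgroup_incl[of "{a}" Q] a Q by simp
    moreover have "card (generate G {a}) \<le> p ^ m"
    proof -
      have "card (generate G {a}) = ord a" using generate_pow_card[OF ac] by simp
      moreover have "ord a dvd p" using a ac by (simp add: pow_eq_id)
      then have "ord a \<le> p" using prime by (intro dvd_imp_le) (auto simp: prime_gt_0_nat)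
      \<comment> \<open>Positivity of \<open>m\<close> ensures that a subgroup of order
        \<open>p\<close> fits into one of order \<open>p ^ m\<close>.\<close>
      moreover have "p ^ 1 \<le> p ^ m" using m prime_ge_1_nat[OF prime] by (intro power_increasing) auto
      ultimately show ?thesis by simp
    qed
    ultimately obtain H where "subgroup H G" "generate G {a} \<subseteq> H" "H \<subseteq> Q" "card H = p ^ m"
      by (rule p_group_intermediate[OF prime pQ _ _ _ less_imp_le[OF Q(3)]])
    moreover have "a \<in> generate G {a}" by (simp add: generate.incl)
    ultimately show "cj x a = a" using cen Cen_fixed by blast
  qed
qed

text \<open>Sylow's theorem in \<open>E\<close> moves the conjugate of \<open>L\<close> into a Sylow subgroup containing \<open>L\<close>; since the
  elements of \<open>E\<close> of order prime to \<open>p\<close> lie in \<open>C\<close>, the conjugating element can be chosen in \<open>C\<close>.\<close>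

lemma weakly_closed_conj:
  assumes L: "weakly_closed S L" and g: "g \<in> carrier G"
    and E: "subgroup E G" "L \<subseteq> E" "cj g ` L \<subseteq> E"
    and C: "subgroup C G" "C \<subseteq> E" "E \<subseteq> Nor C"
    and el: "\<And>q x. Factorial_Ring.prime q \<Longrightarrow> q \<noteq> p \<Longrightarrow> p_element q x \<Longrightarrow> x \<in> E \<Longrightarrow> x \<in> C"
  obtains c where "c \<in> C" "cj (c \<otimes> g) ` L = L"
proof -
  have sL: "subgroup L G" "L \<subseteq> S" using L by (auto simp: weakly_closed_def)
  have Lc: "L \<subseteq> carrier G" using sL by (simp add: subgroup.subset)
  have pL: "p_subgroup p L" by (rule p_subgroup_mono[OF p_subgroup_S sL prime])
  obtain T where T: "sylow_in p E T" "L \<subseteq> T" by (rule sylow_above[OF prime E(1) pL E(2)])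
  have pT: "p_subgroup p T" and sT: "subgroup T G" using T by (auto simp: sylow_in_def p_subgroup_def)
  have Tc: "T \<subseteq> carrier G" using sT by (simp add: subgroup.subset)
  obtain e where e: "e \<in> E" "cj g ` L \<subseteq> cj e ` T"
    by (rule sylow_contains[OF prime E(1) T(1) p_subgroup_cj[OF g pL] E(3)])
  obtain c t where ct: "c \<in> C" "t \<in> T" "e = c \<otimes> t"
    by (rule p'_elements_cover[OF prime E(1) C el T(1) e(1)])
  have cc: "c \<in> carrier G" and tc: "t \<in> carrier G" using ct C Tc subgroup_memD by auto
  have "cj t ` T = T" using Nor_image[OF _ Tc] subgroup_subset_Nor[OF sT] ct by blast
  then have "cj e ` T = cj c ` T" using cj_image_image[OF cc tc Tc] ct by simp
  then have "cj (inv c) ` cj g ` L \<subseteq> cj (inv c) ` cj c ` T" using e by auto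
  then have gT: "cj (inv c \<otimes> g) ` L \<subseteq> T" using cc g Lc Tc by (simp add: cj_image_image)
  \<comment> \<open>A conjugate of \<open>S\<close> contains \<open>T\<close>, and hence both
    \<open>L\<close> and its corrected conjugate.\<close>
  obtain k where k: "k \<in> carrier G" "T \<subseteq> cj k ` S"
    by (rule sylow_contains[OF prime subgroup_self S pT Tc])
  have "cj (inv c \<otimes> g) ` L = L"
    by (rule weakly_closed_common_sylow[OF L S_carrier m_closed[OF inv_closed[OF cc] g] k(1)
        subset_trans[OF T(2) k(2)] subset_trans[OF gT k(2)]])
  moreover have "inv c \<in> C" using subgroup.m_inv_closed[OF C(1) ct(1)] .
  ultimately show ?thesis using that by blast
qed

text \<open>Unless \<open>Q\<close> is cyclic, the property is transferred from an overgroup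
  \<open>L\<close> of order \<open>p ^ (m + 1)\<close>, where \<open>p'_central_large\<close>
  applies. What remains is to correct each \<open>g\<close> normalising \<open>Q\<close> by a factor
  centralising \<open>Q\<close> so that \<open>L\<close> is preserved.\<close>

lemma p'_central_order_d:
  assumes Q: "subgroup Q G" "Q \<subseteq> S" "card Q = p ^ m"
  shows "p'_central p Q"
proof -
  have pQ: "p_subgroup p Q" by (rule p_subgroup_mono[OF p_subgroup_S Q(1,2) prime])
  have Qsub: "Q \<subseteq> carrier G" using pQ p_subgroup_subset by blast
  have Qc: "a \<in> Q \<Longrightarrow> a \<in> carrier G" for a using Qsub by blast
  have "Q \<subset> S" using Q m by auto
  then obtain L where L: "index_p p L Q" "L \<subseteq> S" by (rule p_group_extend[OF prime p_subgroup_S Q(1)])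
  then have sL: "subgroup L G" "Q \<subseteq> L" by (auto simp: index_p_def)
  have Lc: "L \<subseteq> carrier G" using sL by (simp add: subgroup.subset)
  have pL: "p_subgroup p L" by (rule p_subgroup_mono[OF p_subgroup_S sL(1) L(2) prime])
  from other_maximal_or_cyclic[OF prime pL L(1)] show ?thesis
  proof (elim disjE exE conjE bexE)
    fix b assume "b \<in> carrier G" "Q = {b [^] (i::nat) |i. True}"
    then show ?thesis using p'_central_cyclic[OF prime coprime_order _ pQ] by blast
  next
    fix M assume M: "index_p p L M" "M \<noteq> Q"
    have sM: "subgroup M G" "M \<subseteq> L" "M \<subseteq> S" using M L by (auto simp: index_p_def)
    have "p * card M = p * card Q" using M L by (simp add: index_p_def)
    then have cM: "card M = p ^ m" using prime Q by (simp add: prime_nat_iff)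
    have wL: "weakly_closed S L" by (rule noncyclic_weakly_closed[OF L(2) M(1) L(1) M(2) cM])
    have LQ: "L \<subseteq> Nor Q" and LM: "L \<subseteq> Nor M" using index_p_normal[OF prime pL] L M by auto
    have "\<not> M \<subseteq> Q" using M(2) cM Q(3) subgroup_finite[OF Q(1)] card_subset_eq by metis
    then obtain t where t: "t \<in> M" "t \<notin> Q" by blast
    have tL: "t \<in> L" using t sM by blast
    have tN: "t \<in> Nor Q" using tL LQ by blast
    have tc: "t \<in> carrier G" using tL Lc by blast
    have commQ: "a \<otimes> b = b \<otimes> a" if "a \<in> Q" "b \<in> Q" for a b using abelian[OF Q] that by blast
    \<comment> \<open>The axis of the transvection \<open>t\<close>: it is centralised because
      \<open>M\<close> is abelian, and it contains the commutators of \<open>t\<close> with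
      \<open>Q\<close> because \<open>L\<close> normalises both \<open>M\<close> and
      \<open>Q\<close>.\<close>
    define R1 where "R1 = M \<inter> Q"
    have R1: "subgroup R1 G" "R1 \<subseteq> Q" unfolding R1_def using subgroups_Inter_pair[OF sM(1) Q(1)] by auto
    \<comment> \<open>Any \<open>z\<close> outside \<open>M\<close> generates \<open>L\<close>
      together with \<open>M\<close>; intersecting with \<open>Q\<close> gives the claim, since
      \<open>z\<close> lies in \<open>Q\<close>.\<close>
    have gen1: "\<exists>r\<in>R1. \<exists>i::nat. a = r \<otimes> z [^] i" if z: "z \<in> Q - R1" and a: "a \<in> Q" for z a
    proof -
      have "z \<in> L - M" "a \<in> L" using z a sL by (auto simp: R1_def)
      then obtain r and i :: nat where r: "r \<in> M" "a = r \<otimes> z [^] i" by (rule index_p_generate[OF prime pL M(1)])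
      have "r = a \<otimes> inv (z [^] i)"
        using r z Qc[of z] subgroup_memD[OF sM(1)] by (simp add: m_assoc)
      moreover have "a \<otimes> inv (z [^] i) \<in> Q"
        using a z subgroup.m_closed[OF Q(1)] subgroup.m_inv_closed[OF Q(1)] subgroup_pow[OF Q(1)] by blast
      ultimately show ?thesis using r by (auto simp: R1_def)
    qed
    have tR1: "t \<in> Cen R1"
    proof -
      have "cj t a = a" if "a \<in> R1" for a
        using that t abelian[OF sM(1,3) cM t(1)] tc Qc[of a] by (auto simp: R1_def cj_fixed_iff)
      then show ?thesis using tc by (simp add: Cen_def)
    qed
    have t2: "inv a \<otimes> cj t a \<in> R1" if a: "a \<in> Q" for a
    proof -
      have ac: "a \<in> carrier G" using a Qc by blast
      have "inv a \<in> L" using subgroup.m_inv_closed[OF Q(1) a] sL by blast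
      then have "cj (inv a) t \<otimes> inv t \<in> M"
        using t LM Nor_mem subgroup.m_closed[OF sM(1)] subgroup.m_inv_closed[OF sM(1)] by blast
      moreover have "inv a \<otimes> cj t a = cj (inv a) t \<otimes> inv t" using ac tc by (simp add: cj_def m_assoc)
      moreover have "inv a \<otimes> cj t a \<in> Q"
        using a Nor_mem[OF tN] subgroup.m_closed[OF Q(1)] subgroup.m_inv_closed[OF Q(1)] by blast
      ultimately show ?thesis by (simp add: R1_def)
    qed
    have pcL: "p'_central p L"
    proof (rule p'_central_large[OF sL(1) L(2)])
      show "p ^ m < card L" using L Q prime_gt_1_nat[OF prime] by (simp add: index_p_def)
    qed
    show ?thesis
    proof (rule p'_central_transfer[OF sL(2) Lc pcL])
      fix g assume gN: "g \<in> Nor Q"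
      have gc: "g \<in> carrier G" using gN by (rule Nor_carrier)
      have igN: "inv g \<in> Nor Q" using subgroup.m_inv_closed[OF Nor_subgroup[OF Qsub] gN] .
      \<comment> \<open>\<open>u\<close> is the conjugate transvection, with axis \<open>R2\<close>;
        its properties are carried over from \<open>t\<close> by conjugation with
        \<open>g\<close>.\<close>
      define u where "u = cj g t"
      define R2 where "R2 = cj g ` R1"
      have uN: "u \<in> Nor Q"
        unfolding u_def using Nor_mem subgroup_subset_Nor[OF Nor_subgroup[OF Qsub]] gN tN by blast
      have uc: "u \<in> carrier G" using uN by (rule Nor_carrier)
      have R2: "subgroup R2 G" "R2 \<subseteq> Q"
        unfolding R2_def using subgroup_cj_image[OF gc R1(1)] R1(2) Nor_mem[OF gN] by auto
      have R1c: "R1 \<subseteq> carrier G" using R1 Qsub by blast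
      have mem: "cj (inv g) a \<in> Q" if "a \<in> Q" for a using Nor_mem[OF igN that] .
      have conj_u: "cj u a = cj g (cj t (cj (inv g) a))" if "a \<in> carrier G" for a
        unfolding u_def using that gc tc by (simp add: cj_def m_assoc inv_mult_group)
      have gen2: "\<exists>r\<in>R2. \<exists>i::nat. a = r \<otimes> z [^] i" if z: "z \<in> Q - R2" and a: "a \<in> Q" for z a
      proof -
        have zc: "z \<in> carrier G" "a \<in> carrier G" using z a Qc by auto
        have "cj (inv g) z \<notin> R1"
        proof
          assume "cj (inv g) z \<in> R1"
          then have "cj g (cj (inv g) z) \<in> R2" unfolding R2_def by blast
          then show False using z zc gc by simp
        qed
        then obtain r and i :: nat where r: "r \<in> R1" "cj (inv g) a = r \<otimes> cj (inv g) z [^] i"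
          using gen1[of "cj (inv g) z" "cj (inv g) a"] mem z a by blast
        have "a = cj g (cj (inv g) a)" using zc gc by simp
        also have "\<dots> = cj g r \<otimes> z [^] i" unfolding r(2) using r(1) R1c zc gc by (simp add: cj_mult cj_pow subsetD)
        finally show ?thesis using r(1) by (auto simp: R2_def)
      qed
      have uR2: "u \<in> Cen R2"
      proof -
        have "cj u a = a" if "a \<in> R2" for a
        proof -
          from that obtain b where b: "b \<in> R1" "a = cj g b" by (auto simp: R2_def)
          then show ?thesis using conj_u R1c gc Cen_fixed[OF tR1 b(1)] by (simp add: subsetD)
        qed
        then show ?thesis using uc by (simp add: Cen_def)
      qed
      have u2: "inv a \<otimes> cj u a \<in> R2" if a: "a \<in> Q" for a
      proof -
        have ac: "a \<in> carrier G" using a Qc by blast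
        let ?b = "cj (inv g) a"
        have "cj g (inv ?b \<otimes> cj t ?b) = inv a \<otimes> cj u a"
          using conj_u[OF ac] ac gc tc by (simp add: cj_mult cj_inv)
        then show ?thesis using t2[OF mem[OF a]] unfolding R2_def by (metis imageI)
      qed
      have alt: "(\<forall>a\<in>Q. inv a \<otimes> cj t a \<in> R2) \<or> (\<forall>a\<in>Q. inv a \<otimes> cj u a \<in> R1)"
        by (rule transvections_odd_order[OF odd_order Q(1) commQ tN uN R1 R2 gen1 gen2 tR1 t2 uR2 u2])
      let ?B = "R1 \<inter> R2"
      have sB: "subgroup ?B G" using subgroups_Inter_pair[OF R1(1) R2(1)] .
      have Bc: "a \<in> R1 \<Longrightarrow> a \<in> carrier G" "a \<in> R2 \<Longrightarrow> a \<in> carrier G" for a using R1 R2 Qc by auto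
      have one: "inv a \<otimes> cj t a = \<one>" if "a \<in> R1" for a using Cen_fixed[OF tR1 that] Bc that by simp
      have one': "inv a \<otimes> cj u a = \<one>" if "a \<in> R2" for a using Cen_fixed[OF uR2 that] Bc that by simp
      have oB: "\<one> \<in> ?B" using subgroup.one_closed[OF sB] .
      \<comment> \<open>The middle term \<open>R\<close> is the axis that contains the commutators
        of both transvections. The one with axis \<open>R\<close> acts trivially on
        \<open>R\<close>; the other has its commutators in both axes.\<close>
      have "\<exists>R. subgroup R G \<and> ?B \<subseteq> R \<and> R \<subseteq> Q \<and> t \<in> chain_stabilizer Q R ?B \<and> u \<in> chain_stabilizer Q R ?B"
      proof (cases "\<forall>a\<in>Q. inv a \<otimes> cj t a \<in> R2")
        case True
        then have "t \<in> chain_stabilizer Q R2 ?B"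
          using tN t2 R2 Cen_fixed[OF tR1] by (auto simp: chain_stabilizer_def)
        moreover have "u \<in> chain_stabilizer Q R2 ?B"
          using uN u2 one' oB Cen_fixed[OF uR2] by (auto simp: chain_stabilizer_def)
        ultimately show ?thesis using R2 by blast
      next
        case False
        then have "u \<in> chain_stabilizer Q R1 ?B"
          using alt uN u2 R1 Cen_fixed[OF uR2] by (auto simp: chain_stabilizer_def)
        moreover have "t \<in> chain_stabilizer Q R1 ?B"
          using tN t2 one oB Cen_fixed[OF tR1] by (auto simp: chain_stabilizer_def)
        ultimately show ?thesis using R1 by blast
      qed
      then obtain R where R: "subgroup R G" "?B \<subseteq> R" "R \<subseteq> Q"
        and tE: "t \<in> chain_stabilizer Q R ?B" and uE: "u \<in> chain_stabilizer Q R ?B" by blast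
      let ?E = "chain_stabilizer Q R ?B"
      have sE: "subgroup ?E G" by (rule chain_stabilizer[OF Q(1) R(1) sB R(2,3)])
      have CE: "Cen Q \<subseteq> ?E" by (rule Cen_subset_chain_stabilizer[OF Q(1) R(1) sB R(2,3)])
      have QC: "Q \<subseteq> Cen Q" using commQ Qc by (auto simp: Cen_def cj_fixed_iff)
      have Lel: "\<exists>r\<in>Q. \<exists>i::nat. a = r \<otimes> t [^] i" if "a \<in> L" for a
        using index_p_generate[OF prime pL L(1) _ that, of t] t tL by blast
      have LE: "L \<subseteq> ?E"
      proof
        fix a assume "a \<in> L"
        then obtain r and i :: nat where "r \<in> Q" "a = r \<otimes> t [^] i" using Lel by blast
        then show "a \<in> ?E" using QC CE subgroup.m_closed[OF sE] subgroup_pow[OF sE tE] by blast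
      qed
      have gLE: "cj g ` L \<subseteq> ?E"
      proof
        fix b assume "b \<in> cj g ` L"
        then obtain a where a: "a \<in> L" "b = cj g a" by blast
        then obtain r and i :: nat where r: "r \<in> Q" "a = r \<otimes> t [^] i" using Lel by blast
        then have "b = cj g r \<otimes> u [^] i" using a gc tc Qc by (simp add: cj_mult cj_pow u_def)
        moreover have "cj g r \<in> ?E" using Nor_mem[OF gN r(1)] QC CE by blast
        ultimately show "b \<in> ?E" using subgroup.m_closed[OF sE] subgroup_pow[OF sE uE] by blast
      qed
      have EN: "?E \<subseteq> Nor (Cen Q)"
      proof
        fix e assume "e \<in> ?E"
        then have "e \<in> Nor Q" by (simp add: chain_stabilizer_def)
        then show "e \<in> Nor (Cen Q)" using Cen_normal_in_Nor[OF _ _ Qsub] Nor_carrier by (auto simp: Nor_def[of "Cen Q"])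
      qed
      \<comment> \<open>The chain stabiliser contains \<open>L\<close> and its conjugate, and its
        elements of prime power order prime to \<open>p\<close> centralise \<open>Q\<close> by
        coprime action.\<close>
      obtain c where "c \<in> Cen Q" "cj (c \<otimes> g) ` L = L"
      proof (rule weakly_closed_conj[OF wL gc sE LE gLE Cen_subgroup[OF Qsub] CE EN])
        fix q x assume "Factorial_Ring.prime q" "q \<noteq> p" "p_element q x" "x \<in> ?E"
        then show "x \<in> Cen Q" using chain_stabilizer_central[OF prime _ _ pQ R(1) sB R(2,3)] by blast
      qed
      then show "\<exists>c\<in>Cen Q. cj (c \<otimes> g) ` L = L" by blast
    qed
  qed
qed

text \<open>An abelian \<open>H\<close> of order \<open>p ^ m\<close> above \<open>Q\<close> and its
  conjugates under the normaliser of \<open>Q\<close> all lie in \<open>Cen Q\<close>. Weak closure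
  inside \<open>Cen Q\<close> corrects each \<open>g\<close>, so the property passes from
  \<open>H\<close> to \<open>Q\<close>.\<close>

lemma p'_central_small:
  assumes Q: "subgroup Q G" "Q \<subseteq> S" "card Q \<le> p ^ m"
  shows "p'_central p Q"
proof -
  have Qsub: "Q \<subseteq> carrier G" using Q S_carrier by blast
  obtain H where H: "subgroup H G" "Q \<subseteq> H" "H \<subseteq> S" "card H = p ^ m"
    by (rule p_group_intermediate[OF prime p_subgroup_S Q less_imp_le[OF m(2)]])
  have Hc: "H \<subseteq> carrier G" using H S_carrier by blast
  have HC: "H \<subseteq> Cen Q" using abelian[OF H(1,3,4)] H(2) Hc by (auto simp: Cen_def cj_fixed_iff subset_iff)
  show ?thesis
  proof (rule p'_central_transfer[OF H(2) Hc p'_central_order_d[OF H(1,3,4)]])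
    fix g assume gN: "g \<in> Nor Q"
    have gc: "g \<in> carrier G" using gN by (rule Nor_carrier)
    have "cj g ` H \<subseteq> Cen Q" using HC Cen_normal_in_Nor[OF gN _ Qsub] by blast
    then obtain c where "c \<in> Cen Q" "cj (c \<otimes> g) ` H = H"
      using weakly_closed_conj[OF closed[OF H(1,3,4)] gc Cen_subgroup[OF Qsub] HC _ Cen_subgroup[OF Qsub]
          subset_refl subgroup_subset_Nor[OF Cen_subgroup[OF Qsub]]] by blast
    then show "\<exists>c\<in>Cen Q. cj (c \<otimes> g) ` H = H" by blast
  qed
qed

lemma p'_central_p_subgroup:
  assumes Q: "p_subgroup p Q" shows "p'_central p Q"
proof -
  have Qc: "Q \<subseteq> carrier G" using Q by (rule p_subgroup_subset)
  obtain g where g: "g \<in> carrier G" "Q \<subseteq> cj g ` S"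
    by (rule sylow_contains[OF prime subgroup_self S Q Qc])
  let ?P = "cj (inv g) ` Q"
  have "?P \<subseteq> cj (inv g) ` cj g ` S" using g by blast
  then have PS: "?P \<subseteq> S" using g S_carrier by (simp add: cj_image_image)
  have sP: "subgroup ?P G" using subgroup_cj_image[of "inv g" Q] g Q p_subgroup_subgroup by blast
  have "p'_central p ?P"
    using p'_central_large[OF sP PS] p'_central_small[OF sP PS] by linarith
  then have "p'_central p (cj g ` ?P)" by (rule p'_central_cj) (use g S_carrier PS in auto)
  then show ?thesis using g Qc by (simp add: cj_image_image)
qed

end

context finite_group
begin

section \<open>Fusion, transfer and normal complements\<close>

text \<open>Induction on the distance of the intersection \<open>D\<close> from a full Sylow
  subgroup. Sylow's theorem in \<open>Nor D\<close> links overgroups of \<open>D\<close> in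
  \<open>P\<close> and \<open>P'\<close>; as \<open>Nor D\<close> is \<open>Cen D\<close> times any
  of its Sylow p-subgroups, the linking element can be taken in \<open>Cen D\<close>.\<close>

lemma sylow_conj_in_centralizer:
  assumes p: "Factorial_Ring.prime p" and fr: "\<And>Q. p_subgroup p Q \<Longrightarrow> p'_central p Q"
    and P: "sylow_in p (carrier G) P" and P': "sylow_in p (carrier G) P'"
  shows "\<exists>c\<in>Cen (P \<inter> P'). P' = cj c ` P"
  using P P'
proof (induction "card P - card (P \<inter> P')" arbitrary: P P' rule: less_induct)
  case less
  note P = less.prems(1) and P' = less.prems(2)
  have card_eq: "card R = p ^ multiplicity p (order G)" if "sylow_in p (carrier G) R" for R
    using sylow_in_card[OF p subgroup_self that] by (simp add: order_def)
  have pP: "p_subgroup p P" "p_subgroup p P'" using P P' by (auto simp: sylow_in_def)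
  then have sP: "subgroup P G" "subgroup P' G" and Pc: "P \<subseteq> carrier G" "P' \<subseteq> carrier G"
    using p_subgroup_subgroup p_subgroup_subset by auto
  let ?D = "P \<inter> P'"
  have sD: "subgroup ?D G" using subgroups_Inter_pair[OF sP] .
  have Dc: "?D \<subseteq> carrier G" using Pc by blast
  \<comment> \<open>The intersection of \<open>R\<close> and \<open>R'\<close> is strictly larger
    than \<open>D\<close>, and all Sylow subgroups have the same order, so the measure drops;
    centralising the larger intersection implies centralising \<open>D\<close>.\<close>
  have IH: "\<exists>c\<in>Cen ?D. R' = cj c ` R"
    if R: "sylow_in p (carrier G) R" "sylow_in p (carrier G) R'"
      and V: "index_p p V ?D" "V \<subseteq> R \<inter> R'" for R R' V
  proof -
    have sV: "subgroup V G" "?D \<subseteq> V" using V by (auto simp: index_p_def)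
    have Rc: "R \<subseteq> carrier G" using R p_subgroup_subset by (auto simp: sylow_in_def)
    have "card ?D < card V" using psubset_card_mono[OF subgroup_finite[OF sV(1)] index_p_psubset[OF p V(1)]] .
    also have "card V \<le> card (R \<inter> R')" using V(2) Rc by (intro card_mono) auto
    finally have "card ?D < card (R \<inter> R')" .
    moreover have "card (R \<inter> R') \<le> card R" using Rc by (intro card_mono) auto
    ultimately have "card R - card (R \<inter> R') < card P - card ?D" using card_eq[OF R(1)] card_eq[OF P] by simp
    then obtain c where "c \<in> Cen (R \<inter> R')" "R' = cj c ` R" using less.hyps R by blast
    moreover have "Cen (R \<inter> R') \<subseteq> Cen ?D" using V sV by (intro Cen_antimono) blast
    ultimately show ?thesis by blast
  qed
  show ?case
  proof (cases "?D = P \<or> ?D = P'")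
    case True
    then have "P \<subseteq> P' \<or> P' \<subseteq> P" by blast
    moreover have "card P = card P'" using card_eq P P' by simp
    ultimately have "P = P'" using Pc finite_sub card_subset_eq by metis
    moreover have "\<one> \<in> Cen ?D" using subgroup.one_closed[OF Cen_subgroup[OF Dc]] .
    ultimately show ?thesis using Pc by (intro bexI[of _ \<one>]) auto
  next
    case False
    then have D: "?D \<subset> P" "?D \<subset> P'" by auto
    obtain V where V: "index_p p V ?D" "V \<subseteq> P" "V \<subseteq> Nor ?D" by (rule p_group_extend[OF p pP(1) sD D(1)])
    obtain V' where V': "index_p p V' ?D" "V' \<subseteq> P'" "V' \<subseteq> Nor ?D" by (rule p_group_extend[OF p pP(2) sD D(2)])
    have sV: "subgroup V G" "subgroup V' G" using V V' by (auto simp: index_p_def)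
    have pV: "p_subgroup p V" "p_subgroup p V'"
      using p_subgroup_mono[OF pP(1) sV(1) V(2) p] p_subgroup_mono[OF pP(2) sV(2) V'(2) p] by auto
    have N: "subgroup (Nor ?D) G" and C: "subgroup (Cen ?D) G" using Nor_subgroup[OF Dc] Cen_subgroup[OF Dc] .
    obtain R where R: "sylow_in p (Nor ?D) R" "V \<subseteq> R" by (rule sylow_above[OF p N pV(1) V(3)])
    have pR: "p_subgroup p R" and Rc: "R \<subseteq> carrier G" using R p_subgroup_subset by (auto simp: sylow_in_def)
    have sR: "subgroup R G" using pR p_subgroup_subgroup by blast
    obtain n where n: "n \<in> Nor ?D" "V' \<subseteq> cj n ` R" by (rule sylow_contains[OF p N R(1) pV(2) V'(3)])
    have NC: "Nor ?D \<subseteq> Nor (Cen ?D)"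
      using Cen_normal_in_Nor[OF _ _ Dc] Nor_carrier by (auto simp: Nor_def[of "Cen ?D"])
    have pD: "p_subgroup p ?D" using p_subgroup_mono[OF pP(1) sD _ p] by blast
    obtain c t where ct: "c \<in> Cen ?D" "t \<in> R" "n = c \<otimes> t"
      by (rule p'_elements_cover[OF p N C Cen_subset_Nor NC _ R(1) n(1)]) (use p'_centralD[OF fr[OF pD]] in blast)
    have cc: "c \<in> carrier G" and tc: "t \<in> carrier G" using ct Cen_carrier Rc by auto
    have "cj t ` R = R" using Nor_image[OF _ Rc] subgroup_subset_Nor[OF sR] ct by blast
    then have V'R: "V' \<subseteq> cj c ` R" using n(2) cj_image_image[OF cc tc Rc] ct by simp
    \<comment> \<open>The passage goes from \<open>P\<close> to \<open>P1\<close>, to its conjugate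
      by \<open>c\<close>, to \<open>P'\<close>. The first and last steps are inductive, since the
      pairs meet in overgroups of \<open>V\<close> and of \<open>V'\<close>; the middle one is
      conjugation by \<open>c\<close>.\<close>
    obtain P1 where P1: "sylow_in p (carrier G) P1" "R \<subseteq> P1" by (rule sylow_above[OF p subgroup_self pR Rc])
    have P1c: "P1 \<subseteq> carrier G" using P1 by (simp add: sylow_in_def)
    obtain a where a: "a \<in> Cen ?D" "P1 = cj a ` P" using IH[OF P P1(1) V(1)] V R P1 by blast
    have P2: "sylow_in p (carrier G) (cj c ` P1)" by (rule sylow_in_cj[OF subgroup_self P1(1) cc])
    obtain b where b: "b \<in> Cen ?D" "P' = cj b ` cj c ` P1" using IH[OF P2 P' V'(1)] V' V'R P1 by blast
    have abc: "a \<in> carrier G" "b \<in> carrier G" using a b Cen_carrier by auto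
    have "P' = cj (b \<otimes> (c \<otimes> a)) ` P"
      unfolding b(2) a(2) using abc cc Pc by (simp add: cj_image_image)
    moreover have "b \<otimes> (c \<otimes> a) \<in> Cen ?D" using a b ct subgroup.m_closed[OF C] by simp
    ultimately show ?thesis by blast
  qed
qed

text \<open>An element \<open>c\<close> centralising the intersection of \<open>P\<close> with its
  conjugate by \<open>g\<close> carries that conjugate back to \<open>P\<close>. It fixes
  \<open>cj g x\<close>, and \<open>c \<otimes> g\<close> normalises \<open>P\<close>, so on
  \<open>P\<close> it acts as an element of \<open>P\<close>.\<close>

lemma sylow_controls_fusion:
  assumes p: "Factorial_Ring.prime p" and fr: "\<And>Q. p_subgroup p Q \<Longrightarrow> p'_central p Q"
    and P: "sylow_in p (carrier G) P" and x: "x \<in> P" and g: "g \<in> carrier G" "cj g x \<in> P"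
  obtains u where "u \<in> P" "cj g x = cj u x"
proof -
  have pP: "p_subgroup p P" and sP: "subgroup P G" and Pc: "P \<subseteq> carrier G"
    using P p_subgroup_subgroup p_subgroup_subset by (auto simp: sylow_in_def)
  have xc: "x \<in> carrier G" using x Pc by blast
  have P': "sylow_in p (carrier G) (cj g ` P)" by (rule sylow_in_cj[OF subgroup_self P g(1)])
  obtain c where c: "c \<in> Cen (cj g ` P \<inter> P)" "P = cj c ` cj g ` P"
    using sylow_conj_in_centralizer[OF p fr P' P] by blast
  have cc: "c \<in> carrier G" using c Cen_carrier by blast
  have cg: "c \<otimes> g \<in> Nor P" using c(2) cc g Pc by (intro NorI_image) (auto simp: cj_image_image)
  have PN: "subgroup (Nor P) G" "subgroup (Cen P) G" using Nor_subgroup[OF Pc] Cen_subgroup[OF Pc] .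
  have NC: "Nor P \<subseteq> Nor (Cen P)"
    using Cen_normal_in_Nor[OF _ _ Pc] Nor_carrier by (auto simp: Nor_def[of "Cen P"])
  have PP: "sylow_in p (Nor P) P"
    by (rule sylow_in_mono[OF P subgroup_self PN(1) subgroup_subset_Nor[OF sP]]) (auto simp: Nor_def)
  obtain d t where dt: "d \<in> Cen P" "t \<in> P" "c \<otimes> g = d \<otimes> t"
    by (rule p'_elements_cover[OF p PN Cen_subset_Nor NC _ PP cg]) (use p'_centralD[OF fr[OF pP]] in blast)
  have dtc: "d \<in> carrier G" "t \<in> carrier G" using dt Cen_carrier Pc by auto
  have "cj g x = cj c (cj g x)" using Cen_fixed[OF c(1), of "cj g x"] x g by simp
  also have "\<dots> = cj d (cj t x)" using cj_cj[OF cc g(1) xc] cj_cj[OF dtc xc] dt(3) by simp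
  also have "\<dots> = cj t x" using Cen_fixed[OF dt(1)] Nor_mem subgroup_subset_Nor[OF sP] dt x by blast
  finally show ?thesis using that dt by blast
qed

text \<open>\<open>f\<close> is the projection of \<open>T\<close> onto the quotient of order
  \<open>p\<close>, recorded as the exponent of a generator \<open>z\<close>: a natural number
  determined only modulo \<open>p\<close>.\<close>

lemma index_p_hom:
  assumes p: "Factorial_Ring.prime p" and T: "p_subgroup p T" and U: "index_p p T U"
  obtains f :: "'a \<Rightarrow> nat" and z where "z \<in> T" "[f z = 1] (mod p)" "\<And>u. u \<in> U \<Longrightarrow> [f u = 0] (mod p)"
    "\<And>a b. a \<in> T \<Longrightarrow> b \<in> T \<Longrightarrow> [f (a \<otimes> b) = f a + f b] (mod p)"
proof -
  have sT: "subgroup T G" and sU: "subgroup U G" "U \<subseteq> T" using U by (auto simp: index_p_def)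
  have Tc: "T \<subseteq> carrier G" using T p_subgroup_subset by blast
  obtain z where z: "z \<in> T" "z \<notin> U" using index_p_psubset[OF p U] by blast
  have zc: "z \<in> carrier G" using z Tc by blast
  have TU: "T \<subseteq> Nor U" using index_p_normal[OF p T U] .
  define f where "f a = (SOME i::nat. \<exists>u\<in>U. a = u \<otimes> z [^] i)" for a
  have f: "\<exists>u\<in>U. a = u \<otimes> z [^] f a" if a: "a \<in> T" for a
  proof -
    obtain u and i :: nat where "u \<in> U" "a = u \<otimes> z [^] i" by (rule index_p_generate[OF p T U _ a]) (use z in auto)
    then have "\<exists>i::nat. \<exists>u\<in>U. a = u \<otimes> z [^] i" by blast
    then show ?thesis unfolding f_def by (rule someI_ex)
  qed
  have dvd: "p dvd j" if "z [^] (j::nat) \<in> U" for j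
  proof (rule ccontr)
    assume "\<not> p dvd j"
    then have "coprime j p" using p prime_imp_coprime coprime_commute by metis
    then show False using pow_mem_coprime[OF sU(1) zc that] index_p_pow_mem[OF p T U z(1)] z by blast
  qed
  have le: "[i = j] (mod p)" if uv: "u \<in> U" "v \<in> U" "u \<otimes> z [^] i = v \<otimes> z [^] j" "j \<le> i" for u v and i j :: nat
  proof -
    have c: "u \<in> carrier G" "v \<in> carrier G" using uv sU Tc by auto
    have "z [^] i = z [^] (i - j) \<otimes> z [^] j" using uv zc by (simp add: nat_pow_mult)
    then have "(u \<otimes> z [^] (i - j)) \<otimes> z [^] j = v \<otimes> z [^] j" using uv c zc by (simp add: m_assoc)
    then have "u \<otimes> z [^] (i - j) = v" using c zc by simp
    then have "z [^] (i - j) = inv u \<otimes> v" using c zc by (metis inv_mult_cancel_left nat_pow_closed)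
    then have "z [^] (i - j) \<in> U" using uv subgroup.m_closed[OF sU(1)] subgroup.m_inv_closed[OF sU(1)] by simp
    then show ?thesis using dvd uv cong_altdef_nat by blast
  qed
  have uniq: "[i = j] (mod p)" if "u \<in> U" "v \<in> U" "u \<otimes> z [^] i = v \<otimes> z [^] j" for u v and i j :: nat
    using le[OF that] le[OF that(2,1) that(3)[symmetric]] cong_sym by (cases "j \<le> i") auto
  have one: "\<one> \<in> U" using subgroup.one_closed[OF sU(1)] .
  show ?thesis
  proof (rule that[of z f])
    show "z \<in> T" by fact
    obtain u where u: "u \<in> U" "z = u \<otimes> z [^] f z" using f z by blast
    have "u \<otimes> z [^] f z = \<one> \<otimes> z [^] (1::nat)" using u(2) zc by simp
    then show "[f z = 1] (mod p)" by (rule uniq[OF u(1) one])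
    show "[f v = 0] (mod p)" if v: "v \<in> U" for v
    proof -
      obtain u where u: "u \<in> U" "v = u \<otimes> z [^] f v" using f v sU by blast
      have "u \<otimes> z [^] f v = v \<otimes> z [^] (0::nat)" using u(2) v sU Tc by (auto simp: subset_iff)
      then show ?thesis by (rule uniq[OF u(1) v])
    qed
    show "[f (a \<otimes> b) = f a + f b] (mod p)" if ab: "a \<in> T" "b \<in> T" for a b
    proof -
      obtain u where u: "u \<in> U" "a = u \<otimes> z [^] f a" using f ab by blast
      obtain v where v: "v \<in> U" "b = v \<otimes> z [^] f b" using f ab by blast
      obtain w where w: "w \<in> U" "a \<otimes> b = w \<otimes> z [^] f (a \<otimes> b)" using f ab subgroup.m_closed[OF sT] by blast
      have c: "u \<in> carrier G" "v \<in> carrier G" using u v sU Tc by auto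
      have "w \<otimes> z [^] f (a \<otimes> b) = (u \<otimes> z [^] f a) \<otimes> (v \<otimes> z [^] f b)" using w(2) u(2) v(2) by metis
      also have "\<dots> = (u \<otimes> cj (z [^] f a) v) \<otimes> (z [^] f a \<otimes> z [^] f b)" using c zc by (simp add: cj_def m_assoc)
      also have "\<dots> = (u \<otimes> cj (z [^] f a) v) \<otimes> z [^] (f a + f b)" using zc by (simp add: nat_pow_mult)
      finally have "w \<otimes> z [^] f (a \<otimes> b) = (u \<otimes> cj (z [^] f a) v) \<otimes> z [^] (f a + f b)" .
      moreover have "u \<otimes> cj (z [^] f a) v \<in> U"
        using u v TU subgroup_pow[OF sT z(1)] Nor_mem subgroup.m_closed[OF sU(1)] by blast
      ultimately show ?thesis using uniq w(1) by blast
    qed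
  qed
qed

end

section \<open>Sums over cycles and the transfer\<close>

text \<open>\<open>s\<close> permutes \<open>A\<close>, so the sum splits over cycles; one cycle at
  a time is removed, and the last hypothesis is used with \<open>k\<close> the cycle length.\<close>

lemma sum_over_orbits_cong:
  fixes F :: "'b \<Rightarrow> nat"
  assumes "finite A" "\<And>c. c \<in> A \<Longrightarrow> s c \<in> A" "0 < n" "\<And>c. c \<in> A \<Longrightarrow> (s ^^ n) c = c"
    and "\<And>c k. c \<in> A \<Longrightarrow> (s ^^ k) c = c \<Longrightarrow> [(\<Sum>i<k. F ((s ^^ i) c)) = k * b] (mod p)"
  shows "[sum F A = card A * b] (mod p)"
  using assms
proof (induction "card A" arbitrary: A rule: less_induct)
  case less
  note fin = less.prems(1) and closed = less.prems(2) and n = less.prems(3,4) and cyc = less.prems(5)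
  show ?case
  proof (cases "A = {}")
    case False
    then obtain c where c: "c \<in> A" by blast
    have it: "(s ^^ i) x \<in> A" if "x \<in> A" for x i using that closed by (induction i) auto
    have mult: "(s ^^ (n * i)) x = x" if "x \<in> A" for x i
      using n(2)[OF that] by (induction i) (auto simp: funpow_add)
    define k where "k = (LEAST k. 0 < k \<and> (s ^^ k) c = c)"
    have k: "0 < k \<and> (s ^^ k) c = c" unfolding k_def by (rule LeastI[of _ n]) (use n(1) n(2)[OF c] in blast)
    have least: "\<not> (0 < j \<and> (s ^^ j) c = c)" if "j < k" for j
      using not_less_Least[of j "\<lambda>k. 0 < k \<and> (s ^^ k) c = c"] that unfolding k_def by simp
    define Orb where "Orb = (\<lambda>i. (s ^^ i) c) ` {..<k}"
    have Orb: "(s ^^ i) c \<in> Orb" for i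
    proof -
      have "(s ^^ i) c = (s ^^ (i mod k)) c" using k by (simp add: funpow_mod_eq)
      then show ?thesis using k by (auto simp: Orb_def)
    qed
    have inj: "inj_on (\<lambda>i. (s ^^ i) c) {..<k}"
    proof (rule linorder_inj_onI)
      fix i j assume ij: "i < j" "i \<in> {..<k}" "j \<in> {..<k}"
      show "(s ^^ i) c \<noteq> (s ^^ j) c"
      proof
        assume eq: "(s ^^ i) c = (s ^^ j) c"
        \<comment> \<open>\<open>n * i - i\<close> stands for the exponent \<open>- i\<close>: as
          \<open>n * i\<close> steps return every point of \<open>A\<close>, so many steps undo
          \<open>i\<close> steps.\<close>
        have ni: "i \<le> n * i" using n by simp
        have "(s ^^ (n * i - i)) ((s ^^ i) c) = c"
          using mult[OF c, of i] ni by (simp flip: funpow_add[THEN fun_cong, unfolded comp_apply])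
        moreover have "(s ^^ (n * i - i)) ((s ^^ j) c) = (s ^^ (j - i)) ((s ^^ (n * i)) c)"
          using ij ni by (simp add: add.commute flip: funpow_add[THEN fun_cong, unfolded comp_apply])
        ultimately have "(s ^^ (j - i)) c = c" using eq mult[OF c] by simp
        then show False using least[of "j - i"] ij by (simp add: less_imp_diff_less)
      qed
    qed auto
    have OA: "Orb \<subseteq> A" using it c by (auto simp: Orb_def)
    have "c \<in> Orb" using Orb[of 0] by simp
    then have "card (A - Orb) < card A" using c fin by (intro psubset_card_mono) auto
    moreover have "s x \<in> A - Orb" if x: "x \<in> A - Orb" for x
    proof -
      have "s x \<notin> Orb"
      proof
        assume "s x \<in> Orb"
        then obtain i where i: "s x = (s ^^ i) c" by (auto simp: Orb_def)
        have "x = (s ^^ (n - 1)) (s x)" using n x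
          by (metis DiffD1 Suc_pred' funpow_Suc_right comp_apply)
        also have "\<dots> = (s ^^ (n - 1 + i)) c" using i by (simp add: funpow_add)
        finally show False using Orb[of "n - 1 + i"] x by simp
      qed
      then show ?thesis using x closed by blast
    qed
    ultimately have IH: "[sum F (A - Orb) = card (A - Orb) * b] (mod p)"
      using less.hyps[of "A - Orb"] fin n cyc by simp
    have cO: "card Orb = k" using inj by (simp add: Orb_def card_image)
    have "sum F Orb = (\<Sum>i<k. F ((s ^^ i) c))" unfolding Orb_def using inj by (simp add: sum.reindex)
    then have "[sum F Orb = card Orb * b] (mod p)" using cyc[OF c] k cO by simp
    then have "[sum F (A - Orb) + sum F Orb = card (A - Orb) * b + card Orb * b] (mod p)" using IH by (intro cong_add)
    moreover have "sum F A = sum F (A - Orb) + sum F Orb" using fin OA by (simp add: sum.subset_diff)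
    moreover have "card A = card (A - Orb) + card Orb" using fin OA
      by (simp add: card_Diff_subset finite_subset card_mono)
    ultimately show ?thesis by (simp add: algebra_simps)
  qed simp
qed

context finite_group
begin

text \<open>\<open>V\<close> is the transfer. Stability of \<open>f\<close> collapses the contribution of each orbit of \<open>a\<close> on the
  cosets of \<open>T\<close>, so that no double coset decomposition is needed to evaluate \<open>V a\<close>.\<close>

lemma transfer_exists:
  fixes f :: "'a \<Rightarrow> nat"
  assumes N: "subgroup N G" and T: "subgroup T G" "T \<subseteq> N"
    and hom: "\<And>a b. a \<in> T \<Longrightarrow> b \<in> T \<Longrightarrow> [f (a \<otimes> b) = f a + f b] (mod p)"
    and stable: "\<And>a g. a \<in> T \<Longrightarrow> g \<in> N \<Longrightarrow> cj g a \<in> T \<Longrightarrow> [f (cj g a) = f a] (mod p)"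
  obtains V :: "'a \<Rightarrow> nat" where "\<And>a b. a \<in> N \<Longrightarrow> b \<in> N \<Longrightarrow> [V (a \<otimes> b) = V a + V b] (mod p)"
    "\<And>a. a \<in> T \<Longrightarrow> [V a = (card N div card T) * f a] (mod p)"
proof -
  have Nc: "a \<in> N \<Longrightarrow> a \<in> carrier G" for a using N subgroup_memD by blast
  have Tc: "T \<subseteq> carrier G" using T by (simp add: subgroup.subset)
  note nm = subgroup.m_closed[OF N] and ni = subgroup.m_inv_closed[OF N]
  let ?A = "(\<lambda>g. T #> g) ` N"
  have finA: "finite ?A" using subgroup_finite[OF N] by simp
  have cardA: "card ?A = card N div card T"
    using card_rcosets_in[OF T(1) N T(2)] subgroup_card_pos[OF T(1)] by (metis nonzero_mult_div_cancel_right not_gr_zero)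
  define r where "r c = (SOME g. g \<in> N \<and> c = T #> g)" for c
  have r: "r c \<in> N" "T #> r c = c" if "c \<in> ?A" for c
  proof -
    have "\<exists>g. g \<in> N \<and> c = T #> g" using that by blast
    then have "r c \<in> N \<and> c = T #> r c" unfolding r_def by (rule someI_ex)
    then show "r c \<in> N" "T #> r c = c" by auto
  qed
  have act: "c #> g \<in> ?A" "c #> g = T #> (r c \<otimes> g)" if c: "c \<in> ?A" and g: "g \<in> N" for c g
  proof -
    have "T #> r c #> g = T #> (r c \<otimes> g)" by (rule coset_mult_assoc[OF Tc Nc[OF r(1)[OF c]] Nc[OF g]])
    then show 1: "c #> g = T #> (r c \<otimes> g)" using r[OF c] by simp
    show "c #> g \<in> ?A" unfolding 1 using nm[OF r(1)[OF c] g] by blast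
  qed
  have act2: "c #> g #> h = c #> (g \<otimes> h)" if c: "c \<in> ?A" and g: "g \<in> N" "h \<in> N" for c g h
  proof -
    have "c \<subseteq> carrier G" using r_coset_subset_G[OF Tc Nc[OF r(1)[OF c]]] r(2)[OF c] by simp
    then show ?thesis using coset_mult_assoc g Nc by simp
  qed
  have act1: "c #> \<one> = c" if c: "c \<in> ?A" for c
    using r_coset_subset_G[OF Tc Nc[OF r(1)[OF c]]] r(2)[OF c] by simp
  \<comment> \<open>The T-part of \<open>r c \<otimes> g\<close> relative to the chosen transversal;
    \<open>\<tau>_mult\<close> is its cocycle identity.\<close>
  define \<tau> where "\<tau> c g = r c \<otimes> g \<otimes> inv (r (c #> g))" for c g
  have \<tau>T: "\<tau> c g \<in> T" if c: "c \<in> ?A" and g: "g \<in> N" for c g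
  proof -
    have "T #> (r c \<otimes> g) = T #> r (c #> g)" using act[OF c g] r(2) by simp
    then show ?thesis unfolding \<tau>_def
      using rcos_eq_iff[OF T(1), of "r c \<otimes> g" "r (c #> g)"] r(1) c act[OF c g] g Nc by simp
  qed
  have \<tau>_mult: "\<tau> c (g \<otimes> h) = \<tau> c g \<otimes> \<tau> (c #> g) h" if c: "c \<in> ?A" and g: "g \<in> N" "h \<in> N" for c g h
    unfolding \<tau>_def act2[OF c g]
    using Nc[OF r(1)[OF c]] Nc[OF r(1)[OF act(1)[OF c g(1)]]] Nc[OF r(1)[OF act(1)[OF c nm[OF g]]]] Nc[OF g(1)] Nc[OF g(2)]
    by (simp add: m_assoc)
  define V where "V g = (\<Sum>c\<in>?A. f (\<tau> c g))" for g
  have V: "[V (g \<otimes> h) = V g + V h] (mod p)" if g: "g \<in> N" "h \<in> N" for g h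
  proof -
    have bij: "bij_betw (\<lambda>c. c #> g) ?A ?A"
    proof (rule bij_betwI[where g = "\<lambda>c. c #> inv g"])
      show "(\<lambda>c. c #> g) \<in> ?A \<rightarrow> ?A" "(\<lambda>c. c #> inv g) \<in> ?A \<rightarrow> ?A" using act(1) g ni by auto
      show "c #> g #> inv g = c" if "c \<in> ?A" for c using act2[OF that g(1) ni[OF g(1)]] act1[OF that] Nc[OF g(1)] by simp
      show "c #> inv g #> g = c" if "c \<in> ?A" for c using act2[OF that ni[OF g(1)] g(1)] act1[OF that] Nc[OF g(1)] by simp
    qed
    have "[V (g \<otimes> h) = (\<Sum>c\<in>?A. f (\<tau> c g) + f (\<tau> (c #> g) h))] (mod p)"
      unfolding V_def
    proof (rule cong_sum)
      fix c assume c: "c \<in> ?A"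
      show "[f (\<tau> c (g \<otimes> h)) = f (\<tau> c g) + f (\<tau> (c #> g) h)] (mod p)"
        unfolding \<tau>_mult[OF c g] by (rule hom[OF \<tau>T[OF c g(1)] \<tau>T[OF act(1)[OF c g(1)] g(2)]])
    qed
    also have "(\<Sum>c\<in>?A. f (\<tau> c g) + f (\<tau> (c #> g) h)) = V g + (\<Sum>c\<in>?A. f (\<tau> (c #> g) h))"
      unfolding V_def by (rule sum.distrib)
    also have "(\<Sum>c\<in>?A. f (\<tau> (c #> g) h)) = V h" unfolding V_def by (rule sum.reindex_bij_betw[OF bij])
    finally show ?thesis .
  qed
  have f1: "[f \<one> = 0] (mod p)"
  proof -
    have "[f \<one> + 0 = f \<one> + f \<one>] (mod p)" using hom[OF subgroup.one_closed[OF T(1)] subgroup.one_closed[OF T(1)]] by simp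
    then show ?thesis by (metis cong_add_lcancel_nat cong_sym)
  qed
  have fpow: "[f (a [^] (k::nat)) = k * f a] (mod p)" if "a \<in> T" for a k
  proof (induction k)
    case 0 then show ?case using f1 by simp
  next
    case (Suc k)
    have "[f (a [^] Suc k) = f (a [^] k) + f a] (mod p)" using hom subgroup_pow[OF T(1)] that by simp
    also have "[f (a [^] k) + f a = k * f a + f a] (mod p)" using Suc by (intro cong_add) auto
    finally show ?case by (simp add: add.commute)
  qed
  have "[V a = (card N div card T) * f a] (mod p)" if a: "a \<in> T" for a
    unfolding V_def cardA[symmetric]
  proof (rule sum_over_orbits_cong[where s = "\<lambda>c. c #> a" and n = "order G"])
    have aN: "a \<in> N" using a T by blast
    have it: "((\<lambda>c. c #> a) ^^ i) c = c #> (a [^] i)" if c: "c \<in> ?A" for c i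
      using c
    proof (induction i)
      case (Suc i)
      then show ?case using act2[OF c subgroup_pow[OF N aN] aN] by simp
    qed (use act1[OF c] in simp)
    show "finite ?A" by (rule finA)
    show "c #> a \<in> ?A" if "c \<in> ?A" for c using act(1)[OF that aN] .
    show "0 < order G" by (simp add: order_gt_0_iff_finite)
    show "((\<lambda>c. c #> a) ^^ order G) c = c" if c: "c \<in> ?A" for c
      using it[OF c] act1[OF c] pow_order_eq_1[OF Nc[OF aN]] by simp
    fix c k assume c: "c \<in> ?A" and k: "((\<lambda>c. c #> a) ^^ k) c = c"
    \<comment> \<open>The cocycle identity makes the contributions along a cycle telescope.\<close>
    have part: "[(\<Sum>i<j. f (\<tau> (c #> (a [^] i)) a)) = f (\<tau> c (a [^] j))] (mod p)" for j :: nat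
    proof (induction j)
      case 0
      have "\<tau> c (a [^] (0::nat)) = \<one>" unfolding \<tau>_def using act1[OF c] Nc[OF r(1)[OF c]] by simp
      then show ?case using f1 cong_sym by simp
    next
      case (Suc j)
      have ajN: "a [^] j \<in> N" using subgroup_pow[OF N aN] .
      have "[(\<Sum>i<Suc j. f (\<tau> (c #> (a [^] i)) a)) = f (\<tau> c (a [^] j)) + f (\<tau> (c #> (a [^] j)) a)] (mod p)"
        using Suc by (auto intro: cong_add)
      also have "[f (\<tau> c (a [^] j)) + f (\<tau> (c #> (a [^] j)) a) = f (\<tau> c (a [^] Suc j))] (mod p)"
        using hom[OF \<tau>T[OF c ajN] \<tau>T[OF act(1)[OF c ajN] aN]] \<tau>_mult[OF c ajN aN] cong_sym by simp
      finally show ?case .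
    qed
    have ck: "c #> (a [^] k) = c" using k it[OF c] by simp
    have akT: "a [^] k \<in> T" using subgroup_pow[OF T(1) a] .
    \<comment> \<open>When the power of \<open>a\<close> fixes \<open>c\<close>, both
      representatives coincide and the T-part is a conjugate of that power, to which stability of
      \<open>f\<close> applies.\<close>
    have \<tau>k: "\<tau> c (a [^] k) = cj (r c) (a [^] k)" unfolding \<tau>_def ck cj_def ..
    have "cj (r c) (a [^] k) \<in> T" using \<tau>T[OF c, of "a [^] k"] akT T \<tau>k by auto
    then have "[f (\<tau> c (a [^] k)) = f (a [^] k)] (mod p)" unfolding \<tau>k by (rule stable[OF akT r(1)[OF c]])
    then have "[(\<Sum>i<k. f (\<tau> (c #> (a [^] i)) a)) = k * f a] (mod p)"
      using part[of k] fpow[OF a, of k] cong_trans by blast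
    then show "[(\<Sum>i<k. f (\<tau> (((\<lambda>c. c #> a) ^^ i) c) a)) = k * f a] (mod p)" using it[OF c] by simp
  qed
  then show ?thesis using that V by blast
qed

text \<open>A Sylow p-subgroup of \<open>N\<close> above \<open>S \<inter> N\<close> is conjugate
  into \<open>S\<close>, and by normality the conjugate stays in \<open>N\<close>; so it cannot be
  larger than \<open>S \<inter> N\<close>.\<close>

lemma sylow_in_normal_Int:
  assumes p: "Factorial_Ring.prime p" and S: "sylow_in p (carrier G) S"
    and N: "subgroup N G" "carrier G \<subseteq> Nor N"
  shows "sylow_in p N (S \<inter> N)"
proof -
  have pS: "p_subgroup p S" and sS: "subgroup S G" and Sc: "S \<subseteq> carrier G"
    using S p_subgroup_subgroup p_subgroup_subset by (auto simp: sylow_in_def)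
  have sT: "subgroup (S \<inter> N) G" using subgroups_Inter_pair[OF sS N(1)] .
  have pT: "p_subgroup p (S \<inter> N)" using p_subgroup_mono[OF pS sT _ p] by blast
  obtain T where T: "sylow_in p N T" "S \<inter> N \<subseteq> T" by (rule sylow_above[OF p N(1) pT]) auto
  have pT': "p_subgroup p T" and TN: "T \<subseteq> N" and Tc: "T \<subseteq> carrier G"
    using T p_subgroup_subset by (auto simp: sylow_in_def)
  obtain k where k: "k \<in> carrier G" "T \<subseteq> cj k ` S" by (rule sylow_contains[OF p subgroup_self S pT' Tc])
  have "cj (inv k) ` T \<subseteq> cj (inv k) ` cj k ` S" using k by blast
  then have "cj (inv k) ` T \<subseteq> S" using k Sc by (simp add: cj_image_image)
  moreover have "cj (inv k) ` T \<subseteq> N" using TN N(2) k Nor_mem[of "inv k" N] by blast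
  ultimately have "card (cj (inv k) ` T) \<le> card (S \<inter> N)" using Sc by (intro card_mono) auto
  then have "card T \<le> card (S \<inter> N)" using k Tc by (simp add: card_cj_image)
  then have "S \<inter> N = T" using card_seteq[OF finite_sub[OF Tc] T(2)] by blast
  then show ?thesis using T by simp
qed

section \<open>The normal p-complement\<close>

text \<open>The complement is the subgroup \<open>N\<close> generated by the elements of prime power
  order prime to \<open>p\<close>. If \<open>p\<close> divided its order, the transfer of
  \<open>N\<close> into a quotient of order \<open>p\<close> of its Sylow subgroup would be nonzero,
  yet it vanishes on the generators.\<close>

lemma p_nilpotent_if_p'_central:
  assumes p: "Factorial_Ring.prime p" and fr: "\<And>Q. p_subgroup p Q \<Longrightarrow> p'_central p Q"
  shows "p_nilpotent G p"
proof -
  define E where "E = {x. \<exists>q. Factorial_Ring.prime q \<and> q \<noteq> p \<and> p_element q x}"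
  define N where "N = generate G E"
  have Ec: "E \<subseteq> carrier G" by (auto simp: E_def p_element_def)
  have sN: "subgroup N G" unfolding N_def by (rule generate_is_subgroup[OF Ec])
  have EN: "x \<in> N" if "x \<in> E" for x unfolding N_def using that by (rule generate.incl)
  have Nc: "N \<subseteq> carrier G" using sN by (simp add: subgroup.subset)
  have conjN: "cj g x \<in> N" if g: "g \<in> carrier G" and x: "x \<in> N" for g x
    using x unfolding N_def
  proof (induction x rule: generate.induct)
    case one
    then show ?case using g generate.one by simp
  next
    case (incl h)
    have "cj g h \<in> E" using incl p_element_cj g by (auto simp: E_def)
    then show ?case by (rule generate.incl)
  next
    case (inv h)
    have "cj g h \<in> E" using inv p_element_cj g by (auto simp: E_def)
    then show ?case using generate.inv[of "cj g h" E G] g inv Ec by (auto simp: cj_inv subset_iff)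
  next
    case (eng h1 h2)
    then show ?case using generate.eng g generate_in_carrier[OF Ec] by (simp add: cj_mult)
  qed
  have NN: "carrier G \<subseteq> Nor N" using conjN by (auto simp: Nor_def)
  obtain S where S: "sylow_in p (carrier G) S" by (rule sylow_exists[OF p subgroup_self])
  have pS: "p_subgroup p S" and sS: "subgroup S G" and Sc: "S \<subseteq> carrier G"
    using S p_subgroup_subgroup p_subgroup_subset by (auto simp: sylow_in_def)
  define T where "T = S \<inter> N"
  have T: "sylow_in p N T" unfolding T_def by (rule sylow_in_normal_Int[OF p S sN NN])
  have pT: "p_subgroup p T" and sT: "subgroup T G" "T \<subseteq> N" and ndvd: "\<not> p dvd card N div card T"
    using T p_subgroup_subgroup by (auto simp: sylow_in_def)
  have TS: "T \<subseteq> S" by (simp add: T_def)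
  have "T = {\<one>}"
  proof (rule ccontr)
    assume T1: "T \<noteq> {\<one>}"
    have ST: "S \<subseteq> Nor T"
      using subgroup_subset_Nor[OF sS] NN Sc by (auto simp: T_def Nor_def subset_iff)
    obtain U where U: "index_p p T U" and comm: "\<And>k t. k \<in> S \<Longrightarrow> t \<in> T \<Longrightarrow> cj k t \<otimes> inv t \<in> U"
      by (rule invariant_maximal[OF p pS ST sT(1) TS T1]) (rule that)
    obtain f :: "'a \<Rightarrow> nat" and z where z: "z \<in> T" "[f z = 1] (mod p)" and fU: "\<And>u. u \<in> U \<Longrightarrow> [f u = 0] (mod p)"
      and hom: "\<And>a b. a \<in> T \<Longrightarrow> b \<in> T \<Longrightarrow> [f (a \<otimes> b) = f a + f b] (mod p)"
      by (rule index_p_hom[OF p pT U]) (rule that)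
    have UT: "U \<subseteq> T" using U by (simp add: index_p_def)
    \<comment> \<open>Fusion is realised by elements of \<open>S\<close>, and commutators of
      \<open>S\<close> with \<open>T\<close> lie in \<open>U\<close>, where \<open>f\<close>
      vanishes modulo \<open>p\<close>.\<close>
    have stable: "[f (cj g a) = f a] (mod p)" if a: "a \<in> T" and g: "g \<in> N" and ga: "cj g a \<in> T" for a g
    proof -
      have gc: "g \<in> carrier G" using g Nc by blast
      have ac: "a \<in> carrier G" using a Sc TS by blast
      obtain s where s: "s \<in> S" "cj g a = cj s a"
        by (rule sylow_controls_fusion[OF p fr S _ gc]) (use a ga TS in auto)
      have w: "cj g a \<otimes> inv a \<in> U" unfolding s(2) by (rule comm[OF s(1) a])
      have "cj g a = (cj g a \<otimes> inv a) \<otimes> a" using gc ac by (simp add: m_assoc)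
      then have "[f (cj g a) = f (cj g a \<otimes> inv a) + f a] (mod p)" using hom[OF _ a, of "cj g a \<otimes> inv a"] w UT by auto
      also have "[f (cj g a \<otimes> inv a) + f a = 0 + f a] (mod p)" using fU[OF w] by (intro cong_add) auto
      finally show ?thesis by simp
    qed
    obtain V :: "'a \<Rightarrow> nat" where V: "\<And>a b. a \<in> N \<Longrightarrow> b \<in> N \<Longrightarrow> [V (a \<otimes> b) = V a + V b] (mod p)"
      and VT: "\<And>a. a \<in> T \<Longrightarrow> [V a = (card N div card T) * f a] (mod p)"
    proof (rule transfer_exists[OF sN sT, of f p])
      show "[f (a \<otimes> b) = f a + f b] (mod p)" if "a \<in> T" "b \<in> T" for a b by (rule hom[OF that])
      show "[f (cj g a) = f a] (mod p)" if "a \<in> T" "g \<in> N" "cj g a \<in> T" for a g by (rule stable[OF that])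
    qed (rule that)
    have oneN: "\<one> \<in> N" using subgroup.one_closed[OF sN] .
    have V1: "[V \<one> = 0] (mod p)"
    proof -
      have "[V \<one> + 0 = V \<one> + V \<one>] (mod p)" using V[OF oneN oneN] by simp
      then show ?thesis by (metis cong_add_lcancel_nat cong_sym)
    qed
    have Vpow: "[V (a [^] (k::nat)) = k * V a] (mod p)" if "a \<in> N" for a k
    proof (induction k)
      case 0 then show ?case using V1 by simp
    next
      case (Suc k)
      have "[V (a [^] Suc k) = V (a [^] k) + V a] (mod p)" using V subgroup_pow[OF sN] that by simp
      also have "[V (a [^] k) + V a = k * V a + V a] (mod p)" using Suc by (intro cong_add) auto
      finally show ?case by (simp add: add.commute)
    qed
    \<comment> \<open>The order of \<open>x\<close> is prime to \<open>p\<close>, while the values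
      of \<open>V\<close> matter only modulo \<open>p\<close>.\<close>
    have VE: "[V x = 0] (mod p)" if x: "x \<in> E" for x
    proof -
      obtain q k where q: "Factorial_Ring.prime q" "q \<noteq> p" "x [^] (q ^ k) = \<one>"
        using x by (auto simp: E_def p_element_def)
      have "[q ^ k * V x = 0] (mod p)" using Vpow[OF EN[OF x], of "q ^ k"] V1 q(3) by (metis cong_sym cong_trans)
      then have "p dvd q ^ k * V x" by (simp add: cong_0_iff)
      moreover have "\<not> p dvd q ^ k" using p q by (metis prime_dvd_power primes_dvd_imp_eq)
      ultimately show ?thesis using p by (simp add: cong_0_iff prime_dvd_mult_iff)
    qed
    have "[V x = 0] (mod p)" if "x \<in> N" for x
      using that unfolding N_def
    proof (induction x rule: generate.induct)
      case one
      then show ?case by (rule V1)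
    next
      case (incl h)
      then show ?case by (rule VE)
    next
      case (inv h)
      have "h \<in> N" "inv h \<in> N" "h \<in> carrier G" using EN[OF inv] subgroup.m_inv_closed[OF sN] Nc by auto
      then have "[V \<one> = V (inv h) + V h] (mod p)" using V[of "inv h" h] by simp
      moreover have "[V (inv h) + V h = V (inv h) + 0] (mod p)" using VE[OF inv] by (intro cong_add) auto
      ultimately show ?case using V1 by (metis add.right_neutral cong_sym cong_trans)
    next
      case (eng h1 h2)
      have "[V (h1 \<otimes> h2) = V h1 + V h2] (mod p)" using V eng.hyps unfolding N_def by blast
      moreover have "[V h1 + V h2 = 0 + 0] (mod p)" using eng.IH by (intro cong_add)
      ultimately show ?case using cong_trans by fastforce
    qed
    then have "[V z = 0] (mod p)" using z sT by blast
    moreover have "[V z = (card N div card T) * f z] (mod p)" using VT[OF z(1)] .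
    ultimately have "p dvd (card N div card T) * f z" by (metis cong_0_iff cong_sym cong_trans)
    then have "p dvd f z" using p ndvd by (simp add: prime_dvd_mult_iff)
    then have "[f z = 0] (mod p)" by (simp add: cong_0_iff)
    then have "[1 = 0] (mod p)" using z(2) cong_sym cong_trans by blast
    then have "p dvd 1" by (simp add: cong_0_iff)
    then show False using p by (simp add: prime_nat_iff)
  qed
  have "N \<lhd> G" using normal_inv_iff sN conjN by (auto simp: cj_def)
  moreover have "coprime (card N) p"
    using ndvd \<open>T = {\<one>}\<close> p prime_imp_coprime coprime_commute by (metis card.empty card.insert div_by_1 empty_iff finite.emptyI One_nat_def)
  moreover have "\<exists>n. card (rcosets N) = p ^ n"
  proof -
    \<comment> \<open>\<open>G\<close> is the product of \<open>N\<close> and \<open>S\<close>, and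
      the two meet trivially, so the elements of \<open>S\<close> represent the cosets once
      each.\<close>
    have "rcosets N = (\<lambda>s. N #> s) ` S"
    proof (intro equalityI subsetI)
      fix Y assume "Y \<in> rcosets N"
      then obtain g where g: "g \<in> carrier G" "Y = N #> g" by (auto simp: RCOSETS_def)
      obtain c s where cs: "c \<in> N" "s \<in> S" "g = c \<otimes> s"
        by (rule p'_elements_cover[OF p subgroup_self sN Nc NN _ S g(1)]) (use EN in \<open>auto simp: E_def\<close>)
      have "Y = N #> s" using rcos_eq_iff[OF sN g(1), of s] cs g Nc Sc by (auto simp: m_assoc subset_iff)
      then show "Y \<in> (\<lambda>s. N #> s) ` S" using cs by blast
    next
      fix Y assume "Y \<in> (\<lambda>s. N #> s) ` S"
      then show "Y \<in> rcosets N" using Sc by (auto simp: RCOSETS_def)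
    qed
    moreover have "inj_on (\<lambda>s. N #> s) S"
    proof (rule inj_onI)
      fix s t assume st: "s \<in> S" "t \<in> S" "N #> s = N #> t"
      have c: "s \<in> carrier G" "t \<in> carrier G" using st Sc by auto
      have "s \<otimes> inv t \<in> N" using rcos_eq_iff[OF sN c] st by simp
      moreover have "s \<otimes> inv t \<in> S" using st subgroup.m_closed[OF sS] subgroup.m_inv_closed[OF sS] by simp
      ultimately have "s \<otimes> inv t = \<one>" using \<open>T = {\<one>}\<close> by (auto simp: T_def)
      then show "s = t" using c by (simp add: inv_solve_right')
    qed
    ultimately have "card (rcosets N) = card S" by (simp add: card_image)
    then show ?thesis using pS by (auto simp: p_subgroup_def)
  qed
  ultimately show ?thesis by (auto simp: p_nilpotent_def)
qed

section \<open>Weak closure from normalisers, and the theorem\<close>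

text \<open>If \<open>S\<close> contains the conjugate of \<open>H\<close> by \<open>g\<close>, then
  \<open>S\<close> and its conjugate by \<open>g\<close> are Sylow subgroups of the normaliser of
  that conjugate, so some \<open>n\<close> there carries one to the other. Now
  \<open>inv n \<otimes> g\<close> normalises \<open>S\<close>, hence \<open>H\<close>, and since
  \<open>n\<close> preserves the conjugate of \<open>H\<close>, the conjugate is
  \<open>H\<close>.\<close>

lemma weakly_closed_if_Nor:
  assumes p: "Factorial_Ring.prime p" and S: "sylow_in p (carrier G) S"
    and nor: "\<And>H. subgroup H G \<Longrightarrow> H \<subseteq> S \<Longrightarrow> card H = d \<Longrightarrow> Nor S \<subseteq> Nor H"
    and H: "subgroup H G" "H \<subseteq> S" "card H = d"
  shows "weakly_closed S H"
proof -
  have sS: "subgroup S G" and Sc: "S \<subseteq> carrier G"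
    using S p_subgroup_subgroup p_subgroup_subset by (auto simp: sylow_in_def)
  have Hc: "H \<subseteq> carrier G" using H Sc by blast
  have "cj g ` H = H" if g: "g \<in> carrier G" and gH: "cj g ` H \<subseteq> S" for g
  proof -
    let ?H = "cj g ` H" and ?S = "cj g ` S"
    have sH: "subgroup ?H G" using subgroup_cj_image[OF g H(1)] .
    have Hc': "?H \<subseteq> carrier G" using gH Sc by blast
    have "card ?H = d" using card_cj_image[OF g Hc] H by simp
    then have SN: "S \<subseteq> Nor ?H" using nor[OF sH gH] subgroup_subset_Nor[OF sS] by blast
    have SNH: "S \<subseteq> Nor H" using nor[OF H] subgroup_subset_Nor[OF sS] by blast
    have N: "subgroup (Nor ?H) G" by (rule Nor_subgroup[OF Hc'])
    have Nsub: "Nor ?H \<subseteq> carrier G" by (auto simp: Nor_def)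
    have S'N: "?S \<subseteq> Nor ?H"
    proof
      fix y assume "y \<in> ?S"
      then obtain s where s: "s \<in> S" "y = cj g s" by blast
      have sc: "s \<in> carrier G" using s Sc by blast
      have "cj y (cj g h) \<in> ?H" if h: "h \<in> H" for h
      proof -
        have "cj y (cj g h) = cj g (cj s h)"
          using s sc g h Hc by (auto simp: subset_iff) (simp add: cj_def m_assoc inv_mult_group)
        then show ?thesis using Nor_mem SNH s(1) h by blast
      qed
      then show "y \<in> Nor ?H" using s sc g by (auto simp: Nor_def)
    qed
    have sy: "sylow_in p (Nor ?H) S" by (rule sylow_in_mono[OF S subgroup_self N SN Nsub])
    have sy': "sylow_in p (Nor ?H) ?S"
      by (rule sylow_in_mono[OF sylow_in_cj[OF subgroup_self S g] subgroup_self N S'N Nsub])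
    obtain n where n: "n \<in> Nor ?H" "?S = cj n ` S" by (rule sylow_conj[OF p N sy sy'])
    have nc: "n \<in> carrier G" using n Nor_carrier by blast
    have "cj (inv n \<otimes> g) ` S = cj (inv n) ` ?S" using g nc Sc by (simp add: cj_image_image)
    also have "\<dots> = S" unfolding n(2) using nc Sc by (simp add: cj_image_image)
    finally have "inv n \<otimes> g \<in> Nor S" using nc g by (intro NorI_image) auto
    then have "inv n \<otimes> g \<in> Nor H" using nor[OF H] by blast
    then have "cj (inv n) ` ?H = H" using Nor_image Hc nc g cj_image_image by simp
    moreover have "inv n \<in> Nor ?H" using subgroup.m_inv_closed[OF N n(1)] .
    then have "cj (inv n) ` ?H = ?H" using Nor_image Hc' by blast
    ultimately show ?thesis by simp
  qed
  then show ?thesis using H by (simp add: weakly_closed_def)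
qed

end

theorem corollary5p3:
  fixes G :: "('a, 'b) monoid_scheme" and p :: nat and S D :: "'a set"
  assumes "group G" and "finite (carrier G)"
    and "Factorial_Ring.prime p" and "odd p" and "p dvd order G"
    and "coprime (p - 1) (order G)"
    and "sylow_subgroup G p S"
    and "subgroup D G" and "D \<subseteq> S" and "1 < card D" and "card D < card S"
    and "\<And>H. subgroup H G \<Longrightarrow> H \<subseteq> S \<Longrightarrow> card H = card D \<Longrightarrow>
           comm_group (G\<lparr>carrier := H\<rparr>) \<and> subnormalizer_condition G S H"
  shows "p_nilpotent G p"
proof -
  interpret finite_group G using assms(1,2) by (simp add: finite_group_def finite_group_axioms_def)
  note p = assms(3)
  have sS: "subgroup S G" using assms(7) by (simp add: sylow_subgroup_def)
  have S: "sylow_in p (carrier G) S"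
    using assms(7) by (intro sylow_inI[OF p subgroup_self])
      (auto simp: sylow_subgroup_def order_def subgroup.subset)
  have "p_subgroup p S" using S by (simp add: sylow_in_def)
  then have "p_subgroup p D" using p_subgroup_mono assms(8,9) p by blast
  then obtain m where m: "card D = p ^ m" by (auto simp: p_subgroup_def)
  \<comment> \<open>The condition is used with \<open>K = S\<close>, the whole Sylow
    subgroup.\<close>
  have nor: "Nor S \<subseteq> Nor H" if H: "subgroup H G" "H \<subseteq> S" "card H = card D" for H
    using assms(12)[OF H] H sS by (simp add: subnormalizer_condition_def normalizer_eq_Nor)
  interpret weakly_closed_abelian G p m S
  proof unfold_locales
    show "0 < m" using m assms(10) by (cases m) auto
    show "p ^ m < card S" using m assms(11) by simp
    show "weakly_closed S H" if "subgroup H G" "H \<subseteq> S" "card H = p ^ m" for H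
      using weakly_closed_if_Nor[OF p S nor that(1,2)] that m by simp
    show "a \<otimes>\<^bsub>G\<^esub> b = b \<otimes>\<^bsub>G\<^esub> a" if "subgroup H G" "H \<subseteq> S" "card H = p ^ m" "a \<in> H" "b \<in> H" for H a b
      using assms(12)[OF that(1,2)] that m comm_groupE(4)[of "G\<lparr>carrier := H\<rparr>" a b] by simp
  qed (use p assms(4,6) S in auto)
  show ?thesis using p_nilpotent_if_p'_central[OF p p'_central_p_subgroup] .
qed

end
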